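(* Let $\Omega\subset\mathbb{R}^2$ be a bounded, simply connected open set containing the origin $O$, let $\boldsymbol{E}\in\mathcal{A}(\Omega,\mathrm{Sym})$ be a singular strain field, and let $N\in\mathcal{E}(\Omega)$ be an incompatibility field with the representation $N=\sum_{\alpha\in\mathbb{N}^2,\,|\alpha|\le\deg(N)}N^\alpha\partial^\alpha\delta_O$, $N^\alpha\in\mathbb{R}$. Write $\boldsymbol{E}_0=\boldsymbol{E}|_{\Omega-O}$ (a smooth map on $\Omega-O$). Consider the conditions (i) $\operatorname{curl}\operatorname{curl}\boldsymbol{E}_0=0$ on $\Omega-O$; (ii) for all $\boldsymbol{x}\in\Omega-O$, $$\int_{\partial B_\epsilon}\Big\{\boldsymbol{E}_0(\boldsymbol{y})\,d\boldsymbol{y}+\big((\boldsymbol{y}-\boldsymbol{x})\times\boldsymbol{e}_3\big)\,\langle\operatorname{curl}\boldsymbol{E}_0(\boldsymbol{y}),d\boldsymbol{y}\rangle\Big\}=-N^{(0,1)}\boldsymbol{e}_1+N^{(1,0)}\boldsymbol{e}_2+N^{(0,0)}\,\boldsymbol{e}_3\times\boldsymbol{x},$$ where $B_\epsilon$ is any open disc of radius $\epsilon>0$ centred at $O$ with $\overline{B_\epsilon}\subset\Omega$; (iii) $\deg(N)\le\deg(\boldsymbol{E})+2$. Then: (a) The incompatibility equation $\operatorname{Curl}\operatorname{Curl}\boldsymbol{E}=N$ (in the sense of distributions on $\Omega$) implies (i), (ii) and (iii). (b) If $\deg(\boldsymbol{E})<0$, then $\operatorname{Curl}\operatorname{Curl}\boldsymbol{E}=N$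 is equivalent to (i), (ii) and (iii) together.
   Context: $\Omega-O$ means $\Omega\setminus\{O\}$; $\mathrm{Sym}$ is the space of symmetric linear maps $\mathbb{R}^2\to\mathbb{R}^2$; $\mathbb{N}$ includes $0$. $\mathcal{A}(\Omega,\mathrm{Sym})$ is the set of $\mathrm{Sym}$-valued distributions on $\Omega$ whose singular support is contained in $\{O\}$; their restriction to $\Omega-O$ is given by a smooth function and is identified with it. $\mathcal{E}(\Omega)$ is the set of scalar distributions on $\Omega$ with support contained in $\{O\}$; each has a unique representation as a finite combination of $\partial^\alpha\delta_O$, $|\alpha|\le\deg(N)$, where $\delta_O$ is the Dirac measure at $O$; coefficients not appearing are taken to be zero. For a vector distribution, $\operatorname{Curl}\boldsymbol{v}=\partial_1v_2-\partial_2v_1$ (a scalar); for a tensor distribution, $\operatorname{Curl}\boldsymbol{V}$ is the vector with $(\operatorname{Curl}\boldsymbol{V})_i=\partial_1V_{i2}-\partial_2V_{i1}$. Thus $\operatorname{Curl}\operatorname{Curl}\boldsymbol{E}=\partial_1\partial_1E_{22}-2\partial_1\partial_2E_{12}+\partial_2\partial_2E_{11}$. $\operatorname{curl}$ denotes the same operators applied classically to smooth functions. For $\boldsymbol{v}\in\mathbb{R}^2$, $\boldsymbol{e}_3\times\boldsymbol{v}=-v_2\boldsymbol{e}_1+v_1\boldsymbol{e}_2$ and $\boldsymbol{v}\times\boldsymbol{e}_3=-\boldsymbol{e}_3\times\boldsymbol{v}$. The line integral is over the circle $\partial B_\epsilon$ traversed counterclockwise, $d\boldsymbol{y}$ being the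 vector line element and $\boldsymbol{E}_0(\boldsymbol{y})\,d\boldsymbol{y}$ the matrix applied to it. Degree of divergence (with respect to $O$): choose an open ball $B_r\subset\Omega$ centred at $O$. For a test function $\phi$ on $B_r$ and $0<\lambda<1$ put $\phi_\lambda(\boldsymbol{x})=\lambda^{-2}\phi(\boldsymbol{x}/\lambda)$ and $(T|_{B_r})_\lambda(\phi)=T(\phi_\lambda)$. The scaling degree is $\operatorname{sd}(T)=\inf\{k\in\mathbb{R}:\lim_{\lambda\to0}\lambda^k(T|_{B_r})_\lambda=0 \text{ in the sense of distributions}\}$ and $\deg(T)=\operatorname{sd}(T)-2$ (with value $-\infty$ if the infimum is over all of $\mathbb{R}$). For tensor valued distributions the same definition is used with tensor valued test functions (equivalently, the maximum over components). *)

theory Defs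
  imports "HOL-Analysis.Analysis"
begin

section \<open>Smooth functions and test functions on the plane\<close>

definition pd :: "2 \<Rightarrow> (real^2 \<Rightarrow> 'v::real_normed_vector) \<Rightarrow> real^2 \<Rightarrow> 'v" where
  "pd i f = (\<lambda>x. frechet_derivative f (at x) (axis i 1))"

(* C^k regularity; meant for open sets S, where pd depends on f only through its values on S. *)
fun Ck_on :: "nat \<Rightarrow> (real^2) set \<Rightarrow> (real^2 \<Rightarrow> 'v::real_normed_vector) \<Rightarrow> bool" where
  "Ck_on 0 S f \<longleftrightarrow> continuous_on S f"
| "Ck_on (Suc k) S f \<longleftrightarrow> (\<forall>x\<in>S. f differentiable (at x)) \<and> (\<forall>i. Ck_on k S (pd i f))"

definition smooth_on :: "(real^2) set \<Rightarrow> (real^2 \<Rightarrow> 'v::real_normed_vector) \<Rightarrow> bool" where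
  "smooth_on S f \<longleftrightarrow> (\<forall>k. Ck_on k S f)"

type_synonym multiindex = "nat \<times> nat"

definition mi_order :: "multiindex \<Rightarrow> nat" where
  "mi_order \<alpha> = fst \<alpha> + snd \<alpha>"

definition mpd :: "multiindex \<Rightarrow> (real^2 \<Rightarrow> 'v::real_normed_vector) \<Rightarrow> real^2 \<Rightarrow> 'v" where
  "mpd \<alpha> f = (pd 1 ^^ fst \<alpha>) ((pd 2 ^^ snd \<alpha>) f)"

definition tsupport :: "(real^2 \<Rightarrow> 'v::real_normed_vector) \<Rightarrow> (real^2) set" where
  "tsupport \<phi> = closure {x. \<phi> x \<noteq> 0}"

(* Test functions on U are defined on the whole plane (extended by zero), so that restricting a
   distribution to a smaller open set amounts to evaluating it on fewer test functions. *)
definition test_functions :: "(real^2) set \<Rightarrow> (real^2 \<Rightarrow> 'v::real_normed_vector) set" where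
  "test_functions U = {\<phi>. smooth_on UNIV \<phi> \<and> compact (tsupport \<phi>) \<and> tsupport \<phi> \<subseteq> U}"


section \<open>Distributions\<close>

(* A 'v-valued distribution is a continuous linear map from scalar test functions to 'v; its
   components are obtained by taking components of the values. Values on functions that are not
   test functions on the domain are irrelevant; see dist_eq. *)
type_synonym 'v dist = "(real^2 \<Rightarrow> real) \<Rightarrow> 'v"

(* Continuity is expressed by the usual seminorm estimates on each compact subset. *)
definition distribution_on :: "(real^2) set \<Rightarrow> 'v::real_normed_vector dist \<Rightarrow> bool" where
  "distribution_on U T \<longleftrightarrow>
     (\<forall>\<phi>\<in>test_functions U. \<forall>\<psi>\<in>test_functions U. T (\<lambda>x. \<phi> x + \<psi> x) = T \<phi> + T \<psi>) \<and>
     (\<forall>c. \<forall>\<phi>\<in>test_functions U. T (\<lambda>x. c * \<phi> x) = c *\<^sub>R T \<phi>) \<and>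
     (\<forall>K. compact K \<and> K \<subseteq> U \<longrightarrow>
        (\<exists>C m. \<forall>\<phi>\<in>test_functions U. tsupport \<phi> \<subseteq> K \<longrightarrow>
           norm (T \<phi>) \<le> C * (\<Sum>\<alpha> | mi_order \<alpha> \<le> m. SUP x. \<bar>mpd \<alpha> \<phi> x\<bar>)))"

definition dist_eq :: "(real^2) set \<Rightarrow> 'v dist \<Rightarrow> 'v dist \<Rightarrow> bool" where
  "dist_eq U S T \<longleftrightarrow> (\<forall>\<phi>\<in>test_functions U. S \<phi> = T \<phi>)"

definition dist_support :: "(real^2) set \<Rightarrow> 'v::real_normed_vector dist \<Rightarrow> (real^2) set" where
  "dist_support U T =
     {x\<in>U. \<not> (\<exists>W. open W \<and> x \<in> W \<and> W \<subseteq> U \<and> dist_eq W T (\<lambda>_. 0))}"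

definition given_by_smooth ::
  "(real^2) set \<Rightarrow> 'v::euclidean_space dist \<Rightarrow> (real^2 \<Rightarrow> 'v) \<Rightarrow> bool" where
  "given_by_smooth U T f \<longleftrightarrow>
     smooth_on U f \<and> dist_eq U T (\<lambda>\<phi>. LINT x|lborel. \<phi> x *\<^sub>R f x)"

definition singular_support :: "(real^2) set \<Rightarrow> 'v::euclidean_space dist \<Rightarrow> (real^2) set" where
  "singular_support U T =
     {x\<in>U. \<not> (\<exists>W f. open W \<and> x \<in> W \<and> W \<subseteq> U \<and> given_by_smooth W T f)}"

definition dpd :: "2 \<Rightarrow> real dist \<Rightarrow> real dist" where
  "dpd i T = (\<lambda>\<phi>. - T (pd i \<phi>))"

definition dmpd :: "multiindex \<Rightarrow> real dist \<Rightarrow> real dist" where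
  "dmpd \<alpha> T = (dpd 1 ^^ fst \<alpha>) ((dpd 2 ^^ snd \<alpha>) T)"

definition dirac :: "real dist" where
  "dirac \<phi> = \<phi> 0"

definition sym_fields :: "(real^2) set \<Rightarrow> (real^2^2) dist set" where
  "sym_fields \<Omega> = {E. distribution_on \<Omega> E \<and>
     (\<forall>\<phi>\<in>test_functions \<Omega>. transpose (E \<phi>) = E \<phi>) \<and> singular_support \<Omega> E \<subseteq> {0}}"

definition point_fields :: "(real^2) set \<Rightarrow> real dist set" where
  "point_fields \<Omega> = {N. distribution_on \<Omega> N \<and> dist_support \<Omega> N \<subseteq> {0}}"


section \<open>Degree of divergence\<close>

(* Action of a 'v-valued distribution on a 'v-valued test function, the sum over components of
   the scalar pairings. For scalar distributions this is T \<Phi> itself. *)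
definition pairing :: "'v::euclidean_space dist \<Rightarrow> (real^2 \<Rightarrow> 'v) \<Rightarrow> real" where
  "pairing T \<Phi> = (\<Sum>b\<in>Basis. T (\<lambda>x. \<Phi> x \<bullet> b) \<bullet> b)"

definition rescale :: "real \<Rightarrow> (real^2 \<Rightarrow> 'v::real_normed_vector) \<Rightarrow> real^2 \<Rightarrow> 'v" where
  "rescale l \<Phi> = (\<lambda>x. (1 / l^2) *\<^sub>R \<Phi> ((1 / l) *\<^sub>R x))"

(* The radius r of the chosen ball around the origin is a parameter. *)
definition scaling_degree :: "real \<Rightarrow> 'v::euclidean_space dist \<Rightarrow> ereal" where
  "scaling_degree r T = Inf (ereal ` {k. \<forall>\<Phi>\<in>test_functions (ball 0 r).
     ((\<lambda>l. l powr k * pairing T (rescale l \<Phi>)) \<longlongrightarrow> 0) (at_right 0)})"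

definition div_degree :: "real \<Rightarrow> 'v::euclidean_space dist \<Rightarrow> ereal" where
  "div_degree r T = scaling_degree r T - 2"

lemma pairing_real: "pairing T \<Phi> = T \<Phi>" for T :: "real dist"
  by (simp add: pairing_def)


section \<open>Curl operators, distributional and classical\<close>

definition dCurl_vec :: "(real^2) dist \<Rightarrow> real dist" where
  "dCurl_vec v = (\<lambda>\<phi>. dpd 1 (\<lambda>\<psi>. v \<psi> $ 2) \<phi> - dpd 2 (\<lambda>\<psi>. v \<psi> $ 1) \<phi>)"

definition dCurl_mat :: "(real^2^2) dist \<Rightarrow> (real^2) dist" where
  "dCurl_mat V = (\<lambda>\<phi>. \<chi> i. dpd 1 (\<lambda>\<psi>. V \<psi> $ i $ 2) \<phi> - dpd 2 (\<lambda>\<psi>. V \<psi> $ i $ 1) \<phi>)"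

definition curl_vec :: "(real^2 \<Rightarrow> real^2) \<Rightarrow> real^2 \<Rightarrow> real" where
  "curl_vec v = (\<lambda>x. pd 1 (\<lambda>y. v y $ 2) x - pd 2 (\<lambda>y. v y $ 1) x)"

definition curl_mat :: "(real^2 \<Rightarrow> real^2^2) \<Rightarrow> real^2 \<Rightarrow> real^2" where
  "curl_mat V = (\<lambda>x. \<chi> i. pd 1 (\<lambda>y. V y $ i $ 2) x - pd 2 (\<lambda>y. V y $ i $ 1) x)"


section \<open>Line integrals over circles\<close>

(* e_3 x v for a planar vector v *)
definition e3_cross :: "real^2 \<Rightarrow> real^2" where
  "e3_cross v = vector [- (v $ 2), v $ 1]"

definition cross_e3 :: "real^2 \<Rightarrow> real^2" where
  "cross_e3 v = - e3_cross v"

definition circle :: "real \<Rightarrow> real \<Rightarrow> real^2" where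
  "circle \<epsilon> t = vector [\<epsilon> * cos (2 * pi * t), \<epsilon> * sin (2 * pi * t)]"

(* F y d is the value at the point y of the integrand applied to the line element d. *)
definition line_integral ::
  "(real \<Rightarrow> real^2) \<Rightarrow> (real^2 \<Rightarrow> real^2 \<Rightarrow> 'v::real_normed_vector) \<Rightarrow> 'v" where
  "line_integral \<gamma> F =
     integral {0..1} (\<lambda>t. F (\<gamma> t) (vector_derivative \<gamma> (at t within {0..1})))"

end

theory Submission
  imports Defs
begin

text \<open>
  Write Inc for the distribution Curl Curl E. Integration by parts on the punctured domain shows that
  Inc is there the smooth function curl curl E0, so by the fundamental lemma of the calculus of variations
  (i) says that Inc is supported at the origin (lemma curl_curl_zero_iff). This is necessary
  for Inc = N, and (iii) is necessary because two derivatives raise the scaling degree by at most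
  two (incompatibility_rescale_tendsto).

  Condition (ii) is the equation Inc = N tested on a cutoff \<eta> times an affine function a. Indeed
  every term of Inc (\<eta> a) contains a derivative of \<eta>, because a has no second derivatives; hence only
  values of E away from the origin enter, and integrating by parts gives the pairing of the gradient of
  \<eta> with the 1-form a c - a_1 E_2 + a_2 E_1, where c = curl E0, E_i is row i of E0 and a_i a partial
  derivative of a (incompatibility_cutoff_affine). Under (i) this form is closed, so its circulation over circles
  around the origin does not depend on the radius (circulation_constant); for a radial \<eta>, polar coordinates
  then identify the pairing with that circulation (cutoff_gradient_pairing). The components of
  the line integral in (ii) are exactly such circulations (line_integral_eq_circulation), and N (\<eta> a) is
  read off from the coefficients of order at most one. Letting x vary gives three affine functions,
  and so (ii) is equivalent to the three identities for a = 1, y_1, y_2.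

  For the converse with deg E < 0, condition (iii) forces N to have order at most one. What remains is that
  Inc also depends only on the first order Taylor polynomial of a test function at the origin
  (incompatibility_depends_on_first_order_jet). Since Inc is supported at the origin, the cutoff may be
  contracted freely. On monomials of degree at least two the scaling degree of E, being below 2, makes the
  result tend to 0; on monomials of high degree times any smooth function the finite order of E on
  compact sets does. Hadamard's lemma reduces all intermediate cases to these two. Thus Inc and N agree as
  soon as they agree on cut off affine functions, which is (ii).
\<close>


section \<open>Calculus of smooth functions on the plane\<close>

lemma pd_eqI: "(f has_derivative f') (at x) \<Longrightarrow> pd i f x = f' (axis i 1)"
  by (metis frechet_derivative_at pd_def)

lemma has_derivative_pd:
  fixes f :: "real^2 \<Rightarrow> 'v::real_normed_vector"
  assumes "f differentiable (at x)"
  shows "(f has_derivative (\<lambda>h. (h $ 1) *\<^sub>R pd 1 f x + (h $ 2) *\<^sub>R pd 2 f x)) (at x)"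
proof -
  let ?D = "frechet_derivative f (at x)"
  have D: "(f has_derivative ?D) (at x)"
    using assms frechet_derivative_works by blast
  have lin: "linear ?D"
    using assms linear_frechet_derivative by blast
  have "?D h = (h $ 1) *\<^sub>R pd 1 f x + (h $ 2) *\<^sub>R pd 2 f x" for h
  proof -
    have "h = (h $ 1) *\<^sub>R axis 1 1 + (h $ 2) *\<^sub>R axis 2 1"
      by (simp add: vec_eq_iff forall_2 axis_def)
    then have "?D h = ?D ((h $ 1) *\<^sub>R axis 1 1 + (h $ 2) *\<^sub>R axis 2 1)"
      by simp
    then show ?thesis
      by (simp add: linear_add[OF lin] linear_cmul[OF lin] pd_def)
  qed
  then have "?D = (\<lambda>h. (h $ 1) *\<^sub>R pd 1 f x + (h $ 2) *\<^sub>R pd 2 f x)"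
    by blast
  then show ?thesis using D by simp
qed

lemma pd_const [simp]: "pd i (\<lambda>x. c) = (\<lambda>x. 0)"
  by (simp add: pd_def)

lemma pd_coord: "pd i (\<lambda>x. x $ j) x = (if i = j then 1 else 0)"
proof -
  have "((\<lambda>x::real^2. x $ j) has_derivative (\<lambda>h. h $ j)) (at x)"
    by (rule bounded_linear.has_derivative[OF bounded_linear_vec_nth has_derivative_ident])
  from pd_eqI[OF this] show ?thesis by (auto simp: axis_def)
qed

lemma pd_add:
  assumes "f differentiable (at x)" "g differentiable (at x)"
  shows "pd i (\<lambda>x. f x + g x) x = pd i f x + pd i g x"
proof -
  have "((\<lambda>x. f x + g x) has_derivative
     (\<lambda>h. frechet_derivative f (at x) h + frechet_derivative g (at x) h)) (at x)"
    using assms[unfolded frechet_derivative_works] by (rule has_derivative_add)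
  from pd_eqI[OF this] show ?thesis by (simp add: pd_def)
qed

lemma pd_mult:
  fixes f g :: "real^2 \<Rightarrow> real"
  assumes "f differentiable (at x)" "g differentiable (at x)"
  shows "pd i (\<lambda>x. f x * g x) x = pd i f x * g x + f x * pd i g x"
proof -
  have "((\<lambda>x. f x * g x) has_derivative
     (\<lambda>h. f x * frechet_derivative g (at x) h + frechet_derivative f (at x) h * g x)) (at x)"
    using assms[unfolded frechet_derivative_works] by (rule has_derivative_mult)
  from pd_eqI[OF this] show ?thesis by (simp add: pd_def)
qed

lemma pd_linear:
  assumes "bounded_linear L" "f differentiable (at x)"
  shows "pd i (\<lambda>x. L (f x)) x = L (pd i f x)"
proof -
  have "((\<lambda>x. L (f x)) has_derivative (\<lambda>h. L (frechet_derivative f (at x) h))) (at x)"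
    by (rule bounded_linear.has_derivative[OF assms(1) assms(2)[unfolded frechet_derivative_works]])
  from pd_eqI[OF this] show ?thesis by (simp add: pd_def)
qed

lemma differentiable_linear:
  assumes "bounded_linear L" "f differentiable (at x)"
  shows "(\<lambda>x. L (f x)) differentiable (at x)"
  using assms unfolding differentiable_def by (metis bounded_linear.has_derivative)

lemma pd_cong_open:
  assumes "open S" "x \<in> S" "\<And>y. y \<in> S \<Longrightarrow> f y = g y"
  shows "pd i f x = pd i g x"
proof -
  have "(f has_derivative D) (at x) \<longleftrightarrow> (g has_derivative D) (at x)" for D
    using has_derivative_transform_within_open[OF _ assms(1,2), of f D UNIV g]
      has_derivative_transform_within_open[OF _ assms(1,2), of g D UNIV f] assms(3) by auto
  then show ?thesis by (simp add: pd_def frechet_derivative_def)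
qed

lemma differentiable_cong_open:
  assumes "open S" "x \<in> S" "\<And>y. y \<in> S \<Longrightarrow> f y = g y" "f differentiable (at x)"
  shows "g differentiable (at x)"
  using assms unfolding differentiable_def by (metis has_derivative_transform_within_open)

lemma pd_rescaled:
  fixes f :: "real^2 \<Rightarrow> 'v::real_normed_vector"
  assumes "\<And>x. f differentiable (at x)"
  shows "pd i (\<lambda>x. f (c *\<^sub>R x)) = (\<lambda>x. c *\<^sub>R pd i f (c *\<^sub>R x))"
    and "(\<lambda>x. f (c *\<^sub>R x)) differentiable (at x)"
proof -
  have D: "((\<lambda>x. f (c *\<^sub>R x)) has_derivative (\<lambda>h. frechet_derivative f (at (c *\<^sub>R x)) (c *\<^sub>R h))) (at x)" for x
    by (rule has_derivative_compose[OF _ assms[unfolded frechet_derivative_works]])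
      (auto intro!: derivative_intros)
  show "(\<lambda>x. f (c *\<^sub>R x)) differentiable (at x)" using D differentiable_def by blast
  show "pd i (\<lambda>x. f (c *\<^sub>R x)) = (\<lambda>x. c *\<^sub>R pd i f (c *\<^sub>R x))"
    using pd_eqI[OF D] linear_cmul[OF linear_frechet_derivative[OF assms]]
    by (auto simp: pd_def)
qed

lemma Ck_on_cong:
  assumes "open S" "\<And>x. x \<in> S \<Longrightarrow> f x = g x" "Ck_on k S f"
  shows "Ck_on k S g"
  using assms(2,3)
proof (induction k arbitrary: f g)
  case 0
  then show ?case by (metis Ck_on.simps(1) continuous_on_cong)
next
  case (Suc k)
  have "Ck_on k S (pd i g)" for i
    using Suc.IH[of "pd i f" "pd i g"] Suc.prems pd_cong_open[OF assms(1), of _ f g] by simp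
  moreover have "g differentiable (at x)" if "x \<in> S" for x
    using Suc.prems that differentiable_cong_open[OF assms(1) that, of f g] by simp
  ultimately show ?case by simp
qed

lemma Ck_on_subset: "Ck_on k S f \<Longrightarrow> T \<subseteq> S \<Longrightarrow> Ck_on k T f"
proof (induction k arbitrary: f)
  case 0
  then show ?case by (metis Ck_on.simps(1) continuous_on_subset)
next
  case (Suc k)
  then show ?case by (metis Ck_on.simps(2) subsetD)
qed

lemma Ck_on_differentiable:
  "(\<And>x. x \<in> S \<Longrightarrow> f differentiable (at x)) \<Longrightarrow> continuous_on S f"
  by (meson continuous_at_imp_continuous_on differentiable_imp_continuous_within)

lemma Ck_on_Suc: "Ck_on (Suc k) S f \<Longrightarrow> Ck_on k S f"
proof (induction k arbitrary: f)
  case 0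
  then show ?case by (auto intro: Ck_on_differentiable)
next
  case (Suc k)
  then show ?case by (metis Ck_on.simps(2))
qed

lemma Ck_on_const: "Ck_on k S (\<lambda>x. c)"
  by (induction k arbitrary: c) auto

lemma Ck_on_add:
  assumes "open S" "Ck_on k S f" "Ck_on k S g"
  shows "Ck_on k S (\<lambda>x. f x + g x)"
  using assms(2,3)
proof (induction k arbitrary: f g)
  case 0
  then show ?case by (simp add: continuous_on_add)
next
  case (Suc k)
  have "Ck_on k S (pd i (\<lambda>x. f x + g x))" for i
    by (rule Ck_on_cong[OF assms(1), of "\<lambda>x. pd i f x + pd i g x"])
      (use Suc in \<open>auto simp: pd_add\<close>)
  then show ?case using Suc.prems by auto
qed

lemma Ck_on_mult:
  fixes f g :: "real^2 \<Rightarrow> real"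
  assumes "open S" "Ck_on k S f" "Ck_on k S g"
  shows "Ck_on k S (\<lambda>x. f x * g x)"
  using assms(2,3)
proof (induction k arbitrary: f g)
  case 0
  then show ?case by (simp add: continuous_on_mult)
next
  case (Suc k)
  have "Ck_on k S (pd i (\<lambda>x. f x * g x))" for i
  proof (rule Ck_on_cong[OF assms(1), of "\<lambda>x. pd i f x * g x + f x * pd i g x"])
    show "Ck_on k S (\<lambda>x. pd i f x * g x + f x * pd i g x)"
      using Suc.prems Ck_on_Suc[OF Suc.prems(1)] Ck_on_Suc[OF Suc.prems(2)]
      by (intro Ck_on_add[OF assms(1)] Suc.IH) auto
  qed (use Suc in \<open>auto simp: pd_mult\<close>)
  then show ?case using Suc.prems by auto
qed

lemma Ck_on_linear:
  assumes "open S" "bounded_linear L" "Ck_on k S f"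
  shows "Ck_on k S (\<lambda>x. L (f x))"
  using assms(3)
proof (induction k arbitrary: f)
  case 0
  then show ?case by (auto intro: bounded_linear.continuous_on[OF assms(2)])
next
  case (Suc k)
  have "Ck_on k S (pd i (\<lambda>x. L (f x)))" for i
    by (rule Ck_on_cong[OF assms(1), of "\<lambda>x. L (pd i f x)"])
      (use Suc in \<open>auto simp: pd_linear[OF assms(2)]\<close>)
  then show ?case using Suc.prems by (auto intro: differentiable_linear[OF assms(2)])
qed

lemma smooth_onD_Ck: "smooth_on S f \<Longrightarrow> Ck_on k S f"
  by (simp add: smooth_on_def)

lemma smooth_on_iff:
  "smooth_on S f \<longleftrightarrow> (\<forall>x\<in>S. f differentiable (at x)) \<and> (\<forall>i. smooth_on S (pd i f))"
  (is "_ \<longleftrightarrow> ?R")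
proof
  assume "smooth_on S f"
  then have "Ck_on (Suc k) S f" for k by (simp add: smooth_on_def)
  then show ?R by (auto simp: smooth_on_def)
next
  assume ?R
  then have "Ck_on (Suc k) S f" for k by (simp add: smooth_on_def)
  then show "smooth_on S f" using Ck_on_Suc by (metis smooth_on_def)
qed

lemma smooth_on_differentiable: "smooth_on S f \<Longrightarrow> x \<in> S \<Longrightarrow> f differentiable (at x)"
  by (simp add: smooth_on_iff[of S f])

lemma smooth_on_pd: "smooth_on S f \<Longrightarrow> smooth_on S (pd i f)"
  by (simp add: smooth_on_iff[of S f])

lemma smooth_on_continuous_on: "smooth_on S f \<Longrightarrow> continuous_on S f"
  by (meson Ck_on_differentiable smooth_on_differentiable)

lemma smooth_on_cong:
  "open S \<Longrightarrow> (\<And>x. x \<in> S \<Longrightarrow> f x = g x) \<Longrightarrow> smooth_on S f \<Longrightarrow> smooth_on S g"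
  using Ck_on_cong unfolding smooth_on_def by blast

lemma smooth_on_subset: "smooth_on S f \<Longrightarrow> T \<subseteq> S \<Longrightarrow> smooth_on T f"
  using Ck_on_subset unfolding smooth_on_def by blast

lemma smooth_on_const: "smooth_on S (\<lambda>x. c)"
  by (simp add: smooth_on_def Ck_on_const)

lemma smooth_on_add:
  "open S \<Longrightarrow> smooth_on S f \<Longrightarrow> smooth_on S g \<Longrightarrow> smooth_on S (\<lambda>x. f x + g x)"
  by (simp add: smooth_on_def Ck_on_add)

lemma smooth_on_mult:
  fixes f g :: "real^2 \<Rightarrow> real"
  shows "open S \<Longrightarrow> smooth_on S f \<Longrightarrow> smooth_on S g \<Longrightarrow> smooth_on S (\<lambda>x. f x * g x)"
  by (simp add: smooth_on_def Ck_on_mult)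

lemma smooth_on_linear:
  "open S \<Longrightarrow> bounded_linear L \<Longrightarrow> smooth_on S f \<Longrightarrow> smooth_on S (\<lambda>x. L (f x))"
  by (simp add: smooth_on_def Ck_on_linear)

lemma smooth_on_minus: "open S \<Longrightarrow> smooth_on S f \<Longrightarrow> smooth_on S (\<lambda>x. - f x)"
  by (rule smooth_on_linear[OF _ bounded_linear_minus[OF bounded_linear_ident]])

lemma smooth_on_diff:
  "open S \<Longrightarrow> smooth_on S f \<Longrightarrow> smooth_on S g \<Longrightarrow> smooth_on S (\<lambda>x. f x - g x)"
  using smooth_on_add[OF _ _ smooth_on_minus, of S f g] by simp

lemma smooth_on_cmult:
  fixes f :: "real^2 \<Rightarrow> real"
  shows "open S \<Longrightarrow> smooth_on S f \<Longrightarrow> smooth_on S (\<lambda>x. c * f x)"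
  by (rule smooth_on_mult[OF _ smooth_on_const])

lemma smooth_on_coord: "smooth_on S (\<lambda>x. x $ j)"
  unfolding smooth_on_iff[of S "\<lambda>x. x $ j"]
proof safe
  show "(\<lambda>x. x $ j) differentiable (at x)" for x :: "real^2"
    by (rule differentiable_linear[OF bounded_linear_vec_nth]) simp
  show "smooth_on S (pd i (\<lambda>x. x $ j))" for i
    by (simp add: pd_coord[abs_def] smooth_on_const)
qed

lemma smooth_on_power:
  fixes f :: "real^2 \<Rightarrow> real"
  shows "open S \<Longrightarrow> smooth_on S f \<Longrightarrow> smooth_on S (\<lambda>x. f x ^ n)"
  by (induction n) (auto intro: smooth_on_mult smooth_on_const)

lemma smooth_on_rescaled:
  assumes "smooth_on UNIV f"
  shows "smooth_on UNIV (\<lambda>x. f (c *\<^sub>R x))"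
proof -
  have "Ck_on k UNIV (\<lambda>x. f (c *\<^sub>R x))" for k
    using assms
  proof (induction k arbitrary: f)
    case 0
    have "continuous_on UNIV (f \<circ> (\<lambda>x. c *\<^sub>R x))"
    by (rule continuous_on_compose[OF _ continuous_on_subset[OF smooth_on_continuous_on[OF 0]]])
        (auto intro!: continuous_on_scaleR continuous_on_const continuous_on_id)
    then show ?case by (simp add: o_def)
  next
    case (Suc k)
    have d: "\<And>x. f differentiable (at x)" using Suc.prems smooth_on_differentiable by blast
    have "Ck_on k UNIV (\<lambda>x. c *\<^sub>R pd i f (c *\<^sub>R x))" for i
      by (rule Ck_on_linear[OF open_UNIV bounded_linear_scaleR_right
            Suc.IH[OF smooth_on_pd[OF Suc.prems]]])
    then show ?case using pd_rescaled[OF d] by simp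
  qed
  then show ?thesis by (simp add: smooth_on_def)
qed


lemma Ck_on_Un:
  "open S \<Longrightarrow> open T \<Longrightarrow> Ck_on k S f \<Longrightarrow> Ck_on k T f \<Longrightarrow> Ck_on k (S \<union> T) f"
  by (induction k arbitrary: f) (auto intro: continuous_on_open_Un)

lemma smooth_on_Un:
  "open S \<Longrightarrow> open T \<Longrightarrow> smooth_on S f \<Longrightarrow> smooth_on T f \<Longrightarrow> smooth_on (S \<union> T) f"
  by (simp add: smooth_on_def Ck_on_Un)


section \<open>Test functions\<close>

lemma zero_outside_tsupport: "x \<notin> tsupport f \<Longrightarrow> f x = 0"
  using closure_subset[of "{x. f x \<noteq> 0}"] by (auto simp: tsupport_def)

lemma tsupport_subsetI:
  assumes "closed K" and zero: "\<And>x. x \<notin> K \<Longrightarrow> f x = 0"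
  shows "tsupport f \<subseteq> K"
  unfolding tsupport_def
proof (rule closure_minimal[OF _ assms(1)], rule subsetI)
  fix x assume "x \<in> {x. f x \<noteq> 0}"
  then show "x \<in> K" using zero[of x] by (cases "x \<in> K") simp_all
qed

lemma closed_tsupport [simp]: "closed (tsupport f)"
  by (simp add: tsupport_def)

lemma tsupport_pd: "tsupport (pd i f) \<subseteq> tsupport f"
proof (rule tsupport_subsetI)
  fix x assume "x \<notin> tsupport f"
  then have "pd i f x = pd i (\<lambda>x. 0) x"
    by (intro pd_cong_open[of "- tsupport f"]) (auto simp: zero_outside_tsupport)
  then show "pd i f x = 0" by simp
qed simp

lemma test_functionsI:
  assumes "smooth_on UNIV f" "compact K" "K \<subseteq> U" "\<And>x. x \<notin> K \<Longrightarrow> f x = 0"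
  shows "f \<in> test_functions U"
proof -
  have sub: "tsupport f \<subseteq> K"
    using assms(2,4) by (intro tsupport_subsetI compact_imp_closed)
  then have "K \<inter> tsupport f = tsupport f" by blast
  then have "compact (tsupport f)"
    using compact_Int_closed[OF assms(2) closed_tsupport, of f] by simp
  then show ?thesis using assms(1,3) sub by (simp add: test_functions_def)
qed

lemma test_functionsD:
  assumes "f \<in> test_functions U"
  shows "smooth_on UNIV f" "compact (tsupport f)" "tsupport f \<subseteq> U"
  using assms by (simp_all add: test_functions_def)

lemma test_functions_mono: "f \<in> test_functions U \<Longrightarrow> U \<subseteq> V \<Longrightarrow> f \<in> test_functions V"
  using subset_trans[of "tsupport f" U V] by (simp add: test_functions_def)

lemma test_functions_pd:
  assumes "f \<in> test_functions U"
  shows "pd i f \<in> test_functions U"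
proof (rule test_functionsI)
  show "pd i f x = 0" if "x \<notin> tsupport f" for x
    using that tsupport_pd[of i f] zero_outside_tsupport[of x "pd i f"] by (meson subsetD)
qed (simp_all add: smooth_on_pd test_functionsD[OF assms])

lemma test_functions_add:
  assumes "f \<in> test_functions U" "g \<in> test_functions U"
  shows "(\<lambda>x. f x + g x) \<in> test_functions U"
proof (rule test_functionsI)
  show "f x + g x = 0" if "x \<notin> tsupport f \<union> tsupport g" for x
    using that by (simp add: zero_outside_tsupport)
qed (simp_all add: compact_Un smooth_on_add test_functionsD[OF assms(1)] test_functionsD[OF assms(2)])

lemma test_functions_mult:
  fixes f g :: "real^2 \<Rightarrow> real"
  assumes "f \<in> test_functions U" "smooth_on UNIV g"
  shows "(\<lambda>x. f x * g x) \<in> test_functions U"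
proof (rule test_functionsI)
  show "f x * g x = 0" if "x \<notin> tsupport f" for x
    using that by (simp add: zero_outside_tsupport)
qed (simp_all add: assms(2) smooth_on_mult test_functionsD[OF assms(1)])

lemma test_functions_cmult:
  fixes f :: "real^2 \<Rightarrow> real"
  shows "f \<in> test_functions U \<Longrightarrow> (\<lambda>x. c * f x) \<in> test_functions U"
  using test_functions_mult[of f U "\<lambda>x. c"] by (simp add: smooth_on_const mult.commute)

lemma test_functions_differentiable: "f \<in> test_functions U \<Longrightarrow> f differentiable (at x)"
  by (rule smooth_on_differentiable[OF test_functionsD(1) UNIV_I])

text \<open>The second factor may be arbitrary outside U, because the product vanishes on the complement of the
  support of the first; that complement and U cover the plane. This is how test functions on the
  punctured domain meet the strain, which is smooth only there.\<close>

lemma test_functions_mult_local: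
  fixes f g :: "real^2 \<Rightarrow> real"
  assumes "open U" "f \<in> test_functions U" "smooth_on U g"
  shows "(\<lambda>x. f x * g x) \<in> test_functions U"
proof (rule test_functionsI[of _ "tsupport f"])
  have "smooth_on (U \<union> - tsupport f) (\<lambda>x. f x * g x)"
  proof (rule smooth_on_Un)
    show "smooth_on U (\<lambda>x. f x * g x)"
      by (rule smooth_on_mult[OF assms(1) smooth_on_subset[OF test_functionsD(1)[OF assms(2)]] assms(3)])
        simp
    show "smooth_on (- tsupport f) (\<lambda>x. f x * g x)"
      by (rule smooth_on_cong[of _ "\<lambda>x. 0"]) (auto simp: smooth_on_const zero_outside_tsupport)
  qed (use assms in auto)
  moreover have "U \<union> - tsupport f = UNIV" using test_functionsD(3)[OF assms(2)] by auto
  ultimately show "smooth_on UNIV (\<lambda>x. f x * g x)" by simp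
  show "f x * g x = 0" if "x \<notin> tsupport f" for x
    using that by (simp add: zero_outside_tsupport)
qed (simp_all add: test_functionsD[OF assms(2)])


section \<open>Smooth cutoff functions\<close>

text \<open>For n = 0 this is the classical smooth function which is flat at the origin. The powers in the
  denominator are there because the derivative of each member of the family is a linear combination of
  other members, so that smoothness of all of them follows by one induction.\<close>

definition flat_exp :: "nat \<Rightarrow> real \<Rightarrow> real" where
  "flat_exp n s = (if s > 0 then exp (- (1 / s)) / s ^ n else 0)"

lemma flat_exp_pos: "s > 0 \<Longrightarrow> flat_exp n s > 0"
  by (simp add: flat_exp_def)

lemma power_le_fact_exp:
  assumes "u \<ge> (0::real)"
  shows "u ^ m \<le> fact m * exp u"
proof -
  have "(\<lambda>n. u ^ n /\<^sub>R fact n) sums exp u" by (rule exp_converges)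
  then have "(\<Sum>n\<in>{m}. u ^ n /\<^sub>R fact n) \<le> exp u"
    using assms sum_le_suminf[of "\<lambda>n. u ^ n /\<^sub>R fact n" "{m}"]
    by (auto simp: sums_iff)
  then show ?thesis by (simp add: field_simps)
qed

lemma flat_exp_le: "\<bar>flat_exp n s\<bar> \<le> fact (n + 2) * s\<^sup>2"
proof (cases "s > 0")
  case True
  define C :: real where "C = fact (n + 2)"
  have "(1 / s) ^ (n + 2) \<le> C * exp (1 / s)"
    unfolding C_def by (rule power_le_fact_exp) (use True in simp)
  then have "1 \<le> C * exp (1 / s) * s ^ (n + 2)"
    using True by (simp add: power_one_over divide_le_eq)
  then have "1 \<le> C * s\<^sup>2 * s ^ n * exp (1 / s)"
    by (simp add: power_add power2_eq_square ac_simps)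
  then have "exp (- (1 / s)) / s ^ n \<le> C * s\<^sup>2"
    using True by (simp add: exp_minus inverse_eq_divide divide_le_eq ac_simps)
  then show ?thesis using True by (simp add: flat_exp_def C_def)
qed (simp add: flat_exp_def)

lemma flat_exp_has_real_derivative:
  "(flat_exp n has_real_derivative (flat_exp (n + 2) s - real n * flat_exp (n + 1) s)) (at s)"
proof -
  consider "s > 0" | "s < 0" | "s = 0" by linarith
  then show ?thesis
  proof cases
    case 1
    have "((\<lambda>s. exp (- (1 / s)) / s ^ n) has_real_derivative
        (exp (- (1 / s)) * (1 / s\<^sup>2) * s ^ n - exp (- (1 / s)) * (real n * s ^ (n - 1))) / (s ^ n * s ^ n)) (at s)"
      using 1 by (auto intro!: derivative_eq_intros simp: power2_eq_square)
    moreover have "(exp (- (1 / s)) * (1 / s\<^sup>2) * s ^ n - exp (- (1 / s)) * (real n * s ^ (n - 1))) / (s ^ n * s ^ n)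
       = flat_exp (n + 2) s - real n * flat_exp (n + 1) s"
      using 1 by (cases n) (simp_all add: flat_exp_def field_simps power2_eq_square)
    ultimately have "((\<lambda>s. exp (- (1 / s)) / s ^ n) has_real_derivative
        (flat_exp (n + 2) s - real n * flat_exp (n + 1) s)) (at s)" by simp
    then show ?thesis
      by (rule has_field_derivative_transform_within_open[of _ _ _ "{0<..}"])
        (use 1 in \<open>auto simp: flat_exp_def\<close>)
  next
    case 2
    have "((\<lambda>s. 0) has_real_derivative 0) (at s)" by simp
    then have "(flat_exp n has_real_derivative 0) (at s)"
      by (rule has_field_derivative_transform_within_open[of _ _ _ "{..<0}"])
        (use 2 in \<open>auto simp: flat_exp_def\<close>)
    then show ?thesis using 2 by (simp add: flat_exp_def)
  next
    case 3
    \<comment> \<open>At 0 the quadratic bound makes the difference quotient tend to 0.\<close>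
    define C :: real where "C = fact (n + 2)"
    have "(\<lambda>h. (flat_exp n (0 + h) - flat_exp n 0) / h) \<midarrow>0\<rightarrow> 0"
    proof (rule Lim_null_comparison)
      show "\<forall>\<^sub>F h in at 0. norm ((flat_exp n (0 + h) - flat_exp n 0) / h) \<le> C * \<bar>h\<bar>"
      proof (rule eventually_at_filter[THEN iffD2, OF always_eventually], intro allI impI)
        fix h :: real assume "h \<noteq> 0"
        have "\<bar>flat_exp n h\<bar> \<le> C * (\<bar>h\<bar> * \<bar>h\<bar>)"
          using flat_exp_le[of n h] unfolding C_def power2_eq_square abs_mult_self_eq .
        then show "norm ((flat_exp n (0 + h) - flat_exp n 0) / h) \<le> C * \<bar>h\<bar>"
          using \<open>h \<noteq> 0\<close> by (simp add: flat_exp_def[of n 0] divide_le_eq mult.assoc)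
      qed
      have "((\<lambda>h. C * \<bar>h\<bar>) \<longlongrightarrow> C * \<bar>0::real\<bar>) (at 0)"
        by (intro tendsto_intros)
      then show "((\<lambda>h. C * \<bar>h\<bar>) \<longlongrightarrow> 0) (at (0::real))" by simp
    qed
    then have "(flat_exp n has_real_derivative 0) (at 0)" by (simp add: DERIV_def)
    then show ?thesis using 3 by (simp add: flat_exp_def)
  qed
qed

lemma flat_exp_continuous: "continuous_on S (flat_exp n)"
  by (meson DERIV_isCont continuous_at_imp_continuous_on flat_exp_has_real_derivative)

lemma smooth_on_flat_exp:
  fixes q :: "real^2 \<Rightarrow> real"
  assumes q: "smooth_on UNIV q"
  shows "smooth_on UNIV (\<lambda>x. flat_exp n (q x))"
proof -
  have D: "((\<lambda>x. flat_exp n (q x)) has_derivative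
     (\<lambda>h. frechet_derivative q (at x) h * (flat_exp (n + 2) (q x) - real n * flat_exp (n + 1) (q x)))) (at x)" for x n
  proof -
    have "(q has_derivative frechet_derivative q (at x)) (at x)"
      using smooth_on_differentiable[OF q UNIV_I] frechet_derivative_works by blast
    moreover have "(flat_exp n has_derivative
        (\<lambda>h. h * (flat_exp (n + 2) (q x) - real n * flat_exp (n + 1) (q x)))) (at (q x))"
      using flat_exp_has_real_derivative[of n "q x"]
      by (simp add: has_field_derivative_def mult_commute_abs)
    ultimately show ?thesis by (rule has_derivative_compose)
  qed
  have pd_eq: "pd i (\<lambda>x. flat_exp n (q x)) =
      (\<lambda>x. pd i q x * (flat_exp (n + 2) (q x) + (- real n) * flat_exp (n + 1) (q x)))" for i n
    using pd_eqI[OF D] by (simp add: pd_def fun_eq_iff)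
  have "Ck_on k UNIV (\<lambda>x. flat_exp n (q x))" for k
  proof (induction k arbitrary: n)
    case 0
    show ?case
      using D by (auto intro: Ck_on_differentiable differentiableI)
  next
    case (Suc k)
    have "Ck_on k UNIV (pd i (\<lambda>x. flat_exp n (q x)))" for i
      unfolding pd_eq
      by (intro Ck_on_mult[OF open_UNIV] Ck_on_add[OF open_UNIV] Ck_on_const Suc.IH
          smooth_onD_Ck smooth_on_pd q)
    moreover have "(\<lambda>x. flat_exp n (q x)) differentiable (at x)" for x
      using D differentiableI by blast
    ultimately show ?case by simp
  qed
  then show ?thesis by (simp add: smooth_on_def)
qed

definition norm_sq :: "real^2 \<Rightarrow> real" where
  "norm_sq x = (x $ 1)\<^sup>2 + (x $ 2)\<^sup>2"

lemma norm_sq: "norm_sq x = (norm x)\<^sup>2"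
  by (simp add: norm_sq_def norm_vec_def L2_set_def sum_2)

lemma smooth_on_norm_sq: "open S \<Longrightarrow> smooth_on S norm_sq"
  unfolding norm_sq_def[abs_def] by (intro smooth_on_add smooth_on_power smooth_on_coord)

lemma norm_sq_has_derivative:
  "(norm_sq has_derivative (\<lambda>h. 2 * (x $ 1) * (h $ 1) + 2 * (x $ 2) * (h $ 2))) (at x)"
  unfolding norm_sq_def[abs_def]
  by (auto intro!: derivative_eq_intros bounded_linear.has_derivative[OF bounded_linear_vec_nth])

text \<open>The profile is obtained by integrating a bump that lives between a and b, rather than as a quotient,
  so that its derivative h is explicit and smoothness follows from that of the bump. Composition with
  the squared norm, and not the norm, keeps the cutoff smooth at the origin. The derivative is part of
  the conclusion because the circulation argument integrates it along rays.\<close>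

lemma radial_cutoff_exists:
  assumes "0 < a" "a < b"
  obtains H h :: "real \<Rightarrow> real" where
    "\<And>s. 0 \<le> s \<Longrightarrow> (H has_real_derivative h s) (at s)"
    "continuous_on UNIV h"
    "\<And>s. 0 \<le> s \<Longrightarrow> s \<le> a \<Longrightarrow> H s = 1" "\<And>s. b \<le> s \<Longrightarrow> H s = 0"
    "\<And>s. s \<le> a \<Longrightarrow> h s = 0" "\<And>s. b \<le> s \<Longrightarrow> h s = 0"
    "smooth_on UNIV (\<lambda>x. H (norm_sq x))"
    "\<And>i. pd i (\<lambda>x. H (norm_sq x)) = (\<lambda>x. 2 * x $ i * h (norm_sq x))"
proof -
  define g where "g = (\<lambda>s. flat_exp 0 (b - s) * flat_exp 0 (s - a))"
  define G where "G = (\<lambda>s. integral {-1..s} g)"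
  have cont_g: "continuous_on S g" for S
    unfolding g_def
    by (intro continuous_on_mult continuous_on_compose2[OF flat_exp_continuous[of UNIV]]
        continuous_intros) auto
  have g0: "g s = 0" if "s \<le> a \<or> b \<le> s" for s
    using that by (auto simp: g_def flat_exp_def)
  have g_pos: "g s > 0" if "a < s" "s < b" for s
    using that by (simp add: g_def flat_exp_pos)
  have DG: "(G has_real_derivative g s) (at s)" if "-1 < s" for s
  proof -
    have "(G has_real_derivative g s) (at s within {-1..s + 1})"
      unfolding G_def using that by (intro integral_has_real_derivative cont_g) auto
    moreover have "at s within {-1..s + 1} = at s"
      using that by (intro at_within_interior) auto
    ultimately show ?thesis by simp
  qed
  have Ga: "G s = 0" if "s \<le> a" for s
  proof -
    have "G s = integral {-1..s} (\<lambda>s. 0)"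
      unfolding G_def by (rule integral_cong) (use that g0 in auto)
    then show ?thesis by simp
  qed
  have Gb: "G s = G b" if "b \<le> s" for s
  proof -
    have "integral {-1..b} g + integral {b..s} g = integral {-1..s} g"
      using that assms
      by (intro Henstock_Kurzweil_Integration.integral_combine integrable_continuous_real cont_g) auto
    moreover have "integral {b..s} g = integral {b..s} (\<lambda>s. 0)"
      by (rule integral_cong) (use g0 in auto)
    ultimately show ?thesis by (simp add: G_def)
  qed
  have I_pos: "G b > 0"
  proof -
    obtain z where z: "a < z" "z < b" "G b - G a = (b - a) * g z"
      using MVT2[OF assms(2), of G g] DG assms by (metis less_eq_real_def neg_less_0_iff_less
          less_le_trans zero_less_one less_trans)
    then show ?thesis using g_pos[OF z(1,2)] Ga[of a] assms by simp
  qed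
  define H where "H = (\<lambda>s. 1 - G s / G b)"
  define h where "h = (\<lambda>s. - (g s / G b))"
  have DH: "(H has_real_derivative h s) (at s)" if "0 \<le> s" for s
  proof -
    have "-1 < s" using that by simp
    from DG[OF this] have "((\<lambda>s. 1 - G s / G b) has_real_derivative (0 - g s / G b)) (at s)"
      by (intro DERIV_diff DERIV_const DERIV_cdivide)
    then show ?thesis by (simp add: H_def h_def)
  qed
  have cont_h: "continuous_on UNIV h"
    unfolding h_def using I_pos by (intro continuous_intros cont_g) simp
  have smooth_h: "smooth_on UNIV (\<lambda>x. h (norm_sq x))"
  proof -
    have "smooth_on UNIV (\<lambda>x. (- 1 / G b) * (flat_exp 0 (b - norm_sq x) * flat_exp 0 (norm_sq x - a)))"
      by (intro smooth_on_mult[OF open_UNIV] smooth_on_flat_exp smooth_on_diff[OF open_UNIV]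
          smooth_on_const smooth_on_norm_sq open_UNIV)
    then show ?thesis by (simp add: h_def g_def)
  qed
  have DHq: "((\<lambda>x. H (norm_sq x)) has_derivative
      (\<lambda>k. (2 * (x $ 1) * (k $ 1) + 2 * (x $ 2) * (k $ 2)) * h (norm_sq x))) (at x)" for x
  proof -
    have "0 \<le> norm_sq x" by (simp add: norm_sq)
    from DH[OF this] have "(H has_derivative (\<lambda>k. k * h (norm_sq x))) (at (norm_sq x))"
      by (simp add: has_field_derivative_def mult_commute_abs)
    from has_derivative_compose[OF norm_sq_has_derivative this] show ?thesis .
  qed
  have pd_eq: "pd i (\<lambda>x. H (norm_sq x)) = (\<lambda>x. (2 * (x $ i)) * h (norm_sq x))" for i
    using pd_eqI[OF DHq] exhaust_2[of i] by (auto simp: fun_eq_iff axis_def)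
  have smooth_H: "smooth_on UNIV (\<lambda>x. H (norm_sq x))"
    unfolding smooth_on_iff[of UNIV "\<lambda>x. H (norm_sq x)"] pd_eq
  proof (intro conjI allI ballI)
    show "(\<lambda>x. H (norm_sq x)) differentiable (at x)" for x
      using DHq by (rule differentiableI)
    show "smooth_on UNIV (\<lambda>x. 2 * x $ i * h (norm_sq x))" for i
      by (rule smooth_on_mult[OF open_UNIV smooth_on_mult[OF open_UNIV smooth_on_const smooth_on_coord] smooth_h])
  qed
  show ?thesis
  proof (rule that)
    show "H s = 1" if "0 \<le> s" "s \<le> a" for s using Ga[OF that(2)] by (simp add: H_def)
    show "H s = 0" if "b \<le> s" for s using Gb[OF that] I_pos by (simp add: H_def)
    show "h s = 0" if "s \<le> a" for s using g0 that by (simp add: h_def)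
    show "h s = 0" if "b \<le> s" for s using g0 that by (simp add: h_def)
  qed (fact DH cont_h smooth_H pd_eq)+
qed


section \<open>Integration by parts and the fundamental lemma\<close>

lemma continuous_compact_support_integrable:
  fixes f :: "real^2 \<Rightarrow> 'v::euclidean_space"
  assumes "continuous_on UNIV f" "compact K" "\<And>x. x \<notin> K \<Longrightarrow> f x = 0"
  shows "integrable lborel f"
proof -
  have "integrable lborel (\<lambda>x. indicator K x *\<^sub>R f x)"
    by (rule borel_integrable_compact[OF assms(2) continuous_on_subset[OF assms(1)]]) simp
  moreover have "(\<lambda>x. indicator K x *\<^sub>R f x) = f"
    using assms(3) by (force simp: indicator_def fun_eq_iff)
  ultimately show ?thesis by simp
qed

lemma test_function_integrable:
  fixes f :: "real^2 \<Rightarrow> real"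
  assumes "f \<in> test_functions U"
  shows "integrable lborel f"
  using test_functionsD[OF assms] zero_outside_tsupport[of _ f]
  by (intro continuous_compact_support_integrable[of f "tsupport f"] smooth_on_continuous_on) auto

lemma test_function_bounded:
  fixes f :: "real^2 \<Rightarrow> real"
  assumes "f \<in> test_functions U"
  obtains B where "0 \<le> B" "\<And>x. \<bar>f x\<bar> \<le> B"
proof -
  have "compact (f ` tsupport f)"
    using test_functionsD[OF assms] smooth_on_continuous_on continuous_on_subset
    by (metis compact_continuous_image top_greatest)
  then obtain B where "0 < B" "\<And>x. x \<in> tsupport f \<Longrightarrow> \<bar>f x\<bar> \<le> B"
    using compact_imp_bounded bounded_pos by (metis imageI real_norm_def)
  then have "\<bar>f x\<bar> \<le> B" for x
    using zero_outside_tsupport[of x f] by (cases "x \<in> tsupport f") auto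
  then show ?thesis using that[of B] \<open>0 < B\<close> by simp
qed

lemma lborel_translate:
  fixes f :: "real^2 \<Rightarrow> real"
  assumes "integrable lborel f"
  shows "integrable lborel (\<lambda>x. f (c + x))" "(LINT x|lborel. f (c + x)) = (LINT x|lborel. f x)"
proof -
  have m: "(+) c \<in> borel_measurable lborel" by simp
  have f: "f \<in> borel_measurable borel" using assms by simp
  show "integrable lborel (\<lambda>x. f (c + x))"
    using assms integrable_distr_eq[OF m f] lborel_distr_plus[of c] by simp
  show "(LINT x|lborel. f (c + x)) = (LINT x|lborel. f x)"
    using integral_distr[OF m f] lborel_distr_plus[of c] by simp
qed

lemma translate_difference_bound:
  fixes f :: "real^2 \<Rightarrow> real"
  assumes "\<And>x. f differentiable (at x)" "\<And>x. \<bar>pd i f x\<bar> \<le> B" "0 < t"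
  shows "\<bar>f (t *\<^sub>R axis i 1 + x) - f x\<bar> \<le> t * B"
proof -
  have D: "((\<lambda>s. f (s *\<^sub>R axis i 1 + x)) has_real_derivative pd i f (s *\<^sub>R axis i 1 + x)) (at s)" for s
  proof -
    let ?D = "frechet_derivative f (at (s *\<^sub>R axis i 1 + x))"
    have "((\<lambda>s. f (s *\<^sub>R axis i 1 + x)) has_derivative (\<lambda>h. ?D (h *\<^sub>R axis i 1))) (at s)"
      by (rule has_derivative_compose[OF _ assms(1)[unfolded frechet_derivative_works]])
        (auto intro!: derivative_eq_intros)
    then show ?thesis
      using linear_cmul[OF linear_frechet_derivative[OF assms(1)]]
      by (simp add: has_field_derivative_def pd_def mult_commute_abs)
  qed
  obtain z where "f (t *\<^sub>R axis i 1 + x) - f (0 *\<^sub>R axis i 1 + x) = (t - 0) * pd i f (z *\<^sub>R axis i 1 + x)"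
    using MVT2[OF assms(3), of "\<lambda>s. f (s *\<^sub>R axis i 1 + x)" "\<lambda>s. pd i f (s *\<^sub>R axis i 1 + x)"] D
    by blast
  then show ?thesis using assms(2)[of "z *\<^sub>R axis i 1 + x"] assms(3) by (simp add: abs_mult)
qed

text \<open>The integral of a difference quotient vanishes by translation invariance, and the difference
  quotients converge dominatedly to the partial derivative.\<close>

lemma integral_pd_eq_0:
  fixes f :: "real^2 \<Rightarrow> real"
  assumes f: "f \<in> test_functions U"
  shows "(LINT x|lborel. pd i f x) = 0"
proof -
  define e :: "real^2" where "e = axis i 1"
  have norm_e: "norm e = 1" by (simp add: e_def)
  define t :: "nat \<Rightarrow> real" where "t n = inverse (real (Suc n))" for n
  have t: "0 < t n" "t n \<le> 1" for n by (simp_all add: t_def field_simps)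
  have t_lim: "t \<longlonglongrightarrow> 0" unfolding t_def by (rule LIMSEQ_inverse_real_of_nat)
  define s where "s = (\<lambda>n x. (f (t n *\<^sub>R e + x) - f x) / t n)"
  have d: "f differentiable (at x)" for x using f by (rule test_functions_differentiable)
  obtain B where B: "0 \<le> B" "\<And>x. \<bar>pd i f x\<bar> \<le> B"
    using test_function_bounded[OF test_functions_pd[OF f]] by blast
  obtain R where R: "0 < R" "\<And>x. x \<in> tsupport f \<Longrightarrow> norm x \<le> R"
    using compact_imp_bounded[OF test_functionsD(2)[OF f]] bounded_pos by metis
  have out: "f x = 0" if "norm x > R" for x
    using that R(2)[of x] zero_outside_tsupport[of x f] by force
  have int_s: "(LINT x|lborel. s n x) = 0" for n
    using lborel_translate[OF test_function_integrable[OF f]] test_function_integrable[OF f]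
    by (simp add: s_def)
  have "(\<lambda>n. LINT x|lborel. s n x) \<longlonglongrightarrow> (LINT x|lborel. pd i f x)"
  proof (rule integral_dominated_convergence)
    show "pd i f \<in> borel_measurable lborel"
      using test_function_integrable[OF test_functions_pd[OF f]] by simp
    show "s n \<in> borel_measurable lborel" for n
      using lborel_translate(1)[OF test_function_integrable[OF f]] test_function_integrable[OF f]
      unfolding s_def by (intro borel_measurable_divide borel_measurable_diff) auto
    show "integrable lborel (\<lambda>x. B * indicator (cball (0::real^2) (R + 1)) x)"
      by (intro integrable_mult_right integrable_real_indicator)
        (simp_all add: emeasure_bounded_finite[OF bounded_cball] flip: infinity_ennreal_def)
    have "(\<lambda>n. s n x) \<longlonglongrightarrow> pd i f x" for x
    proof -
      have "((\<lambda>r. f (r *\<^sub>R e + x)) has_derivative (\<lambda>h. frechet_derivative f (at x) (h *\<^sub>R e))) (at 0)"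
        by (rule has_derivative_compose[where g = f])
          (use d[of x] in \<open>auto intro!: derivative_eq_intros simp: frechet_derivative_works\<close>)
      then have "((\<lambda>r. f (r *\<^sub>R e + x)) has_real_derivative pd i f x) (at 0)"
        using linear_cmul[OF linear_frechet_derivative[OF d]]
        by (simp add: has_field_derivative_def pd_def e_def mult_commute_abs)
      then have "(\<lambda>h. (f (h *\<^sub>R e + x) - f x) / h) \<midarrow>0\<rightarrow> pd i f x"
        by (simp add: DERIV_def)
      then have "((\<lambda>h. (f (h *\<^sub>R e + x) - f x) / h) \<circ> t) \<longlonglongrightarrow> pd i f x"
        by (rule tendsto_at_iff_sequentially[THEN iffD1, rule_format])
          (use t t_lim in \<open>auto simp: less_imp_neq[THEN not_sym]\<close>)
      then show ?thesis by (simp add: s_def o_def)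
    qed
    then show "AE x in lborel. (\<lambda>n. s n x) \<longlonglongrightarrow> pd i f x" by simp
    have "norm (s n x) \<le> B * indicator (cball (0::real^2) (R + 1)) x" for n x
    proof (cases "norm x \<le> R + 1")
      case True
      have "\<bar>f (t n *\<^sub>R e + x) - f x\<bar> \<le> t n * B"
        unfolding e_def by (rule translate_difference_bound[OF d B(2) t(1)])
      then show ?thesis using True t(1)[of n] by (simp add: s_def field_simps)
    next
      case False
      have "norm x \<le> norm (t n *\<^sub>R e + x) + norm (t n *\<^sub>R e)"
        by (metis add_diff_cancel_left' norm_triangle_ineq4)
      then have "norm (t n *\<^sub>R e + x) > R" using False t[of n] norm_e by simp
      then show ?thesis using False out[of x] out[of "t n *\<^sub>R e + x"] by (simp add: s_def)
    qed
    then show "AE x in lborel. norm (s n x) \<le> B * indicator (cball (0::real^2) (R + 1)) x" for n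
      by simp
  qed
  then show ?thesis using int_s by (simp add: LIMSEQ_const_iff)
qed

lemma integral_by_parts:
  fixes \<phi> f :: "real^2 \<Rightarrow> real"
  assumes "open U" "\<phi> \<in> test_functions U" "smooth_on U f"
  shows "(LINT x|lborel. pd i \<phi> x * f x) = - (LINT x|lborel. \<phi> x * pd i f x)"
    and "integrable lborel (\<lambda>x. \<phi> x * f x)"
proof -
  have int1: "integrable lborel (\<lambda>x. pd i \<phi> x * f x)"
    by (rule test_function_integrable[OF test_functions_mult_local[OF assms(1) test_functions_pd[OF assms(2)] assms(3)]])
  have int2: "integrable lborel (\<lambda>x. \<phi> x * pd i f x)"
    by (rule test_function_integrable[OF test_functions_mult_local[OF assms(1,2) smooth_on_pd[OF assms(3)]]])
  have "pd i (\<lambda>x. \<phi> x * f x) x = pd i \<phi> x * f x + \<phi> x * pd i f x" for x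
  proof (cases "x \<in> U")
    case True
    then show ?thesis
      by (intro pd_mult test_functions_differentiable[OF assms(2)] smooth_on_differentiable[OF assms(3)])
  next
    case False
    then have x: "x \<notin> tsupport \<phi>" using test_functionsD(3)[OF assms(2)] by blast
    then have "x \<notin> tsupport (pd i \<phi>)" using tsupport_pd[of i \<phi>] by blast
    moreover have "pd i (\<lambda>x. \<phi> x * f x) x = pd i (\<lambda>x. 0) x"
      by (rule pd_cong_open[of "- tsupport \<phi>"]) (use x in \<open>auto simp: zero_outside_tsupport\<close>)
    ultimately show ?thesis using x by (simp add: zero_outside_tsupport)
  qed
  then have "(LINT x|lborel. pd i \<phi> x * f x + \<phi> x * pd i f x) = 0"
    using integral_pd_eq_0[OF test_functions_mult_local[OF assms], of i] by simp
  then show "(LINT x|lborel. pd i \<phi> x * f x) = - (LINT x|lborel. \<phi> x * pd i f x)"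
    using int1 int2 by simp
  show "integrable lborel (\<lambda>x. \<phi> x * f x)"
    by (rule test_function_integrable[OF test_functions_mult_local[OF assms]])
qed

text \<open>Were g positive somewhere, a bump concentrated where g stays positive would have a positive
  integral against g.\<close>

lemma fundamental_lemma_nonpos:
  fixes g :: "real^2 \<Rightarrow> real"
  assumes U: "open U" and g: "smooth_on U g"
    and int0: "\<And>\<phi>. \<phi> \<in> test_functions U \<Longrightarrow> (LINT x|lborel. \<phi> x * g x) = 0"
    and x0: "x0 \<in> U"
  shows "g x0 \<le> 0"
proof (rule ccontr)
  assume "\<not> g x0 \<le> 0"
  then have pos0: "g x0 > 0" by simp
  have "open (U \<inter> g -` {0<..})"
    using smooth_on_continuous_on[OF g] U continuous_open_preimage open_greaterThan by blast
  then obtain d where d: "d > 0" "cball x0 d \<subseteq> U \<inter> g -` {0<..}"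
    using x0 pos0 open_contains_cball by (metis IntI greaterThan_iff vimageI2)
  define \<phi> where "\<phi> = (\<lambda>x. flat_exp 0 (d\<^sup>2 - norm_sq (x - x0)))"
  have smooth_q: "smooth_on UNIV (\<lambda>x. d\<^sup>2 - norm_sq (x - x0))"
    unfolding norm_sq_def vector_minus_component
    by (intro smooth_on_diff[OF open_UNIV] smooth_on_add[OF open_UNIV] smooth_on_power[OF open_UNIV]
        smooth_on_coord smooth_on_const)
  have pos_iff: "\<phi> x > 0 \<longleftrightarrow> x \<in> ball x0 d" "\<phi> x \<ge> 0" "x \<notin> cball x0 d \<Longrightarrow> \<phi> x = 0" for x
  proof -
    have "d\<^sup>2 - norm_sq (x - x0) > 0 \<longleftrightarrow> norm (x - x0) < d"
      using d(1) power_mono_iff[of d "norm (x - x0)" 2] by (simp add: norm_sq not_le[symmetric])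
    then have *: "\<phi> x = (if x \<in> ball x0 d then exp (- (1 / (d\<^sup>2 - norm_sq (x - x0)))) else 0)"
      by (simp add: \<phi>_def flat_exp_def dist_norm norm_minus_commute)
    show "\<phi> x > 0 \<longleftrightarrow> x \<in> ball x0 d" "\<phi> x \<ge> 0" "x \<notin> cball x0 d \<Longrightarrow> \<phi> x = 0"
      using * by auto
  qed
  have \<phi>: "\<phi> \<in> test_functions U"
    by (rule test_functionsI[of _ "cball x0 d"])
      (use d pos_iff smooth_on_flat_exp[OF smooth_q] in \<open>auto simp: \<phi>_def\<close>)
  have int: "integrable lborel (\<lambda>x. \<phi> x * g x)"
    by (rule integral_by_parts(2)[OF U \<phi> g])
  have nn: "\<phi> x * g x \<ge> 0" for x
  proof (cases "x \<in> cball x0 d")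
    case True
    then have "0 < g x" using d(2) by auto
    then show ?thesis using pos_iff(2)[of x] by simp
  qed (simp add: pos_iff(3))
  have "AE x in lborel. \<phi> x * g x = 0"
    using integral_nonneg_eq_0_iff_AE[OF int] nn int0[OF \<phi>] by simp
  moreover have "\<phi> x * g x \<noteq> 0" if "x \<in> ball x0 d" for x
  proof -
    have "x \<in> cball x0 d" using that ball_subset_cball by blast
    then have "0 < g x" using d(2) by auto
    then show ?thesis using pos_iff(1)[of x] that by simp
  qed
  ultimately have "AE x in lborel. x \<notin> ball x0 d"
    by (auto elim!: eventually_mono)
  then have "ball x0 d \<in> null_sets lborel"
    by (subst AE_iff_null_sets) auto
  then have "negligible (ball x0 d)"
    using negligible_iff_null_sets null_sets_completionI by blast
  then show False using open_not_negligible[of "ball x0 d"] d(1) by simp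
qed

lemma fundamental_lemma:
  fixes g :: "real^2 \<Rightarrow> real"
  assumes "open U" "smooth_on U g"
    and "\<And>\<phi>. \<phi> \<in> test_functions U \<Longrightarrow> (LINT x|lborel. \<phi> x * g x) = 0"
    and "x \<in> U"
  shows "g x = 0"
proof -
  have "- g x \<le> 0"
    by (rule fundamental_lemma_nonpos[of U "\<lambda>x. - g x"])
      (use assms smooth_on_minus in auto)
  then show ?thesis using fundamental_lemma_nonpos[OF assms] by simp
qed


section \<open>Polar coordinates\<close>

lemma integral_real2_iterated:
  fixes f :: "real^2 \<Rightarrow> real"
  assumes "continuous_on (cbox (vector [a, c]) (vector [b, d])) f"
  shows "integral (cbox (vector [a, c]) (vector [b, d])) f
    = integral {a..b} (\<lambda>x. integral {c..d} (\<lambda>y. f (vector [x, y])))"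
proof -
  define g :: "real \<times> real \<Rightarrow> real^2" where "g = (\<lambda>p. vector [fst p, snd p])"
  define h :: "real^2 \<Rightarrow> real \<times> real" where "h = (\<lambda>v. (v $ 1, v $ 2))"
  have hg: "h (g p) = p" and gh: "g (h v) = v" for p v
    by (simp_all add: g_def h_def vec_eq_iff forall_2)
  have g_cbox: "g ` cbox u v = cbox (g u) (g v)" for u v
  proof -
    have "w \<in> cbox (g u) (g v) \<longleftrightarrow> h w \<in> cbox u v" for w
      by (cases u; cases v) (simp add: mem_box_cart forall_2 g_def h_def cbox_Pair_eq conj_ac)
    moreover have "w \<in> g ` cbox u v \<longleftrightarrow> h w \<in> cbox u v" for w
    proof
      assume "h w \<in> cbox u v"
      then have "g (h w) \<in> g ` cbox u v" by (rule imageI)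
      then show "w \<in> g ` cbox u v" unfolding gh .
    qed (auto simp: hg)
    ultimately show ?thesis by blast
  qed
  have h_cbox: "h ` cbox u v = cbox (h u) (h v)" for u v
  proof -
    have "h ` cbox u v = h ` (g ` cbox (h u) (h v))"
      unfolding g_cbox gh ..
    also have "\<dots> = cbox (h u) (h v)"
      by (simp add: image_image hg)
    finally show ?thesis .
  qed
  have cont_g: "continuous_on S g" for S
  proof -
    have "g = (\<lambda>p. fst p *\<^sub>R axis 1 1 + snd p *\<^sub>R axis 2 1)"
      by (auto simp: g_def vec_eq_iff forall_2 axis_def)
    then show ?thesis by (auto intro!: continuous_intros)
  qed
  have content: "measure lborel (g ` cbox u v) = 1 * measure lborel (cbox u v)" for u v
  proof (cases "cbox u v = {}")
    case True
    then show ?thesis by simp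
  next
    case False
    then have ne: "cbox (g u) (g v) \<noteq> {}" using g_cbox by (metis image_is_empty)
    obtain u1 u2 v1 v2 where uv: "u = (u1, u2)" "v = (v1, v2)" by fastforce
    have "u1 \<le> v1" "u2 \<le> v2" using False by (auto simp: uv cbox_Pair_eq)
    then show ?thesis
      using ne unfolding g_cbox uv content_Pair
      by (subst content_cbox_cart) (simp_all add: g_def uv UNIV_2)
  qed
  have "(f has_integral integral (cbox (g (a, c)) (g (b, d))) f) (cbox (g (a, c)) (g (b, d)))"
    using assms by (intro integrable_integral integrable_continuous) (simp add: g_def)
  then have "((\<lambda>p. f (g p)) has_integral (1 / 1) *\<^sub>R integral (cbox (g (a, c)) (g (b, d))) f)
      (h ` cbox (g (a, c)) (g (b, d)))"
  proof (rule has_integral_twiddle[rotated -1])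
    show "isCont g p" for p
      using cont_g[of UNIV] unfolding continuous_on_eq_continuous_at[OF open_UNIV] by blast
    show "\<exists>w z. g ` cbox u v = cbox w z" for u v using g_cbox by blast
    show "\<exists>w z. h ` cbox u v = cbox w z" for u v using h_cbox by blast
  qed (fact hg gh content zero_less_one)+
  then have "integral (cbox (a, c) (b, d)) (\<lambda>p. f (g p)) = integral (cbox (g (a, c)) (g (b, d))) f"
    using h_cbox hg by (simp add: integral_unique)
  moreover have "continuous_on (cbox (a, c) (b, d)) (\<lambda>p. f (g p))"
    by (rule continuous_on_compose2[OF assms cont_g]) (use g_cbox[of "(a, c)" "(b, d)"] in \<open>auto simp: g_def\<close>)
  ultimately show ?thesis
    using integral_prod_continuous[of a c b d "\<lambda>p. f (g p)"] by (simp add: g_def)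
qed

lemma circle_nth [simp]: "circle \<epsilon> t $ 1 = \<epsilon> * cos (2 * pi * t)" "circle \<epsilon> t $ 2 = \<epsilon> * sin (2 * pi * t)"
  by (simp_all add: circle_def)

lemma circle_eq: "circle \<epsilon> t = (\<epsilon> * cos (2 * pi * t)) *\<^sub>R axis 1 1 + (\<epsilon> * sin (2 * pi * t)) *\<^sub>R axis 2 1"
  by (simp add: vec_eq_iff forall_2 axis_def)

lemma norm_sq_circle: "norm_sq (circle \<epsilon> t) = \<epsilon>\<^sup>2"
  by (simp add: norm_sq_def power_mult_distrib flip: distrib_left)

lemma norm_circle: "0 \<le> \<epsilon> \<Longrightarrow> norm (circle \<epsilon> t) = \<epsilon>"
  using norm_sq_circle[of \<epsilon> t] by (simp add: norm_sq)

lemma continuous_on_circle: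
  fixes r t :: "'a::real_normed_vector \<Rightarrow> real"
  shows "continuous_on S r \<Longrightarrow> continuous_on S t \<Longrightarrow> continuous_on S (\<lambda>x. circle (r x) (t x))"
  unfolding circle_eq by (intro continuous_intros)

lemma circle_inj:
  assumes "circle a s = circle b t" "0 < a" "0 < b" "0 < s" "s < 1" "0 < t" "t < 1"
  shows "a = b \<and> s = t"
proof -
  have ab: "a = b" using norm_circle[of a s] norm_circle[of b t] assms by simp
  have "a * cos (2 * pi * s) = b * cos (2 * pi * t)" "a * sin (2 * pi * s) = b * sin (2 * pi * t)"
    using assms(1) by (metis circle_nth(1), metis circle_nth(2))
  then have "sin (2 * pi * s) = sin (2 * pi * t) \<and> cos (2 * pi * s) = cos (2 * pi * t)"
    using ab assms by simp
  then obtain n :: int where "2 * pi * s = 2 * pi * t + 2 * pi * n"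
    using sin_cos_eq_iff by blast
  then have "2 * pi * s = 2 * pi * (t + n)" by (simp add: algebra_simps)
  then have n: "s = t + n" by simp
  then have "real_of_int n < 1" "- 1 < real_of_int n" using assms by linarith+
  then have "n = 0" by linarith
  then show ?thesis using ab n by simp
qed

lemma polar_representation:
  assumes "x $ 2 \<noteq> 0"
  obtains t where "0 < t" "t < 1" "x = circle (norm x) t"
proof -
  have pos: "norm x > 0" using assms by auto
  have "(x $ 1 / norm x)\<^sup>2 + (x $ 2 / norm x)\<^sup>2 = norm_sq x / (norm x)\<^sup>2"
    by (simp add: norm_sq_def power_divide add_divide_distrib)
  then have "(x $ 1 / norm x)\<^sup>2 + (x $ 2 / norm x)\<^sup>2 = 1" using pos by (simp add: norm_sq)
  then obtain u where u: "0 \<le> u" "u < 2 * pi" "x $ 1 / norm x = cos u" "x $ 2 / norm x = sin u"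
    by (rule sincos_total_2pi)
  have "u \<noteq> 0" using u(4) assms pos by auto
  have x1: "norm x * cos u = x $ 1" and x2: "norm x * sin u = x $ 2"
    unfolding u(3,4)[symmetric] using pos by simp_all
  have scale: "2 * pi * (u / (2 * pi)) = u" by simp
  show ?thesis
  proof (rule that[of "u / (2 * pi)"])
    show "x = circle (norm x) (u / (2 * pi))"
      unfolding vec_eq_iff forall_2 circle_nth scale x1 x2 by simp
    show "0 < u / (2 * pi)" using u(1) \<open>u \<noteq> 0\<close> by simp
    show "u / (2 * pi) < 1" using u(2) by simp
  qed
qed

definition polar_deriv :: "real^2 \<Rightarrow> real^2 \<Rightarrow> real^2" where
  "polar_deriv p h = (h $ 1 * cos (2 * pi * (p $ 2)) - p $ 1 * (2 * pi * (h $ 2) * sin (2 * pi * (p $ 2)))) *\<^sub>R axis 1 1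
     + (h $ 1 * sin (2 * pi * (p $ 2)) + p $ 1 * (2 * pi * (h $ 2) * cos (2 * pi * (p $ 2)))) *\<^sub>R axis 2 1"

lemma circle_has_derivative:
  "((\<lambda>p::real^2. circle (p $ 1) (p $ 2)) has_derivative polar_deriv p) (at p within S)"
  unfolding circle_eq polar_deriv_def[abs_def]
  by (auto intro!: derivative_eq_intros bounded_linear.has_derivative[OF bounded_linear_vec_nth]
      simp: algebra_simps)

lemma det_polar_deriv: "det (matrix (polar_deriv p)) = 2 * pi * (p $ 1)"
proof -
  define c where "c = cos (2 * pi * (p $ 2))"
  define s where "s = sin (2 * pi * (p $ 2))"
  have "det (matrix (polar_deriv p)) = c * (p $ 1 * (2 * pi * c)) - (- (p $ 1 * (2 * pi * s))) * s"
    by (simp add: det_2 matrix_def polar_deriv_def axis_def c_def s_def)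
  also have "\<dots> = 2 * pi * (p $ 1) * (c\<^sup>2 + s\<^sup>2)"
    by (simp add: power2_eq_square algebra_simps)
  also have "c\<^sup>2 + s\<^sup>2 = 1" by (simp add: c_def s_def)
  finally show ?thesis by simp
qed

text \<open>The factor 2 pi besides the radius is there because the angle is measured in full turns. The function
  vanishes outside the disc of radius R, so that one bounded rectangle of polar coordinates sees all of
  it up to a null set.\<close>

lemma integral_polar:
  fixes G :: "real^2 \<Rightarrow> real"
  assumes cont: "continuous_on UNIV G" and R: "0 < R" and out: "\<And>x. R \<le> norm x \<Longrightarrow> G x = 0"
  shows "(LINT x|lborel. G x)
    = integral {0..R} (\<lambda>\<rho>. integral {0..1} (\<lambda>t. 2 * pi * \<rho> * G (circle \<rho> t)))"
proof -
  define S where "S = box (vector [0, 0]) (vector [R, 1] :: real^2)"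
  define C where "C = cbox (vector [0, 0]) (vector [R, 1] :: real^2)"
  define g where "g = (\<lambda>p::real^2. circle (p $ 1) (p $ 2))"
  \<comment> \<open>The change of variables theorem is about vector valued functions; G is viewed as a map into
      one-dimensional space.\<close>
  define F :: "real^2 \<Rightarrow> real^1" where "F = (\<lambda>x. G x *\<^sub>R axis 1 1)"
  have S_iff: "p \<in> S \<longleftrightarrow> 0 < p $ 1 \<and> p $ 1 < R \<and> 0 < p $ 2 \<and> p $ 2 < 1" for p
    by (auto simp: S_def mem_box_cart forall_2)
  have S_sub: "S \<subseteq> C" unfolding S_def C_def by (rule box_subset_cbox)
  have C_nonneg: "0 \<le> p $ 1" if "p \<in> C" for p
    using that by (auto simp: C_def mem_box_cart forall_2)
  have cont_g: "continuous_on A g" for A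
    unfolding g_def by (intro continuous_on_circle continuous_intros)
  have cont_Gg: "continuous_on A (\<lambda>p. G (g p))" for A
    by (rule continuous_on_compose2[OF cont cont_g]) simp
  have cont_L: "continuous_on A (\<lambda>p. 2 * pi * p $ 1 * G (g p))" for A
    by (intro continuous_intros cont_Gg)
  have inj: "inj_on g S"
  proof (rule inj_onI)
    fix p q assume "p \<in> S" "q \<in> S" "g p = g q"
    then have "p $ 1 = q $ 1 \<and> p $ 2 = q $ 2"
      by (intro circle_inj) (simp_all add: S_iff g_def)
    then show "p = q" by (simp add: vec_eq_iff forall_2)
  qed
  let ?L = "\<lambda>p. \<bar>det (matrix (polar_deriv p))\<bar> *\<^sub>R F (g p)"
  have L_eq: "?L p = (2 * pi * p $ 1 * G (g p)) *\<^sub>R axis 1 1" if "p \<in> C" for p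
    using C_nonneg[OF that] by (simp add: det_polar_deriv F_def abs_mult)
  have "?L absolutely_integrable_on C"
    unfolding C_def
  proof (rule absolutely_integrable_continuous)
    have "continuous_on C (\<lambda>p. (2 * pi * p $ 1 * G (g p)) *\<^sub>R axis 1 (1::real) :: real^1)"
      by (intro continuous_on_scaleR cont_L continuous_on_const)
    then show "continuous_on (cbox (vector [0, 0]) (vector [R, 1])) ?L"
      unfolding C_def[symmetric] by (rule continuous_on_eq) (rule L_eq[symmetric])
  qed
  then have "?L absolutely_integrable_on S"
    by (rule set_integrable_subset) (use S_sub in \<open>auto simp: S_def\<close>)
  then have "F absolutely_integrable_on (g ` S) \<and> integral (g ` S) F = integral S ?L"
    using has_absolute_integral_change_of_variables[of S g polar_deriv F "integral S ?L"] inj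
      circle_has_derivative by (simp add: S_def g_def)
  then have "(F has_integral integral S ?L) (g ` S)"
    using set_lebesgue_integral_eq_integral(1) integrable_integral by metis
  \<comment> \<open>Up to a null set the image is the open disc of radius R.\<close>
  moreover have "negligible {x \<in> UNIV - g ` S. F x \<noteq> 0}"
  proof (rule negligible_subset[OF negligible_standard_hyperplane_cart[of 2]])
    show "{x \<in> UNIV - g ` S. F x \<noteq> 0} \<subseteq> {x. x $ 2 = 0}"
    proof clarify
      fix x assume x: "x \<notin> g ` S" "F x \<noteq> 0"
      show "x $ 2 = 0"
      proof (rule ccontr)
        assume x2: "x $ 2 \<noteq> 0"
        then obtain t where t: "0 < t" "t < 1" "x = circle (norm x) t" by (rule polar_representation)
        have "norm x < R" using x(2) out[of x] by (force simp: F_def)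
        moreover have "0 < norm x" using x2 by auto
        ultimately have "vector [norm x, t] \<in> S" using t by (simp add: S_iff)
        moreover have "g (vector [norm x, t]) = x" using t(3) by (simp add: g_def)
        ultimately show False using x(1) by (metis imageI)
      qed
    qed
  qed
  ultimately have "(F has_integral integral S ?L) UNIV"
    by (subst has_integral_spike_set_eq[of UNIV "g ` S"]) auto
  from has_integral_linear[OF this bounded_linear_vec_nth[of 1]]
  have "((\<lambda>x. F x $ 1) has_integral integral S ?L $ 1) UNIV"
    unfolding o_def .
  then have "integral UNIV G = integral S ?L $ 1"
    by (simp add: F_def axis_def integral_unique)
  also have "integral S ?L = integral C ?L"
    unfolding S_def C_def by (rule integral_open_interval)
  also have "\<dots> = integral C (\<lambda>p. (2 * pi * p $ 1 * G (g p)) *\<^sub>R axis 1 1)"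
    by (rule integral_cong) (rule L_eq)
  also have "\<dots> $ 1 = integral C (\<lambda>p. ((2 * pi * p $ 1 * G (g p)) *\<^sub>R axis 1 1 :: real^1) $ 1)"
    unfolding C_def
    by (rule integral_component_eq_cart[symmetric])
      (intro integrable_continuous continuous_on_scaleR cont_L continuous_on_const)
  also have "\<dots> = integral C (\<lambda>p. 2 * pi * p $ 1 * G (g p))"
    by (simp add: axis_def)
  also have "\<dots> = integral {0..R} (\<lambda>\<rho>. integral {0..1} (\<lambda>t. 2 * pi * \<rho> * G (circle \<rho> t)))"
    unfolding C_def by (subst integral_real2_iterated[OF cont_L]) (simp add: g_def)
  finally have "integral UNIV G = integral {0..R} (\<lambda>\<rho>. integral {0..1} (\<lambda>t. 2 * pi * \<rho> * G (circle \<rho> t)))" .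
  moreover have "integrable lborel G"
    using out by (intro continuous_compact_support_integrable[OF cont, of "cball 0 R"]) auto
  ultimately show ?thesis using integral_lborel by metis
qed


section \<open>Closed forms and circles\<close>

text \<open>The line integral of P dx + Q dy, counterclockwise: on the circle dx = -2 pi y dt and
  dy = 2 pi x dt.\<close>

definition circulation :: "(real^2 \<Rightarrow> real) \<Rightarrow> (real^2 \<Rightarrow> real) \<Rightarrow> real \<Rightarrow> real" where
  "circulation P Q r = integral {0..1} (\<lambda>t. 2 * pi * (circle r t $ 1 * Q (circle r t) - circle r t $ 2 * P (circle r t)))"

lemma partials_along_circle:
  fixes f :: "real^2 \<Rightarrow> real"
  assumes "f differentiable (at (circle \<rho> t))"
  shows "((\<lambda>\<rho>. f (circle \<rho> t)) has_real_derivative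
      (cos (2 * pi * t) * pd 1 f (circle \<rho> t) + sin (2 * pi * t) * pd 2 f (circle \<rho> t))) (at \<rho>)"
    and "((\<lambda>t. f (circle \<rho> t)) has_real_derivative
      (2 * pi * \<rho> * (cos (2 * pi * t) * pd 2 f (circle \<rho> t) - sin (2 * pi * t) * pd 1 f (circle \<rho> t)))) (at t)"
proof -
  note D = has_derivative_pd[OF assms]
  have "((\<lambda>\<rho>. circle \<rho> t) has_derivative
      (\<lambda>h. (h * cos (2 * pi * t)) *\<^sub>R axis 1 1 + (h * sin (2 * pi * t)) *\<^sub>R axis 2 1)) (at \<rho>)"
    unfolding circle_eq by (auto intro!: derivative_eq_intros)
  from has_derivative_compose[OF this D]
  show "((\<lambda>\<rho>. f (circle \<rho> t)) has_real_derivative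
      (cos (2 * pi * t) * pd 1 f (circle \<rho> t) + sin (2 * pi * t) * pd 2 f (circle \<rho> t))) (at \<rho>)"
    unfolding has_field_derivative_def
    by (rule has_derivative_eq_rhs) (simp add: fun_eq_iff axis_def algebra_simps)
  have "((\<lambda>t. circle \<rho> t) has_derivative
      (\<lambda>h. (- (\<rho> * (2 * pi * h * sin (2 * pi * t)))) *\<^sub>R axis 1 1 + (\<rho> * (2 * pi * h * cos (2 * pi * t))) *\<^sub>R axis 2 1)) (at t)"
    unfolding circle_eq by (auto intro!: derivative_eq_intros simp: algebra_simps)
  from has_derivative_compose[OF this D]
  show "((\<lambda>t. f (circle \<rho> t)) has_real_derivative
      (2 * pi * \<rho> * (cos (2 * pi * t) * pd 2 f (circle \<rho> t) - sin (2 * pi * t) * pd 1 f (circle \<rho> t)))) (at t)"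
    unfolding has_field_derivative_def
    by (rule has_derivative_eq_rhs) (simp add: fun_eq_iff axis_def algebra_simps)
qed

text \<open>The derivative of the circulation in the radius is the integral over a period of the angular
  derivative of the radial component of the form, which vanishes.\<close>

lemma circulation_constant:
  assumes U: "open U" "cball 0 R - {0} \<subseteq> U" and R: "0 < R"
    and P: "smooth_on U P" and Q: "smooth_on U Q"
    and closed_form: "\<And>x. x \<in> U \<Longrightarrow> pd 1 Q x = pd 2 P x"
    and \<rho>: "0 < \<rho>" "\<rho> \<le> R"
  shows "circulation P Q \<rho> = circulation P Q R"
proof -
  define c where "c = (\<lambda>t. cos (2 * pi * t))"
  define s where "s = (\<lambda>t. sin (2 * pi * t))"
  define k where "k = (\<lambda>\<rho> t. 2 * pi * \<rho> * (c t * Q (circle \<rho> t) - s t * P (circle \<rho> t)))"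
  define k' where "k' = (\<lambda>\<rho> t. 2 * pi * (c t * Q (circle \<rho> t) - s t * P (circle \<rho> t))
    + 2 * pi * \<rho> * (c t * (c t * pd 1 Q (circle \<rho> t) + s t * pd 2 Q (circle \<rho> t))
                   - s t * (c t * pd 1 P (circle \<rho> t) + s t * pd 2 P (circle \<rho> t))))"
  define m where "m = (\<lambda>\<rho> t. c t * P (circle \<rho> t) + s t * Q (circle \<rho> t))"
  have cs: "cos (2 * pi * t) = c t" "sin (2 * pi * t) = s t" for t by (simp_all add: c_def s_def)
  let ?I = "{0<..R}"
  have in_U: "circle \<rho> t \<in> U" if "\<rho> \<in> ?I" for \<rho> t
    using that U(2) norm_circle[of \<rho> t] by force
  have circ_k: "circulation P Q \<rho> = integral (cbox 0 1) (k \<rho>)" for \<rho>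
    by (simp add: circulation_def k_def c_def s_def algebra_simps)
  have Dk: "((\<lambda>\<rho>. k \<rho> t) has_real_derivative k' \<rho> t) (at \<rho> within ?I)" if "\<rho> \<in> ?I" for \<rho> t
  proof -
    note dP = partials_along_circle(1)[OF smooth_on_differentiable[OF P in_U[OF that]], of t, unfolded cs]
    note dQ = partials_along_circle(1)[OF smooth_on_differentiable[OF Q in_U[OF that]], of t, unfolded cs]
    have "((\<lambda>\<rho>. k \<rho> t) has_real_derivative k' \<rho> t) (at \<rho>)"
      unfolding k_def k'_def
      by (rule derivative_eq_intros dP dQ refl)+ (simp add: algebra_simps)
    then show ?thesis by (rule has_field_derivative_at_within)
  qed
  have Dm: "(m \<rho> has_real_derivative k' \<rho> t) (at t)" if "\<rho> \<in> ?I" for \<rho> t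
  proof -
    note dP = partials_along_circle(2)[OF smooth_on_differentiable[OF P in_U[OF that]], of t, unfolded cs]
    note dQ = partials_along_circle(2)[OF smooth_on_differentiable[OF Q in_U[OF that]], of t, unfolded cs]
    have dc: "(c has_real_derivative (- (2 * pi * s t))) (at t)"
      and ds: "(s has_real_derivative (2 * pi * c t)) (at t)"
      by (auto simp: c_def s_def intro!: derivative_eq_intros)
    show ?thesis
      unfolding m_def k'_def
      by (rule derivative_eq_intros dP dQ dc ds refl)+
        (simp add: closed_form[OF in_U[OF that]] algebra_simps)
  qed
  have cont: "continuous_on (?I \<times> cbox 0 1) (\<lambda>x. f (circle (fst x) (snd x)))"
    if "smooth_on U f" for f :: "real^2 \<Rightarrow> real"
    by (rule continuous_on_compose2[OF smooth_on_continuous_on[OF that]])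
      (use in_U in \<open>auto intro!: continuous_on_circle continuous_intros\<close>)
  have cont_k': "continuous_on (?I \<times> cbox 0 1) (\<lambda>(\<rho>, t). k' \<rho> t)"
    unfolding k'_def c_def s_def split_beta
    by (intro continuous_intros cont P Q smooth_on_pd)
  have cont1: "continuous_on (cbox 0 1) (\<lambda>t. f (circle \<rho> t))" if "smooth_on U f" "\<rho> \<in> ?I" for f :: "real^2 \<Rightarrow> real" and \<rho>
    by (rule continuous_on_compose2[OF smooth_on_continuous_on[OF that(1)]])
      (use in_U that in \<open>auto intro!: continuous_on_circle continuous_intros\<close>)
  have int_k: "k \<rho> integrable_on cbox 0 1" if "\<rho> \<in> ?I" for \<rho>
    unfolding k_def c_def s_def
    by (intro integrable_continuous continuous_intros cont1 P Q that)
  have int_k'0: "integral (cbox 0 1) (k' \<rho>) = 0" if "\<rho> \<in> ?I" for \<rho>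
  proof -
    have "(k' \<rho> has_integral (m \<rho> 1 - m \<rho> 0)) {0..1}"
      by (rule fundamental_theorem_of_calculus)
        (use Dm[OF that] in \<open>auto simp: has_real_derivative_iff_has_vector_derivative
          intro: has_vector_derivative_at_within\<close>)
    moreover have "m \<rho> 1 = m \<rho> 0" by (simp add: m_def c_def s_def circle_def)
    ultimately show ?thesis by (simp add: integral_unique)
  qed
  have "((\<lambda>\<rho>. integral (cbox 0 1) (k \<rho>)) has_real_derivative integral (cbox 0 1) (k' \<rho>)) (at \<rho> within ?I)"
    if "\<rho> \<in> ?I" for \<rho>
    by (rule leibniz_rule_field_derivative[OF Dk int_k cont_k' that]) auto
  then have "((\<lambda>\<rho>. circulation P Q \<rho>) has_real_derivative 0) (at \<rho> within ?I)" if "\<rho> \<in> ?I" for \<rho>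
    using that int_k'0 by (simp add: circ_k[abs_def])
  then obtain C where "\<And>\<rho>. \<rho> \<in> ?I \<Longrightarrow> circulation P Q \<rho> = C"
    using has_field_derivative_zero_constant[of ?I "\<lambda>\<rho>. circulation P Q \<rho>"] by auto
  then show ?thesis using \<rho> R by simp
qed

text \<open>A form of Stokes' theorem on a punctured disc: in polar coordinates the gradient of a radial
  cutoff sees only the circulations, which do not depend on the radius.\<close>

lemma cutoff_gradient_pairing:
  assumes U: "open U" "cball 0 R - {0} \<subseteq> U" "0 \<notin> U" and R: "0 < R"
    and P: "smooth_on U P" and Q: "smooth_on U Q"
    and closed_form: "\<And>x. x \<in> U \<Longrightarrow> pd 1 Q x = pd 2 P x"
    and ab: "0 < a" "a < b" "b \<le> R\<^sup>2"
    and DH: "\<And>s. 0 \<le> s \<Longrightarrow> (H has_real_derivative h s) (at s)"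
    and cont_h: "continuous_on UNIV h"
    and H: "H 0 = 1" "\<And>s. b \<le> s \<Longrightarrow> H s = 0"
    and h: "\<And>s. s \<le> a \<Longrightarrow> h s = 0" "\<And>s. b \<le> s \<Longrightarrow> h s = 0"
    and pd_chi: "\<And>i. pd i \<eta> = (\<lambda>x. 2 * x $ i * h (norm_sq x))"
    and test: "\<And>i. pd i \<eta> \<in> test_functions U"
  shows "(LINT x|lborel. pd 1 \<eta> x * Q x - pd 2 \<eta> x * P x) = - circulation P Q R"
proof -
  define G where "G = (\<lambda>x. pd 1 \<eta> x * Q x - pd 2 \<eta> x * P x)"
  have cont: "continuous_on UNIV G"
    unfolding G_def
    by (intro continuous_on_diff smooth_on_continuous_on test_functionsD(1)[of _ U]
        test_functions_mult_local U(1) test P Q)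
  have out: "G x = 0" if "R \<le> norm x" for x
  proof -
    have "R\<^sup>2 \<le> norm_sq x" unfolding norm_sq by (rule power_mono) (use that R in auto)
    then show ?thesis using ab h(2)[of "norm_sq x"] by (simp add: G_def pd_chi)
  qed
  have inner: "integral {0..1} (\<lambda>t. 2 * pi * \<rho> * G (circle \<rho> t)) = 2 * \<rho> * h (\<rho>\<^sup>2) * circulation P Q R"
    if "\<rho> \<in> {0..R}" for \<rho>
  proof -
    have "integral {0..1} (\<lambda>t. 2 * pi * \<rho> * G (circle \<rho> t)) =
        integral {0..1} (\<lambda>t. (2 * \<rho> * h (\<rho>\<^sup>2)) * (2 * pi * (circle \<rho> t $ 1 * Q (circle \<rho> t) - circle \<rho> t $ 2 * P (circle \<rho> t))))"
      by (rule integral_cong) (simp add: G_def pd_chi norm_sq_circle algebra_simps)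
    also have "\<dots> = (2 * \<rho> * h (\<rho>\<^sup>2)) * circulation P Q \<rho>"
      unfolding circulation_def by (rule integral_mult_right)
    also have "\<dots> = 2 * \<rho> * h (\<rho>\<^sup>2) * circulation P Q R"
      using circulation_constant[OF U(1,2) R P Q closed_form, of \<rho>] that by (cases "\<rho> = 0") auto
    finally show ?thesis .
  qed
  have "((\<lambda>\<rho>. 2 * \<rho> * h (\<rho>\<^sup>2)) has_integral (H (R\<^sup>2) - H (0\<^sup>2))) {0..R}"
  proof (rule fundamental_theorem_of_calculus)
    fix \<rho> assume "\<rho> \<in> {0..R}"
    have "((\<lambda>\<rho>. H (\<rho>\<^sup>2)) has_real_derivative h (\<rho>\<^sup>2) * (2 * \<rho>)) (at \<rho>)"
      by (rule DERIV_chain2[OF DH]) (auto intro!: derivative_eq_intros)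
    then show "((\<lambda>\<rho>. H (\<rho>\<^sup>2)) has_vector_derivative 2 * \<rho> * h (\<rho>\<^sup>2)) (at \<rho> within {0..R})"
      by (auto simp: has_real_derivative_iff_has_vector_derivative ac_simps
          intro: has_vector_derivative_at_within)
  qed (use R in auto)
  then have total: "integral {0..R} (\<lambda>\<rho>. 2 * \<rho> * h (\<rho>\<^sup>2)) = - 1"
    using H ab by (simp add: integral_unique)
  have "(LINT x|lborel. G x) = integral {0..R} (\<lambda>\<rho>. integral {0..1} (\<lambda>t. 2 * pi * \<rho> * G (circle \<rho> t)))"
    by (rule integral_polar[OF cont R]) (rule out)
  also have "\<dots> = integral {0..R} (\<lambda>\<rho>. 2 * \<rho> * h (\<rho>\<^sup>2) * circulation P Q R)"
    by (rule integral_cong) (rule inner)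
  also have "\<dots> = integral {0..R} (\<lambda>\<rho>. 2 * \<rho> * h (\<rho>\<^sup>2)) * circulation P Q R"
    by (rule integral_mult_left)
  finally show ?thesis unfolding total G_def by simp
qed


section \<open>Strain fields with an isolated singularity\<close>

lemma test_functions_punctured:
  assumes "\<phi> \<in> test_functions \<Omega>" "0 < \<delta>" "\<And>x. x \<in> ball 0 \<delta> \<Longrightarrow> \<phi> x = 0"
  shows "\<phi> \<in> test_functions (\<Omega> - {0})"
proof (rule test_functionsI)
  show "smooth_on UNIV \<phi>" using test_functionsD(1)[OF assms(1)] .
  show "compact (tsupport \<phi> - ball 0 \<delta>)"
    using test_functionsD(2)[OF assms(1)] by (intro compact_diff) auto
  show "tsupport \<phi> - ball 0 \<delta> \<subseteq> \<Omega> - {0}"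
    using test_functionsD(3)[OF assms(1)] assms(2) by auto
  show "\<phi> x = 0" if "x \<notin> tsupport \<phi> - ball 0 \<delta>" for x
    using that assms(3) zero_outside_tsupport[of x \<phi>] by blast
qed

lemma pd_add_test:
  assumes "\<phi> \<in> test_functions U" "\<psi> \<in> test_functions U"
  shows "pd i (\<lambda>x. \<phi> x + \<psi> x) = (\<lambda>x. pd i \<phi> x + pd i \<psi> x)"
  using pd_add test_functions_differentiable assms by blast

lemma pd_cmult_test:
  fixes \<phi> :: "real^2 \<Rightarrow> real"
  assumes "\<phi> \<in> test_functions U"
  shows "pd i (\<lambda>x. c * \<phi> x) = (\<lambda>x. c * pd i \<phi> x)"
  using pd_linear[OF bounded_linear_mult_right test_functions_differentiable[OF assms]] by blast

lemma bounded_linear_entry: "bounded_linear (\<lambda>M::real^2^2. M $ i $ j)"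
  by (rule bounded_linear_compose[OF bounded_linear_vec_nth bounded_linear_vec_nth])

definition affine_fun :: "real \<Rightarrow> real \<Rightarrow> real \<Rightarrow> real^2 \<Rightarrow> real" where
  "affine_fun \<alpha> \<beta> \<gamma> x = \<alpha> + \<beta> * x $ 1 + \<gamma> * x $ 2"

lemma smooth_on_affine_fun: "open S \<Longrightarrow> smooth_on S (affine_fun \<alpha> \<beta> \<gamma>)"
  unfolding affine_fun_def[abs_def]
  by (intro smooth_on_add smooth_on_cmult smooth_on_coord smooth_on_const)

lemma pd_affine_fun: "pd i (affine_fun \<alpha> \<beta> \<gamma>) = (\<lambda>x. if i = 1 then \<beta> else \<gamma>)"
proof -
  have "(affine_fun \<alpha> \<beta> \<gamma> has_derivative (\<lambda>h. \<beta> * h $ 1 + \<gamma> * h $ 2)) (at x)" for x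
    unfolding affine_fun_def[abs_def]
    by (auto intro!: derivative_eq_intros bounded_linear.has_derivative[OF bounded_linear_vec_nth])
  from pd_eqI[OF this] show ?thesis using exhaust_2[of i] by (auto simp: fun_eq_iff axis_def)
qed

locale strain_field =
  fixes \<Omega> :: "(real^2) set" and E :: "(real^2^2) dist" and E0 :: "real^2 \<Rightarrow> real^2^2"
  assumes open_domain: "open \<Omega>" and dist_E: "distribution_on \<Omega> E"
    and E_smooth: "given_by_smooth (\<Omega> - {0}) E E0"
begin

abbreviation U where "U \<equiv> \<Omega> - {0}"

lemma open_U: "open U"
  using open_domain by (simp add: open_delete)

lemma E_add: "\<phi> \<in> test_functions \<Omega> \<Longrightarrow> \<psi> \<in> test_functions \<Omega> \<Longrightarrow> E (\<lambda>x. \<phi> x + \<psi> x) = E \<phi> + E \<psi>"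
  using dist_E unfolding distribution_on_def by blast

lemma E_cmult: "\<phi> \<in> test_functions \<Omega> \<Longrightarrow> E (\<lambda>x. c * \<phi> x) = c *\<^sub>R E \<phi>"
  using dist_E unfolding distribution_on_def by blast

definition entry where "entry i j x = E0 x $ i $ j"

definition curl_row where "curl_row i x = pd 1 (entry i 2) x - pd 2 (entry i 1) x"

definition incompatibility where "incompatibility = dCurl_vec (dCurl_mat E)"

lemma incompatibility_eq: "incompatibility \<phi> = E (pd 1 (pd 1 \<phi>)) $ 2 $ 2 - E (pd 2 (pd 1 \<phi>)) $ 2 $ 1
    - E (pd 1 (pd 2 \<phi>)) $ 1 $ 2 + E (pd 2 (pd 2 \<phi>)) $ 1 $ 1"
  by (simp add: incompatibility_def dCurl_vec_def dCurl_mat_def dpd_def)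

lemma incompatibility_add:
  assumes "\<phi> \<in> test_functions \<Omega>" "\<psi> \<in> test_functions \<Omega>"
  shows "incompatibility (\<lambda>x. \<phi> x + \<psi> x) = incompatibility \<phi> + incompatibility \<psi>"
  using assms
  by (simp add: incompatibility_eq pd_add_test[OF assms] pd_add_test[OF test_functions_pd test_functions_pd]
      E_add test_functions_pd)

lemma incompatibility_cmult:
  assumes "\<phi> \<in> test_functions \<Omega>"
  shows "incompatibility (\<lambda>x. c * \<phi> x) = c * incompatibility \<phi>"
  using assms
  by (simp add: incompatibility_eq pd_cmult_test[OF assms] pd_cmult_test[OF test_functions_pd]
      E_cmult test_functions_pd algebra_simps)

lemma smooth_entry: "smooth_on U (entry i j)"
  unfolding entry_def[abs_def]
  by (rule smooth_on_linear[OF open_U bounded_linear_entry])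
    (use E_smooth in \<open>simp add: given_by_smooth_def\<close>)

lemma smooth_curl_row: "smooth_on U (curl_row i)"
  unfolding curl_row_def[abs_def] by (intro smooth_on_diff open_U smooth_on_pd smooth_entry)

lemma curl_mat_eq: "curl_mat E0 x $ i = curl_row i x"
  by (simp add: curl_mat_def curl_row_def entry_def[abs_def])

lemma curl_curl_eq: "curl_vec (curl_mat E0) x = pd 1 (curl_row 2) x - pd 2 (curl_row 1) x"
  by (simp add: curl_vec_def curl_mat_eq)

lemma E_punctured:
  assumes "\<phi> \<in> test_functions U"
  shows "E \<phi> $ i $ j = (LINT x|lborel. \<phi> x * entry i j x)"
proof -
  have contE0: "continuous_on U E0"
    using E_smooth smooth_on_continuous_on by (auto simp: given_by_smooth_def)
  have "continuous_on (U \<union> - tsupport \<phi>) (\<lambda>x. \<phi> x *\<^sub>R E0 x)"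
  proof (rule continuous_on_open_Un[OF open_U])
    show "continuous_on U (\<lambda>x. \<phi> x *\<^sub>R E0 x)"
      using continuous_on_subset[OF smooth_on_continuous_on[OF test_functionsD(1)[OF assms]]]
      by (intro continuous_on_scaleR contE0) auto
    have "\<phi> x *\<^sub>R E0 x = 0" if "x \<in> - tsupport \<phi>" for x
      using that zero_outside_tsupport[of x \<phi>] by simp
    then show "continuous_on (- tsupport \<phi>) (\<lambda>x. \<phi> x *\<^sub>R E0 x)"
      using continuous_on_cong[of "- tsupport \<phi>" _ "\<lambda>x. \<phi> x *\<^sub>R E0 x" "\<lambda>x. 0"] by simp
  qed (simp add: open_Compl)
  moreover have "U \<union> - tsupport \<phi> = UNIV" using test_functionsD(3)[OF assms] by auto
  ultimately have "continuous_on UNIV (\<lambda>x. \<phi> x *\<^sub>R E0 x)" by simp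
  then have "integrable lborel (\<lambda>x. \<phi> x *\<^sub>R E0 x)"
    by (rule continuous_compact_support_integrable[OF _ test_functionsD(2)[OF assms]])
      (simp add: zero_outside_tsupport)
  from integral_bounded_linear[OF bounded_linear_entry[of i j] this]
  have "(LINT x|lborel. \<phi> x *\<^sub>R E0 x) $ i $ j = (LINT x|lborel. \<phi> x * entry i j x)"
    by (simp add: entry_def)
  moreover have "E \<phi> = (LINT x|lborel. \<phi> x *\<^sub>R E0 x)"
    using E_smooth assms by (simp add: given_by_smooth_def dist_eq_def)
  ultimately show ?thesis by simp
qed

lemma second_derivative_punctured:
  assumes "\<phi> \<in> test_functions U"
  shows "E (pd k (pd l \<phi>)) $ i $ j = (LINT x|lborel. \<phi> x * pd l (pd k (entry i j)) x)"
proof -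
  have "E (pd k (pd l \<phi>)) $ i $ j = (LINT x|lborel. pd k (pd l \<phi>) x * entry i j x)"
    by (intro E_punctured test_functions_pd assms)
  also have "\<dots> = - (LINT x|lborel. pd l \<phi> x * pd k (entry i j) x)"
    by (rule integral_by_parts(1)[OF open_U test_functions_pd[OF assms] smooth_entry])
  also have "(LINT x|lborel. pd l \<phi> x * pd k (entry i j) x) = - (LINT x|lborel. \<phi> x * pd l (pd k (entry i j)) x)"
    by (rule integral_by_parts(1)[OF open_U assms smooth_on_pd[OF smooth_entry]])
  finally show ?thesis by simp
qed

lemma pd_curl_row: "x \<in> U \<Longrightarrow> pd k (curl_row i) x = pd k (pd 1 (entry i 2)) x - pd k (pd 2 (entry i 1)) x"
proof -
  assume x: "x \<in> U"
  have d: "pd l (entry i j) differentiable (at x)" for l j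
    by (rule smooth_on_differentiable[OF smooth_on_pd[OF smooth_entry] x])
  have m: "pd k (\<lambda>y. - pd 2 (entry i 1) y) x = - pd k (pd 2 (entry i 1)) x"
    by (rule pd_linear[OF bounded_linear_minus[OF bounded_linear_ident] d])
  have dm: "(\<lambda>y. - pd 2 (entry i 1) y) differentiable (at x)"
    by (rule differentiable_linear[OF bounded_linear_minus[OF bounded_linear_ident] d])
  have "pd k (\<lambda>y. pd 1 (entry i 2) y + - pd 2 (entry i 1) y) x = pd k (pd 1 (entry i 2)) x + - pd k (pd 2 (entry i 1)) x"
    using pd_add[OF d dm] m by simp
  then show ?thesis by (simp add: curl_row_def[abs_def])
qed

lemma incompatibility_punctured:
  assumes "\<phi> \<in> test_functions U"
  shows "incompatibility \<phi> = (LINT x|lborel. \<phi> x * curl_vec (curl_mat E0) x)"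
proof -
  have int: "integrable lborel (\<lambda>x. \<phi> x * pd l (pd k (entry i j)) x)" for i j k l
    by (rule integral_by_parts(2)[OF open_U assms smooth_on_pd[OF smooth_on_pd[OF smooth_entry]]])
  have "\<phi> x * curl_vec (curl_mat E0) x = \<phi> x * pd 1 (pd 1 (entry 2 2)) x - \<phi> x * pd 1 (pd 2 (entry 2 1)) x
      - \<phi> x * pd 2 (pd 1 (entry 1 2)) x + \<phi> x * pd 2 (pd 2 (entry 1 1)) x" for x
  proof (cases "x \<in> U")
    case True
    then show ?thesis by (simp add: curl_curl_eq pd_curl_row algebra_simps)
  next
    case False
    then have "\<phi> x = 0" using test_functionsD(3)[OF assms] zero_outside_tsupport[of x \<phi>] by blast
    then show ?thesis by simp
  qed
  then show ?thesis
    unfolding incompatibility_eq second_derivative_punctured[OF assms] using int by simp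
qed

text \<open>Away from the singularity the incompatibility is a function, so (i) says that it is supported at
  the origin.\<close>

lemma curl_curl_zero_iff:
  "(\<forall>x\<in>U. curl_vec (curl_mat E0) x = 0) \<longleftrightarrow> (\<forall>\<phi>\<in>test_functions U. incompatibility \<phi> = 0)"
proof
  assume zero: "\<forall>x\<in>U. curl_vec (curl_mat E0) x = 0"
  show "\<forall>\<phi>\<in>test_functions U. incompatibility \<phi> = 0"
  proof
    fix \<phi> :: "real^2 \<Rightarrow> real" assume \<phi>: "\<phi> \<in> test_functions U"
    have "\<phi> x * curl_vec (curl_mat E0) x = 0" for x
      using zero test_functionsD(3)[OF \<phi>] zero_outside_tsupport[of x \<phi>] by (cases "x \<in> U") auto
    then show "incompatibility \<phi> = 0" by (simp only: incompatibility_punctured[OF \<phi>]) simp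
  qed
next
  assume zero: "\<forall>\<phi>\<in>test_functions U. incompatibility \<phi> = 0"
  have "smooth_on U (curl_vec (curl_mat E0))"
    unfolding curl_curl_eq[abs_def] by (intro smooth_on_diff open_U smooth_on_pd smooth_curl_row)
  then show "\<forall>x\<in>U. curl_vec (curl_mat E0) x = 0"
    using fundamental_lemma[OF open_U, of "curl_vec (curl_mat E0)"] zero incompatibility_punctured by simp
qed

text \<open>The difference of the two test functions vanishes near the origin, hence is a test function on the
  punctured domain.\<close>

lemma incompatibility_localize:
  assumes supp: "\<forall>\<phi>\<in>test_functions U. incompatibility \<phi> = 0"
    and "\<phi> \<in> test_functions \<Omega>" "\<psi> \<in> test_functions \<Omega>" "0 < \<delta>"
    and eq: "\<And>x. x \<in> ball 0 \<delta> \<Longrightarrow> \<phi> x = \<psi> x"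
  shows "incompatibility \<phi> = incompatibility \<psi>"
proof -
  have m: "(\<lambda>x. (-1) * \<psi> x) \<in> test_functions \<Omega>"
    by (rule test_functions_cmult[OF assms(3)])
  have d: "(\<lambda>x. \<phi> x + (-1) * \<psi> x) \<in> test_functions U"
    by (rule test_functions_punctured[OF test_functions_add[OF assms(2) m] assms(4)]) (simp add: eq)
  have "incompatibility (\<lambda>x. \<phi> x + (-1) * \<psi> x) = incompatibility \<phi> + (-1) * incompatibility \<psi>"
    by (simp only: incompatibility_add[OF assms(2) m] incompatibility_cmult[OF assms(3)])
  then show ?thesis using supp d by simp
qed

text \<open>For an affine function a with partial derivatives a_1 and a_2, this is the 1-form
  a c - a_1 E_2 + a_2 E_1, where E_i is row i of the strain and c the curl of the strain; k selects the
  component. The components of the Cesaro integrand are such forms, for affine functions which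
  depend on x.\<close>

definition form where
  "form \<alpha> \<beta> \<gamma> k x = affine_fun \<alpha> \<beta> \<gamma> x * curl_row k x - \<beta> * entry 2 k x + \<gamma> * entry 1 k x"

lemma smooth_form: "smooth_on U (form \<alpha> \<beta> \<gamma> k)"
  unfolding form_def[abs_def]
  by (intro smooth_on_add smooth_on_diff smooth_on_mult[OF open_U smooth_on_affine_fun] smooth_on_cmult
      open_U smooth_curl_row smooth_entry)

text \<open>The curl of the form is the affine function times the double curl of the strain, plus terms linear
  in the gradient of the affine function; the latter cancel because the rows of the curl are the
  curls of the rows.\<close>

lemma form_closed:
  assumes "curl_vec (curl_mat E0) x = 0" "x \<in> U"
  shows "pd 1 (form \<alpha> \<beta> \<gamma> 2) x = pd 2 (form \<alpha> \<beta> \<gamma> 1) x"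
proof -
  have dw: "curl_row k differentiable (at x)" and de: "entry i k differentiable (at x)" for i k
    using smooth_on_differentiable[OF smooth_curl_row assms(2)] smooth_on_differentiable[OF smooth_entry assms(2)] by blast+
  have da: "affine_fun \<alpha> \<beta> \<gamma> differentiable (at x)"
    using smooth_on_differentiable[OF smooth_on_affine_fun[OF open_UNIV]] by blast
  have dm: "(\<lambda>x. c * entry i k x) differentiable (at x)" for c i k
    using differentiable_linear[OF bounded_linear_mult_right de] .
  have pm: "pd l (\<lambda>x. c * entry i k x) x = c * pd l (entry i k) x" for c i k l
    using pd_linear[OF bounded_linear_mult_right de] .
  note d1 = differentiable_mult[OF da dw]
  have "pd l (\<lambda>x. (affine_fun \<alpha> \<beta> \<gamma> x * curl_row k x + (- \<beta>) * entry 2 k x) + \<gamma> * entry 1 k x) x =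
      pd l (affine_fun \<alpha> \<beta> \<gamma>) x * curl_row k x + affine_fun \<alpha> \<beta> \<gamma> x * pd l (curl_row k) x
      + (- \<beta>) * pd l (entry 2 k) x + \<gamma> * pd l (entry 1 k) x" for k l
    by (simp only: pd_add[OF differentiable_add[OF d1 dm] dm] pd_add[OF d1 dm] pd_mult[OF da dw] pm)
  then have "pd l (form \<alpha> \<beta> \<gamma> k) x = pd l (affine_fun \<alpha> \<beta> \<gamma>) x * curl_row k x
      + affine_fun \<alpha> \<beta> \<gamma> x * pd l (curl_row k) x - \<beta> * pd l (entry 2 k) x + \<gamma> * pd l (entry 1 k) x" for k l
    by (simp add: form_def[abs_def])
  moreover have "pd 1 (curl_row 2) x = pd 2 (curl_row 1) x" using assms(1) by (simp add: curl_curl_eq)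
  ultimately show ?thesis
    by (simp add: pd_affine_fun) (simp add: curl_row_def algebra_simps)
qed

lemma E_second_derivative_cutoff:
  fixes \<alpha> \<beta> \<gamma> :: real
  assumes "smooth_on UNIV \<eta>" and test: "\<And>i. pd i \<eta> \<in> test_functions U"
  defines "a \<equiv> affine_fun \<alpha> \<beta> \<gamma>"
  shows "E (pd k (pd l (\<lambda>x. \<eta> x * a x))) $ i $ j =
    (LINT x|lborel. pd k \<eta> x * (pd l a x * entry i j x) - pd l \<eta> x * (a x * pd k (entry i j) x))"
proof -
  have a: "smooth_on S a" if "open S" for S
    unfolding a_def using that by (rule smooth_on_affine_fun)
  have a': "smooth_on S (pd m a)" for S m
    unfolding a_def pd_affine_fun by (rule smooth_on_const)
  note d\<eta> = smooth_on_differentiable[OF assms(1) UNIV_I]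
  note da = smooth_on_differentiable[OF a[OF open_UNIV] UNIV_I]
  have pda: "pd m (pd n a) x = 0" for m n x
    by (simp add: a_def pd_affine_fun)
  have dpa: "pd m a differentiable (at x)" for m x
    by (simp add: a_def pd_affine_fun)
  have step1: "pd l (\<lambda>x. \<eta> x * a x) = (\<lambda>x. pd l \<eta> x * a x + \<eta> x * pd l a x)" for l
    using pd_mult[OF d\<eta> da] by blast
  have d\<eta>': "pd m \<eta> differentiable (at x)" for m x
    by (rule test_functions_differentiable[OF test])
  have step2: "pd k (pd l (\<lambda>x. \<eta> x * a x)) =
      (\<lambda>x. (pd k (pd l \<eta>) x * a x + pd l \<eta> x * pd k a x) + pd k \<eta> x * pd l a x)"
  proof
    fix x
    have "pd k (\<lambda>x. pd l \<eta> x * a x + \<eta> x * pd l a x) x =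
      (pd k (pd l \<eta>) x * a x + pd l \<eta> x * pd k a x) + (pd k \<eta> x * pd l a x + \<eta> x * pd k (pd l a) x)"
      by (simp only: pd_add[OF differentiable_mult[OF d\<eta>' da] differentiable_mult[OF d\<eta> dpa]]
          pd_mult[OF d\<eta>' da] pd_mult[OF d\<eta> dpa])
    then show "pd k (pd l (\<lambda>x. \<eta> x * a x)) x =
      (pd k (pd l \<eta>) x * a x + pd l \<eta> x * pd k a x) + pd k \<eta> x * pd l a x"
      unfolding step1 by (simp add: pda)
  qed
  have t1: "(\<lambda>x. pd k (pd l \<eta>) x * a x) \<in> test_functions U"
    by (intro test_functions_mult test_functions_pd test a open_UNIV)
  have t2: "(\<lambda>x. pd l \<eta> x * pd k a x) \<in> test_functions U" for k l
    by (intro test_functions_mult test_functions_pd test a')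
  have t: "pd k (pd l (\<lambda>x. \<eta> x * a x)) \<in> test_functions U"
    unfolding step2 by (intro test_functions_add t1 t2)
  have ae: "smooth_on U (\<lambda>x. a x * entry i j x)" by (intro smooth_on_mult open_U a smooth_entry)
  have pd_ae: "pd k (\<lambda>x. a x * entry i j x) x = pd k a x * entry i j x + a x * pd k (entry i j) x" if "x \<in> U" for x
    by (rule pd_mult[OF da smooth_on_differentiable[OF smooth_entry that]])
  have out: "pd l \<eta> x = 0" if "x \<notin> U" for x l
    using that test_functionsD(3)[OF test] zero_outside_tsupport[of x "pd l \<eta>"] by blast
  have ia: "integrable lborel (\<lambda>x. pd l \<eta> x * (pd k a x * entry i j x))" for k l
    by (intro integral_by_parts(2)[OF open_U test] smooth_on_mult open_U a' smooth_entry)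
  have ib: "integrable lborel (\<lambda>x. pd l \<eta> x * (a x * pd k (entry i j) x))" for k l
    by (intro integral_by_parts(2)[OF open_U test] smooth_on_mult open_U a smooth_on_pd smooth_entry)
  have ic: "integrable lborel (\<lambda>x. pd k (pd l \<eta>) x * (a x * entry i j x))"
    by (rule integral_by_parts(2)[OF open_U test_functions_pd[OF test] ae])
  have bp: "(LINT x|lborel. pd k (pd l \<eta>) x * (a x * entry i j x)) =
      - (LINT x|lborel. pd l \<eta> x * (pd k a x * entry i j x) + pd l \<eta> x * (a x * pd k (entry i j) x))"
    unfolding integral_by_parts(1)[OF open_U test ae]
  proof (intro arg_cong[of _ _ uminus] Bochner_Integration.integral_cong refl)
    fix x
    show "pd l \<eta> x * pd k (\<lambda>x. a x * entry i j x) x =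
        pd l \<eta> x * (pd k a x * entry i j x) + pd l \<eta> x * (a x * pd k (entry i j) x)"
      using pd_ae[of x] out[of x l] by (cases "x \<in> U") (auto simp: algebra_simps)
  qed
  have "E (pd k (pd l (\<lambda>x. \<eta> x * a x))) $ i $ j =
      (LINT x|lborel. pd k (pd l (\<lambda>x. \<eta> x * a x)) x * entry i j x)"
    by (rule E_punctured[OF t])
  also have "\<dots> = (LINT x|lborel. pd k (pd l \<eta>) x * (a x * entry i j x) + pd l \<eta> x * (pd k a x * entry i j x)
         + pd k \<eta> x * (pd l a x * entry i j x))"
    unfolding step2 by (intro Bochner_Integration.integral_cong refl) (simp add: algebra_simps)
  also have "\<dots> = (LINT x|lborel. pd k (pd l \<eta>) x * (a x * entry i j x))
      + (LINT x|lborel. pd l \<eta> x * (pd k a x * entry i j x)) + (LINT x|lborel. pd k \<eta> x * (pd l a x * entry i j x))"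
    using ia ic by simp
  also have "\<dots> = (LINT x|lborel. pd k \<eta> x * (pd l a x * entry i j x) - pd l \<eta> x * (a x * pd k (entry i j) x))"
    unfolding bp using ia ib by simp
  finally show ?thesis .
qed

text \<open>The second derivatives of an affine function vanish, so every term of the expansion contains a
  derivative of the cutoff, and the singular point is not seen. One integration by parts in each term
  with a second derivative of the cutoff leaves only its gradient, paired with the form.\<close>

lemma incompatibility_cutoff_affine:
  assumes "smooth_on UNIV \<eta>" and test: "\<And>i. pd i \<eta> \<in> test_functions U"
  shows "incompatibility (\<lambda>x. \<eta> x * affine_fun \<alpha> \<beta> \<gamma> x) =
    - (LINT x|lborel. pd 1 \<eta> x * form \<alpha> \<beta> \<gamma> 2 x - pd 2 \<eta> x * form \<alpha> \<beta> \<gamma> 1 x)"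
proof -
  let ?a = "affine_fun \<alpha> \<beta> \<gamma>"
  have a': "smooth_on U (pd m ?a)" for m
    unfolding pd_affine_fun by (rule smooth_on_const)
  have ia: "integrable lborel (\<lambda>x. pd l \<eta> x * (pd k ?a x * entry i j x))" for k l i j
    by (intro integral_by_parts(2)[OF open_U test] smooth_on_mult open_U a' smooth_entry)
  have ib: "integrable lborel (\<lambda>x. pd l \<eta> x * (?a x * pd k (entry i j) x))" for k l i j
    by (intro integral_by_parts(2)[OF open_U test] smooth_on_mult open_U smooth_on_affine_fun smooth_on_pd smooth_entry)
  define I where "I = (\<lambda>k l i j x. pd k \<eta> x * (pd l ?a x * entry i j x) - pd l \<eta> x * (?a x * pd k (entry i j) x))"
  have I: "integrable lborel (I k l i j)" for k l i j
    unfolding I_def by (intro Bochner_Integration.integrable_diff ia ib)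
  have "incompatibility (\<lambda>x. \<eta> x * ?a x) = (LINT x|lborel. I 1 1 2 2 x) - (LINT x|lborel. I 2 1 2 1 x)
      - (LINT x|lborel. I 1 2 1 2 x) + (LINT x|lborel. I 2 2 1 1 x)"
    unfolding incompatibility_eq I_def E_second_derivative_cutoff[OF assms] ..
  also have "\<dots> = (LINT x|lborel. I 1 1 2 2 x - I 2 1 2 1 x - I 1 2 1 2 x + I 2 2 1 1 x)"
    using I by simp
  also have "\<dots> = (LINT x|lborel. - (pd 1 \<eta> x * form \<alpha> \<beta> \<gamma> 2 x - pd 2 \<eta> x * form \<alpha> \<beta> \<gamma> 1 x))"
    by (intro Bochner_Integration.integral_cong refl)
      (simp add: I_def form_def curl_row_def pd_affine_fun algebra_simps)
  also have "\<dots> = - (LINT x|lborel. pd 1 \<eta> x * form \<alpha> \<beta> \<gamma> 2 x - pd 2 \<eta> x * form \<alpha> \<beta> \<gamma> 1 x)"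
    by (rule Bochner_Integration.integral_minus)
  finally show ?thesis .
qed

text \<open>This links the distributional side to the line integrals: evaluating the incompatibility on a cut off
  affine function is a circulation.\<close>

lemma cutoff_circulation:
  assumes i: "\<forall>x\<in>U. curl_vec (curl_mat E0) x = 0"
    and \<epsilon>: "0 < \<epsilon>" "cball 0 \<epsilon> \<subseteq> \<Omega>" and s: "0 < s" "s \<le> \<epsilon>"
  obtains \<eta> \<delta> where "0 < \<delta>" "\<eta> \<in> test_functions (ball 0 s)" "\<And>x. x \<in> ball 0 \<delta> \<Longrightarrow> \<eta> x = 1"
    "\<And>\<alpha> \<beta> \<gamma>. incompatibility (\<lambda>x. \<eta> x * affine_fun \<alpha> \<beta> \<gamma> x) = circulation (form \<alpha> \<beta> \<gamma> 1) (form \<alpha> \<beta> \<gamma> 2) \<epsilon>"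
proof -
  define \<delta> where "\<delta> = s / 3"
  define \<sigma> where "\<sigma> = s / 2"
  have \<delta>\<sigma>: "0 < \<delta>" "\<delta> < \<sigma>" "\<sigma> < s" using s by (simp_all add: \<delta>_def \<sigma>_def)
  have less_sq: "\<delta>\<^sup>2 < \<sigma>\<^sup>2" by (rule power_strict_mono) (use \<delta>\<sigma> in auto)
  show ?thesis
  proof (rule radial_cutoff_exists[OF zero_less_power[OF \<delta>\<sigma>(1)] less_sq])
    fix H h :: "real \<Rightarrow> real"
    assume DH: "\<And>s. 0 \<le> s \<Longrightarrow> (H has_real_derivative h s) (at s)"
      and cont_h: "continuous_on UNIV h"
      and H: "\<And>s. 0 \<le> s \<Longrightarrow> s \<le> \<delta>\<^sup>2 \<Longrightarrow> H s = 1" "\<And>s. \<sigma>\<^sup>2 \<le> s \<Longrightarrow> H s = 0"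
      and h: "\<And>s. s \<le> \<delta>\<^sup>2 \<Longrightarrow> h s = 0" "\<And>s. \<sigma>\<^sup>2 \<le> s \<Longrightarrow> h s = 0"
      and smooth: "smooth_on UNIV (\<lambda>x. H (norm_sq x))"
      and pdH: "\<And>i. pd i (\<lambda>x. H (norm_sq x)) = (\<lambda>x. 2 * x $ i * h (norm_sq x))"
    define \<eta> where "\<eta> = (\<lambda>x. H (norm_sq x))"
    have in_ball: "norm_sq x \<le> \<delta>\<^sup>2" if "norm x \<le> \<delta>" for x
      unfolding norm_sq by (rule power_mono[OF that]) simp
    have out_ball: "\<sigma>\<^sup>2 \<le> norm_sq x" if "\<sigma> \<le> norm x" for x
      unfolding norm_sq by (rule power_mono[OF that]) (use \<delta>\<sigma> in simp)
    have \<eta>_test: "\<eta> \<in> test_functions (ball 0 s)"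
    proof (rule test_functionsI)
      show "\<eta> x = 0" if "x \<notin> cball 0 \<sigma>" for x
        using that out_ball[of x] H(2) by (simp add: \<eta>_def)
    qed (use smooth \<delta>\<sigma> in \<open>auto simp: \<eta>_def\<close>)
    have sub: "ball 0 s \<subseteq> \<Omega>" using \<epsilon>(2) s(2) by (auto simp: subset_iff)
    have pd_test: "pd i \<eta> \<in> test_functions U" for i
    proof (rule test_functions_punctured)
      show "pd i \<eta> \<in> test_functions \<Omega>"
        by (rule test_functions_mono[OF test_functions_pd[OF \<eta>_test] sub])
      show "pd i \<eta> x = 0" if "x \<in> ball 0 \<delta>" for x
        using that h(1)[OF in_ball[of x]] by (simp add: \<eta>_def pdH)
    qed (use \<delta>\<sigma> in simp)
    have "incompatibility (\<lambda>x. \<eta> x * affine_fun \<alpha> \<beta> \<gamma> x) = circulation (form \<alpha> \<beta> \<gamma> 1) (form \<alpha> \<beta> \<gamma> 2) \<epsilon>" for \<alpha> \<beta> \<gamma>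
    proof -
      have "(LINT x|lborel. pd 1 \<eta> x * form \<alpha> \<beta> \<gamma> 2 x - pd 2 \<eta> x * form \<alpha> \<beta> \<gamma> 1 x)
          = - circulation (form \<alpha> \<beta> \<gamma> 1) (form \<alpha> \<beta> \<gamma> 2) \<epsilon>"
      proof (rule cutoff_gradient_pairing[OF open_U _ _ \<epsilon>(1) smooth_form smooth_form _ _ less_sq _ DH cont_h])
        show "cball 0 \<epsilon> - {0} \<subseteq> U" using \<epsilon>(2) by auto
        show "\<sigma>\<^sup>2 \<le> \<epsilon>\<^sup>2" by (rule power_mono) (use \<delta>\<sigma> s in auto)
        show "H 0 = 1" by (rule H(1)) simp_all
        show "pd 1 (form \<alpha> \<beta> \<gamma> 2) x = pd 2 (form \<alpha> \<beta> \<gamma> 1) x" if "x \<in> U" for x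
          using form_closed i that by blast
      qed (use H(2) h pdH pd_test \<delta>\<sigma> in \<open>auto simp: \<eta>_def\<close>)
      then show ?thesis
        using incompatibility_cutoff_affine[OF test_functionsD(1)[OF \<eta>_test] pd_test] by simp
    qed
    moreover have "\<eta> x = 1" if "x \<in> ball 0 \<delta>" for x
      unfolding \<eta>_def by (rule H(1)) (use that in_ball[of x] in \<open>auto simp: norm_sq\<close>)
    ultimately show ?thesis using that \<delta>\<sigma>(1) \<eta>_test by blast
  qed
qed

text \<open>The two components of the Cesaro integral at x belong to the affine functions
  y_2 - x_2 and x_1 - y_1 of y.\<close>

lemma line_integral_eq_circulation:
  fixes x :: "real^2"
  assumes \<epsilon>: "0 < \<epsilon>" "cball 0 \<epsilon> \<subseteq> \<Omega>"
  defines "I \<equiv> line_integral (circle \<epsilon>) (\<lambda>y dy. E0 y *v dy + (curl_mat E0 y \<bullet> dy) *\<^sub>R cross_e3 (y - x))"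
  shows "I $ 1 = circulation (form (- (x $ 2)) 0 1 1) (form (- (x $ 2)) 0 1 2) \<epsilon>"
    and "I $ 2 = circulation (form (x $ 1) (- 1) 0 1) (form (x $ 1) (- 1) 0 2) \<epsilon>"
proof -
  define dy :: "real \<Rightarrow> real^2" where "dy t = vector [- (2 * pi * circle \<epsilon> t $ 2), 2 * pi * circle \<epsilon> t $ 1]" for t
  define F where "F t = E0 (circle \<epsilon> t) *v dy t + (curl_mat E0 (circle \<epsilon> t) \<bullet> dy t) *\<^sub>R cross_e3 (circle \<epsilon> t - x)" for t
  have D: "(circle \<epsilon> has_vector_derivative dy t) (at t within S)" for t S
  proof -
    have "((\<lambda>t. circle \<epsilon> t) has_vector_derivative
        ((- (2 * pi * \<epsilon> * sin (2 * pi * t))) *\<^sub>R axis 1 1 + (2 * pi * \<epsilon> * cos (2 * pi * t)) *\<^sub>R axis 2 1)) (at t within S)"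
      unfolding circle_eq has_vector_derivative_def
      by (auto intro!: derivative_eq_intros simp: algebra_simps)
    moreover have "(- (2 * pi * \<epsilon> * sin (2 * pi * t))) *\<^sub>R axis 1 1 + (2 * pi * \<epsilon> * cos (2 * pi * t)) *\<^sub>R axis 2 1 = dy t"
      by (simp add: dy_def vec_eq_iff forall_2 axis_def)
    ultimately show ?thesis by simp
  qed
  have "vector_derivative (circle \<epsilon>) (at t within {0..1}) = dy t" if "t \<in> {0..1}" for t
    using vector_derivative_within_cbox[of 0 1 t, OF _ _ D] that by simp
  then have I_F: "I = integral {0..1} F"
    unfolding I_def line_integral_def F_def by (intro integral_cong) simp
  have in_U: "circle \<epsilon> t \<in> U" for t
    using \<epsilon> norm_circle[of \<epsilon> t] by force
  have F1: "F t $ 1 = 2 * pi * (circle \<epsilon> t $ 1 * form (- (x $ 2)) 0 1 2 (circle \<epsilon> t)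
      - circle \<epsilon> t $ 2 * form (- (x $ 2)) 0 1 1 (circle \<epsilon> t))" for t
    unfolding F_def form_def affine_fun_def cross_e3_def e3_cross_def matrix_vector_mult_def
      inner_vec_def sum_2 curl_mat_eq entry_def dy_def
    by (simp add: sum_2 algebra_simps)
  have F2: "F t $ 2 = 2 * pi * (circle \<epsilon> t $ 1 * form (x $ 1) (- 1) 0 2 (circle \<epsilon> t)
      - circle \<epsilon> t $ 2 * form (x $ 1) (- 1) 0 1 (circle \<epsilon> t))" for t
    unfolding F_def form_def affine_fun_def cross_e3_def e3_cross_def matrix_vector_mult_def
      inner_vec_def sum_2 curl_mat_eq entry_def dy_def
    by (simp add: sum_2 algebra_simps)
  have cont1: "continuous_on {0..1} (\<lambda>t. f (circle \<epsilon> t))" if "smooth_on U f" for f :: "real^2 \<Rightarrow> real"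
    by (rule continuous_on_compose2[OF smooth_on_continuous_on[OF that]])
      (use in_U in \<open>auto intro!: continuous_on_circle continuous_intros\<close>)
  have cont_k: "continuous_on {0..1} (\<lambda>t. circle \<epsilon> t $ i)" for i
    by (intro continuous_on_component continuous_on_circle continuous_intros)
  have "continuous_on {0..1} (\<lambda>t. F t $ 1)" "continuous_on {0..1} (\<lambda>t. F t $ 2)"
    unfolding F1 F2 by (intro continuous_intros cont1 cont_k smooth_form)+
  then have "continuous_on {0..1} (\<lambda>t. F t $ i)" for i
    using exhaust_2[of i] by auto
  then have "continuous_on {0..1} (\<lambda>t. \<chi> i. F t $ i)"
    by (intro continuous_on_vec_lambda)
  then have int: "F integrable_on {0..1}"
    by (intro integrable_continuous_real) simp
  show "I $ 1 = circulation (form (- (x $ 2)) 0 1 1) (form (- (x $ 2)) 0 1 2) \<epsilon>"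
    unfolding I_F circulation_def integral_component_eq_cart[OF int, symmetric] F1 ..
  show "I $ 2 = circulation (form (x $ 1) (- 1) 0 1) (form (x $ 1) (- 1) 0 2) \<epsilon>"
    unfolding I_F circulation_def integral_component_eq_cart[OF int, symmetric] F2 ..
qed

end


section \<open>Taylor expansion with smooth remainders\<close>

text \<open>Differentiating under the integral sign produces one factor t for each partial derivative; the
  weights t ^ n make the statement stable under this.\<close>

lemma smooth_on_radial_average:
  fixes g :: "real^2 \<Rightarrow> real"
  assumes "smooth_on UNIV g"
  shows "smooth_on UNIV (\<lambda>x. integral {0..1} (\<lambda>t. t ^ n * g (t *\<^sub>R x)))"
proof -
  define A where "A = (\<lambda>n (g::real^2 \<Rightarrow> real) x. integral {0..1} (\<lambda>t. t ^ n * g (t *\<^sub>R x)))"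
  define B :: "2 \<Rightarrow> ((real^2) \<Rightarrow>\<^sub>L real)" where "B i = Blinfun (\<lambda>h. h $ i)" for i
  have B: "blinfun_apply (B i) h = h $ i" for i h
    by (simp add: B_def bounded_linear_Blinfun_apply[OF bounded_linear_vec_nth])
  have cont: "continuous_on S (\<lambda>p. f (snd p *\<^sub>R fst p))" if "smooth_on UNIV f"
    for f :: "real^2 \<Rightarrow> real" and S :: "((real^2) \<times> real) set"
    by (rule continuous_on_compose2[OF smooth_on_continuous_on[OF that]]) (auto intro!: continuous_intros)
  have cont1: "continuous_on S (\<lambda>t. f (t *\<^sub>R x))" if "smooth_on UNIV f" for f :: "real^2 \<Rightarrow> real" and S x
    by (rule continuous_on_compose2[OF smooth_on_continuous_on[OF that]]) (auto intro!: continuous_intros)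
  have D: "\<exists>D. (A n g has_derivative blinfun_apply D) (at x) \<and> (\<forall>i. D (axis i 1) = A (Suc n) (pd i g) x)"
    if g: "smooth_on UNIV g" for n g x
  proof -
    define fx where "fx = (\<lambda>x t. (t ^ Suc n * pd 1 g (t *\<^sub>R x)) *\<^sub>R B 1 + (t ^ Suc n * pd 2 g (t *\<^sub>R x)) *\<^sub>R B 2)"
    have 1: "((\<lambda>x. t ^ n * g (t *\<^sub>R x)) has_derivative blinfun_apply (fx x t)) (at x within UNIV)" for x t
    proof -
      have "((\<lambda>x. g (t *\<^sub>R x)) has_derivative
          (\<lambda>h. ((t *\<^sub>R h) $ 1) *\<^sub>R pd 1 g (t *\<^sub>R x) + ((t *\<^sub>R h) $ 2) *\<^sub>R pd 2 g (t *\<^sub>R x))) (at x)"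
        by (rule has_derivative_compose[OF _ has_derivative_pd[OF smooth_on_differentiable[OF g UNIV_I]]])
          (auto intro!: derivative_eq_intros)
      from has_derivative_mult_right[OF this, of "t ^ n"] show ?thesis
        by (rule has_derivative_eq_rhs)
          (simp add: fx_def fun_eq_iff B blinfun.add_left blinfun.scaleR_left algebra_simps)
    qed
    have 2: "(\<lambda>t. t ^ n * g (t *\<^sub>R x)) integrable_on cbox 0 1" for x
      by (intro integrable_continuous continuous_intros cont1 g)
    have 3: "continuous_on (UNIV \<times> cbox 0 1) (\<lambda>(x, t). fx x t)"
      unfolding fx_def split_beta by (intro continuous_intros cont smooth_on_pd g)
    have int_fx: "fx x integrable_on cbox 0 1"
      unfolding fx_def by (intro integrable_continuous continuous_intros cont1 smooth_on_pd g)
    have "(A n g has_derivative blinfun_apply (integral (cbox 0 1) (fx x))) (at x within UNIV)"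
      unfolding A_def interval_cbox by (rule leibniz_rule[OF 1 2 3]) auto
    moreover have "integral (cbox 0 1) (fx x) (axis i 1) = A (Suc n) (pd i g) x" for i
    proof -
      have "blinfun_apply (integral (cbox 0 1) (fx x)) (axis i 1) = integral (cbox 0 1) (\<lambda>t. fx x t (axis i 1))"
        using integral_linear[OF int_fx blinfun.bounded_linear_left[of "axis i 1"]] by (simp add: o_def)
      also have "(\<lambda>t. fx x t (axis i 1)) = (\<lambda>t. t ^ Suc n * pd i g (t *\<^sub>R x))"
        using exhaust_2[of i]
        by (auto simp: fx_def fun_eq_iff B blinfun.add_left blinfun.scaleR_left axis_def)
      finally show ?thesis by (simp add: A_def)
    qed
    ultimately show ?thesis by auto
  qed
  have pd_A: "pd i (A n g) = A (Suc n) (pd i g)" and diff_A: "A n g differentiable (at x)"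
    if g: "smooth_on UNIV g" for i n g x
  proof -
    show "pd i (A n g) = A (Suc n) (pd i g)"
    proof
      fix x
      obtain D where D: "(A n g has_derivative blinfun_apply D) (at x)" "\<forall>i. D (axis i 1) = A (Suc n) (pd i g) x"
        using D[OF g] by blast
      show "pd i (A n g) x = A (Suc n) (pd i g) x" using pd_eqI[OF D(1)] D(2) by simp
    qed
    show "A n g differentiable (at x)"
      using D[OF g, of n x] differentiableI by metis
  qed
  have "Ck_on k UNIV (A n g)" if "smooth_on UNIV g" for k n g
    using that
  proof (induction k arbitrary: n g)
    case 0
    have "continuous_on UNIV (A n g)"
      by (rule Ck_on_differentiable) (rule diff_A[OF 0])
    then show ?case by simp
  next
    case (Suc k)
    have "Ck_on k UNIV (pd i (A n g))" for i
      unfolding pd_A[OF Suc.prems] by (rule Suc.IH[OF smooth_on_pd[OF Suc.prems]])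
    then show ?case using diff_A[OF Suc.prems] by simp
  qed
  from this[OF assms] have "smooth_on UNIV (A n g)"
    by (simp add: smooth_on_def[of UNIV "A n g"])
  then show ?thesis by (simp add: A_def)
qed

text \<open>Hadamard's lemma, by integrating the derivative along rays.\<close>

lemma hadamard:
  fixes g :: "real^2 \<Rightarrow> real"
  assumes g: "smooth_on UNIV g"
  obtains g1 g2 where "smooth_on UNIV g1" "smooth_on UNIV g2" "g1 0 = pd 1 g 0" "g2 0 = pd 2 g 0"
    "\<And>x. g x = g 0 + x $ 1 * g1 x + x $ 2 * g2 x"
proof -
  define G where "G = (\<lambda>i x. integral {0..1} (\<lambda>t. pd i g (t *\<^sub>R x)))"
  have smooth_G: "smooth_on UNIV (G i)" for i
    using smooth_on_radial_average[OF smooth_on_pd[OF g], of 0] by (simp add: G_def)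
  have cont1: "continuous_on S (\<lambda>t. pd i g (t *\<^sub>R x))" for i S x
    by (rule continuous_on_compose2[OF smooth_on_continuous_on[OF smooth_on_pd[OF g]]])
      (auto intro!: continuous_intros)
  have int: "(\<lambda>t. pd i g (t *\<^sub>R x)) integrable_on {0..1}" for i x
    by (intro integrable_continuous_real cont1)
  have "g x = g 0 + x $ 1 * G 1 x + x $ 2 * G 2 x" for x
  proof -
    have D: "((\<lambda>t. g (t *\<^sub>R x)) has_vector_derivative (x $ 1 * pd 1 g (t *\<^sub>R x) + x $ 2 * pd 2 g (t *\<^sub>R x))) (at t)" for t
    proof -
      have "((\<lambda>t. g (t *\<^sub>R x)) has_derivative
          (\<lambda>h. ((h *\<^sub>R x) $ 1) *\<^sub>R pd 1 g (t *\<^sub>R x) + ((h *\<^sub>R x) $ 2) *\<^sub>R pd 2 g (t *\<^sub>R x))) (at t)"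
        by (rule has_derivative_compose[OF _ has_derivative_pd[OF smooth_on_differentiable[OF g UNIV_I]]])
          (auto intro!: derivative_eq_intros)
      then show ?thesis
        unfolding has_vector_derivative_def
        by (rule has_derivative_eq_rhs) (simp add: fun_eq_iff algebra_simps)
    qed
    have "((\<lambda>t. x $ 1 * pd 1 g (t *\<^sub>R x) + x $ 2 * pd 2 g (t *\<^sub>R x)) has_integral (g (1 *\<^sub>R x) - g (0 *\<^sub>R x))) {0..1}"
      by (rule fundamental_theorem_of_calculus) (simp_all add: D has_vector_derivative_at_within)
    moreover have "((\<lambda>t. x $ 1 * pd 1 g (t *\<^sub>R x) + x $ 2 * pd 2 g (t *\<^sub>R x)) has_integral (x $ 1 * G 1 x + x $ 2 * G 2 x)) {0..1}"
      unfolding G_def by (intro has_integral_add has_integral_mult_right integrable_integral int)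
    ultimately have "g (1 *\<^sub>R x) - g (0 *\<^sub>R x) = x $ 1 * G 1 x + x $ 2 * G 2 x"
      by (rule has_integral_unique)
    then show ?thesis by simp
  qed
  moreover have "G i 0 = pd i g 0" for i by (simp add: G_def)
  ultimately show ?thesis using that[of "G 1" "G 2"] smooth_G by blast
qed


section \<open>Seminorms of concentrated functions\<close>

lemma fold_pd_add:
  "smooth_on UNIV f \<Longrightarrow> smooth_on UNIV g \<Longrightarrow>
    fold pd is (\<lambda>x. f x + g x) = (\<lambda>x. fold pd is f x + fold pd is g x)"
proof (induction "is" arbitrary: f g)
  case (Cons i "is")
  have "pd i (\<lambda>x. f x + g x) = (\<lambda>x. pd i f x + pd i g x)"
    using pd_add smooth_on_differentiable[OF Cons.prems(1)] smooth_on_differentiable[OF Cons.prems(2)]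
    by blast
  then show ?case using Cons.IH[OF smooth_on_pd[OF Cons.prems(1)] smooth_on_pd[OF Cons.prems(2)]] by simp
qed simp

lemma fold_pd_cmult:
  fixes f :: "real^2 \<Rightarrow> real"
  shows "smooth_on UNIV f \<Longrightarrow> fold pd is (\<lambda>x. c * f x) = (\<lambda>x. c * fold pd is f x)"
proof (induction "is" arbitrary: f)
  case (Cons i "is")
  have "pd i (\<lambda>x. c * f x) = (\<lambda>x. c * pd i f x)"
    using pd_linear[OF bounded_linear_mult_right smooth_on_differentiable[OF Cons.prems UNIV_I]] by blast
  then show ?case using Cons.IH[OF smooth_on_pd[OF Cons.prems]] by simp
qed simp

lemma fold_replicate_funpow: "fold f (replicate n x) = f x ^^ n"
  by (induction n) (simp_all add: funpow_Suc_right del: funpow.simps(2))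

lemma mpd_eq_fold: "mpd \<alpha> f = fold pd (replicate (snd \<alpha>) 2 @ replicate (fst \<alpha>) 1) f"
  by (simp add: mpd_def fold_replicate_funpow)

lemma fold_pd_cong_open:
  assumes "open S" "\<And>x. x \<in> S \<Longrightarrow> f x = g x" "x \<in> S"
  shows "fold pd is f x = fold pd is g x"
  using assms(2,3)
proof (induction "is" arbitrary: f g)
  case (Cons i "is")
  show ?case using Cons.IH[of "pd i f" "pd i g"] Cons.prems pd_cong_open[OF assms(1), of _ f g i] by simp
qed simp

text \<open>A derivative produces a factor 1 / l when it falls on the concentrated function and none when it falls
  on the other one; as l is at most 1, the worst case is that all fall on the former.\<close>

lemma concentrated_derivative_bound:
  fixes \<Phi> g :: "real^2 \<Rightarrow> real"
  assumes "\<Phi> \<in> test_functions UNIV" "smooth_on UNIV g"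
  shows "\<exists>C\<ge>0. \<forall>l. 0 < l \<longrightarrow> l \<le> 1 \<longrightarrow>
    (\<forall>x. \<bar>fold pd is (\<lambda>x. \<Phi> ((1 / l) *\<^sub>R x) * g x) x\<bar> \<le> C * (1 / l) ^ length is)"
  using assms
proof (induction "is" arbitrary: \<Phi> g)
  case Nil
  obtain B where B: "0 \<le> B" "\<And>x. \<bar>\<Phi> x\<bar> \<le> B" using test_function_bounded[OF Nil(1)] by blast
  obtain R where R: "0 < R" "\<And>x. x \<in> tsupport \<Phi> \<Longrightarrow> norm x \<le> R"
    using compact_imp_bounded[OF test_functionsD(2)[OF Nil(1)]] bounded_pos by metis
  have "compact (g ` cball 0 R)"
    by (intro compact_continuous_image compact_cball)
      (rule continuous_on_subset[OF smooth_on_continuous_on[OF Nil(2)]], simp)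
  then obtain M where M: "0 < M" "\<And>x. x \<in> cball 0 R \<Longrightarrow> \<bar>g x\<bar> \<le> M"
    using compact_imp_bounded bounded_pos by (metis imageI real_norm_def)
  have "\<bar>\<Phi> ((1 / l) *\<^sub>R x) * g x\<bar> \<le> B * M" if l: "0 < l" "l \<le> 1" for l x
  proof (cases "norm x \<le> R")
    case True
    then show ?thesis using B(2)[of "(1 / l) *\<^sub>R x"] M(2)[of x] B(1) by (simp add: abs_mult mult_mono)
  next
    case False
    have "norm x \<le> norm x / l" using l by (simp add: pos_le_divide_eq mult_left_le)
    then have "norm x \<le> norm ((1 / l) *\<^sub>R x)" using l by simp
    then have "\<not> norm ((1 / l) *\<^sub>R x) \<le> R" using False by linarith
    then have "\<Phi> ((1 / l) *\<^sub>R x) = 0" using R(2) zero_outside_tsupport by blast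
    then show ?thesis using B(1) M(1) by simp
  qed
  then show ?case using B(1) M(1) by (intro exI[of _ "B * M"]) simp
next
  case (Cons i "is")
  have smooth\<Phi>: "smooth_on UNIV \<Phi>" using Cons.prems(1) by (rule test_functionsD)
  from Cons.IH[OF test_functions_pd[OF Cons.prems(1)] Cons.prems(2)]
  obtain C1 where C1: "C1 \<ge> 0 \<and> (\<forall>l. 0 < l \<longrightarrow> l \<le> 1 \<longrightarrow>
      (\<forall>x. \<bar>fold pd is (\<lambda>x. pd i \<Phi> ((1 / l) *\<^sub>R x) * g x) x\<bar> \<le> C1 * (1 / l) ^ length is))"
    by (rule exE)
  from Cons.IH[OF Cons.prems(1) smooth_on_pd[OF Cons.prems(2)]]
  obtain C2 where C2: "C2 \<ge> 0 \<and> (\<forall>l. 0 < l \<longrightarrow> l \<le> 1 \<longrightarrow>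
      (\<forall>x. \<bar>fold pd is (\<lambda>x. \<Phi> ((1 / l) *\<^sub>R x) * pd i g x) x\<bar> \<le> C2 * (1 / l) ^ length is))"
    by (rule exE)
  have "\<bar>fold pd (i # is) (\<lambda>x. \<Phi> ((1 / l) *\<^sub>R x) * g x) x\<bar> \<le> (C1 + C2) * (1 / l) ^ length (i # is)"
    if l: "0 < l" "l \<le> 1" for l x
  proof -
    define P where "P = (\<lambda>x. pd i \<Phi> ((1 / l) *\<^sub>R x) * g x)"
    define Q where "Q = (\<lambda>x. \<Phi> ((1 / l) *\<^sub>R x) * pd i g x)"
    have sP: "smooth_on UNIV P" and sQ: "smooth_on UNIV Q"
      unfolding P_def Q_def
      by (intro smooth_on_mult open_UNIV smooth_on_rescaled smooth_on_pd smooth\<Phi> Cons.prems(2))+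
    have d: "\<And>x. \<Phi> differentiable (at x)" by (rule test_functions_differentiable[OF Cons.prems(1)])
    have "pd i (\<lambda>x. \<Phi> ((1 / l) *\<^sub>R x) * g x) x = (1 / l) * P x + Q x" for x
      using pd_mult[OF pd_rescaled(2)[OF d] smooth_on_differentiable[OF Cons.prems(2) UNIV_I], of i "1 / l" x]
        pd_rescaled(1)[OF d, of i "1 / l"] by (simp add: P_def Q_def)
    then have "pd i (\<lambda>x. \<Phi> ((1 / l) *\<^sub>R x) * g x) = (\<lambda>x. (1 / l) * P x + Q x)" by blast
    then have "fold pd (i # is) (\<lambda>x. \<Phi> ((1 / l) *\<^sub>R x) * g x) = fold pd is (\<lambda>x. (1 / l) * P x + Q x)"
      by simp
    also have "\<dots> = (\<lambda>x. (1 / l) * fold pd is P x + fold pd is Q x)"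
      by (simp only: fold_pd_add[OF smooth_on_cmult[OF open_UNIV sP] sQ] fold_pd_cmult[OF sP])
    finally have eq: "fold pd (i # is) (\<lambda>x. \<Phi> ((1 / l) *\<^sub>R x) * g x) x
        = (1 / l) * fold pd is P x + fold pd is Q x" by (rule fun_cong)
    define k where "k = (1 / l) ^ length is"
    have k: "0 \<le> k" using l by (simp add: k_def)
    have bP: "\<bar>fold pd is P x\<bar> \<le> C1 * k"
      using C1 l unfolding P_def k_def by blast
    have bQ: "\<bar>fold pd is Q x\<bar> \<le> C2 * k"
      using C2 l unfolding Q_def k_def by blast
    have "\<bar>(1 / l) * fold pd is P x\<bar> \<le> (1 / l) * (C1 * k)"
      unfolding abs_mult using bP l by (intro mult_mono) auto
    moreover have "1 * (C2 * k) \<le> (1 / l) * (C2 * k)"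
      using l C2 k by (intro mult_right_mono) auto
    ultimately have "\<bar>(1 / l) * fold pd is P x + fold pd is Q x\<bar> \<le> (1 / l) * (C1 * k) + (1 / l) * (C2 * k)"
      using bQ by linarith
    also have "\<dots> = (C1 + C2) * (1 / l) ^ length (i # is)"
      by (simp add: k_def distrib_right add_divide_distrib)
    finally show ?thesis unfolding eq .
  qed
  then have "\<forall>l. 0 < l \<longrightarrow> l \<le> 1 \<longrightarrow> (\<forall>x. \<bar>fold pd (i # is) (\<lambda>x. \<Phi> ((1 / l) *\<^sub>R x) * g x) x\<bar>
      \<le> (C1 + C2) * (1 / l) ^ length (i # is))"
    by (intro allI impI)
  moreover have "0 \<le> C1 + C2" using C1 C2 by linarith
  ultimately show ?case by (intro exI[of _ "C1 + C2"] conjI)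
qed

lemma abs_SUP_le:
  fixes f :: "real^2 \<Rightarrow> real"
  assumes "\<And>x. \<bar>f x\<bar> \<le> c"
  shows "\<bar>SUP x. \<bar>f x\<bar>\<bar> \<le> c"
proof -
  have "(SUP x. \<bar>f x\<bar>) \<le> c" by (rule cSUP_least) (use assms in auto)
  moreover have "\<bar>f 0\<bar> \<le> (SUP x. \<bar>f x\<bar>)"
    by (rule cSUP_upper) (use assms in \<open>auto intro!: bdd_aboveI\<close>)
  ultimately show ?thesis by simp
qed

definition monomial :: "nat \<Rightarrow> nat \<Rightarrow> real^2 \<Rightarrow> real" where
  "monomial p q x = x $ 1 ^ p * x $ 2 ^ q"

lemma smooth_on_monomial: "open S \<Longrightarrow> smooth_on S (monomial p q)"
  unfolding monomial_def[abs_def] by (intro smooth_on_mult smooth_on_power smooth_on_coord)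

lemma monomial_scaleR: "monomial p q (c *\<^sub>R x) = c ^ (p + q) * monomial p q x"
  by (simp add: monomial_def power_mult_distrib power_add)

lemma rescale_test:
  fixes \<phi> :: "real^2 \<Rightarrow> 'v::real_normed_vector"
  assumes "\<phi> \<in> test_functions (ball 0 r)" "0 < l" "l \<le> 1"
  shows "rescale l \<phi> \<in> test_functions (ball 0 r)"
proof (rule test_functionsI)
  show "smooth_on UNIV (rescale l \<phi>)"
    unfolding rescale_def
    by (rule smooth_on_linear[OF open_UNIV bounded_linear_scaleR_right smooth_on_rescaled[OF test_functionsD(1)[OF assms(1)]]])
  show "compact ((*\<^sub>R) l ` tsupport \<phi>)"
    by (rule compact_scaling[OF test_functionsD(2)[OF assms(1)]])
  have "norm (l *\<^sub>R x) < r" if "x \<in> tsupport \<phi>" for x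
  proof -
    have "norm (l *\<^sub>R x) \<le> norm x" using assms(2,3) by (simp add: mult_left_le_one_le)
    also have "\<dots> < r" using test_functionsD(3)[OF assms(1)] that by auto
    finally show ?thesis .
  qed
  then show "(*\<^sub>R) l ` tsupport \<phi> \<subseteq> ball 0 r" by auto
  show "rescale l \<phi> x = 0" if "x \<notin> (*\<^sub>R) l ` tsupport \<phi>" for x
  proof -
    have "x = l *\<^sub>R ((1 / l) *\<^sub>R x)" using assms(2) by simp
    then have "(1 / l) *\<^sub>R x \<notin> tsupport \<phi>" using that by (metis imageI)
    then have "\<phi> ((1 / l) *\<^sub>R x) = 0" by (rule zero_outside_tsupport)
    then show ?thesis by (simp add: rescale_def)
  qed
qed

lemma pd_rescale:
  fixes \<phi> :: "real^2 \<Rightarrow> real"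
  assumes "\<phi> \<in> test_functions V"
  shows "pd i (rescale l \<phi>) = (\<lambda>x. (1 / l) * rescale l (pd i \<phi>) x)"
proof
  fix x
  have d: "\<And>x. \<phi> differentiable (at x)" using assms by (rule test_functions_differentiable)
  have "pd i (rescale l \<phi>) x = (1 / l\<^sup>2) *\<^sub>R pd i (\<lambda>x. \<phi> ((1 / l) *\<^sub>R x)) x"
    unfolding rescale_def by (rule pd_linear[OF bounded_linear_scaleR_right pd_rescaled(2)[OF d]])
  then show "pd i (rescale l \<phi>) x = (1 / l) * rescale l (pd i \<phi>) x"
    by (simp add: rescale_def pd_rescaled(1)[OF d])
qed


section \<open>Scaling of the incompatibility\<close>

text \<open>The seminorm in the continuity estimates for distributions.\<close>

definition deriv_sups :: "nat \<Rightarrow> (real^2 \<Rightarrow> real) \<Rightarrow> real" where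
  "deriv_sups m f = (\<Sum>\<alpha> | mi_order \<alpha> \<le> m. SUP x. \<bar>mpd \<alpha> f x\<bar>)"

lemma deriv_sups_concentrated:
  assumes "\<Phi> \<in> test_functions UNIV" "smooth_on UNIV g"
  shows "\<exists>D\<ge>0. \<forall>l. 0 < l \<longrightarrow> l \<le> 1 \<longrightarrow>
    \<bar>deriv_sups m (pd i (pd j (\<lambda>x. \<Phi> ((1 / l) *\<^sub>R x) * g x)))\<bar> \<le> D * (1 / l) ^ (m + 2)"
proof -
  have "\<forall>is. \<exists>C. C \<ge> 0 \<and> (\<forall>l. 0 < l \<longrightarrow> l \<le> 1 \<longrightarrow>
      (\<forall>x. \<bar>fold pd is (\<lambda>x. \<Phi> ((1 / l) *\<^sub>R x) * g x) x\<bar> \<le> C * (1 / l) ^ length is))"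
    by (rule allI) (rule concentrated_derivative_bound[OF assms])
  from choice[OF this] obtain C where C: "\<forall>is. C is \<ge> 0 \<and> (\<forall>l. 0 < l \<longrightarrow> l \<le> 1 \<longrightarrow>
      (\<forall>x. \<bar>fold pd is (\<lambda>x. \<Phi> ((1 / l) *\<^sub>R x) * g x) x\<bar> \<le> C is * (1 / l) ^ length is))"
    by (rule exE)
  define L where "L = (\<lambda>\<alpha>. j # i # replicate (snd \<alpha>) 2 @ replicate (fst \<alpha>) (1::2))"
  define D where "D = (\<Sum>\<alpha> | mi_order \<alpha> \<le> m. C (L \<alpha>))"
  have bound: "\<bar>deriv_sups m (pd i (pd j (\<lambda>x. \<Phi> ((1 / l) *\<^sub>R x) * g x)))\<bar> \<le> D * (1 / l) ^ (m + 2)"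
    if l: "0 < l" "l \<le> 1" for l
  proof -
    define F where "F = (\<lambda>x. \<Phi> ((1 / l) *\<^sub>R x) * g x)"
    have "\<bar>SUP x. \<bar>mpd \<alpha> (pd i (pd j F)) x\<bar>\<bar> \<le> C (L \<alpha>) * (1 / l) ^ (m + 2)" if \<alpha>: "mi_order \<alpha> \<le> m" for \<alpha>
    proof (rule abs_SUP_le)
      fix x
      have "mpd \<alpha> (pd i (pd j F)) x = fold pd (L \<alpha>) F x"
        by (simp add: mpd_eq_fold L_def)
      moreover have "\<bar>fold pd (L \<alpha>) F x\<bar> \<le> C (L \<alpha>) * (1 / l) ^ length (L \<alpha>)"
        using C l unfolding F_def by blast
      moreover have "(1 / l) ^ length (L \<alpha>) \<le> (1 / l) ^ (m + 2)"
        using l \<alpha> by (intro power_increasing) (auto simp: L_def mi_order_def)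
      then have "C (L \<alpha>) * (1 / l) ^ length (L \<alpha>) \<le> C (L \<alpha>) * (1 / l) ^ (m + 2)"
        using C by (intro mult_left_mono) auto
      ultimately show "\<bar>mpd \<alpha> (pd i (pd j F)) x\<bar> \<le> C (L \<alpha>) * (1 / l) ^ (m + 2)"
        by linarith
    qed
    then have "\<bar>deriv_sups m (pd i (pd j F))\<bar> \<le> (\<Sum>\<alpha> | mi_order \<alpha> \<le> m. C (L \<alpha>) * (1 / l) ^ (m + 2))"
      unfolding deriv_sups_def by (intro order_trans[OF sum_abs] sum_mono) simp
    then show ?thesis by (simp only: D_def sum_distrib_right F_def)
  qed
  have "D \<ge> 0" unfolding D_def by (intro sum_nonneg) (use C in blast)
  with bound show ?thesis by (intro exI[of _ D] conjI allI impI)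
qed

context strain_field
begin

lemma incompatibility_bound:
  assumes "compact K" "K \<subseteq> \<Omega>"
  shows "\<exists>C m. \<forall>\<phi>. \<phi> \<in> test_functions \<Omega> \<longrightarrow> tsupport \<phi> \<subseteq> K \<longrightarrow>
    \<bar>incompatibility \<phi>\<bar> \<le> C * (deriv_sups m (pd 1 (pd 1 \<phi>)) + deriv_sups m (pd 2 (pd 1 \<phi>))
       + deriv_sups m (pd 1 (pd 2 \<phi>)) + deriv_sups m (pd 2 (pd 2 \<phi>)))"
proof -
  obtain C m where Cm: "\<forall>\<phi>\<in>test_functions \<Omega>. tsupport \<phi> \<subseteq> K \<longrightarrow>
      norm (E \<phi>) \<le> C * (\<Sum>\<alpha> | mi_order \<alpha> \<le> m. SUP x. \<bar>mpd \<alpha> \<phi> x\<bar>)"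
    using dist_E assms unfolding distribution_on_def by blast
  have entry: "\<bar>E (pd k (pd l \<phi>)) $ i $ j\<bar> \<le> C * deriv_sups m (pd k (pd l \<phi>))"
    if "\<phi> \<in> test_functions \<Omega>" "tsupport \<phi> \<subseteq> K" for \<phi> i j k l
  proof -
    have "tsupport (pd k (pd l \<phi>)) \<subseteq> K"
      using tsupport_pd[of k "pd l \<phi>"] tsupport_pd[of l \<phi>] that(2) by blast
    then have "norm (E (pd k (pd l \<phi>))) \<le> C * deriv_sups m (pd k (pd l \<phi>))"
      using Cm test_functions_pd[OF test_functions_pd[OF that(1)]] unfolding deriv_sups_def by blast
    moreover have "\<bar>E (pd k (pd l \<phi>)) $ i $ j\<bar> \<le> norm (E (pd k (pd l \<phi>)))"
      using component_le_norm_cart[of "E (pd k (pd l \<phi>)) $ i" j] Finite_Cartesian_Product.norm_nth_le[of "E (pd k (pd l \<phi>))" i]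
      by linarith
    ultimately show ?thesis by linarith
  qed
  have "\<bar>incompatibility \<phi>\<bar> \<le> C * (deriv_sups m (pd 1 (pd 1 \<phi>)) + deriv_sups m (pd 2 (pd 1 \<phi>))
       + deriv_sups m (pd 1 (pd 2 \<phi>)) + deriv_sups m (pd 2 (pd 2 \<phi>)))"
    if \<phi>: "\<phi> \<in> test_functions \<Omega>" "tsupport \<phi> \<subseteq> K" for \<phi>
    using entry[OF \<phi>, of 1 1 2 2] entry[OF \<phi>, of 2 1 2 1] entry[OF \<phi>, of 1 2 1 2] entry[OF \<phi>, of 2 2 1 1]
    unfolding incompatibility_eq distrib_left by linarith
  then show ?thesis by (intro exI[of _ C] exI[of _ m] allI impI)
qed

text \<open>Replacing the cutoff by its contraction by l does not change the value. On the contracted cutoff a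
  monomial of degree d contributes a factor l ^ d, while a distribution of finite order m on a compact
  set, applied after two derivatives, costs at most (1 / l) ^ (m + 2). So degree m + 3 suffices.\<close>

lemma incompatibility_high_order_zero:
  assumes supp: "\<forall>\<phi>\<in>test_functions U. incompatibility \<phi> = 0"
    and s: "0 < s" "cball 0 s \<subseteq> \<Omega>"
    and \<eta>: "\<eta> \<in> test_functions (ball 0 s)" "0 < \<delta>" "\<And>x. x \<in> ball 0 \<delta> \<Longrightarrow> \<eta> x = 1"
  shows "\<exists>M. \<forall>p q g. M \<le> p + q \<longrightarrow> smooth_on UNIV g \<longrightarrow> incompatibility (\<lambda>x. \<eta> x * (monomial p q x * g x)) = 0"
proof -
  obtain C m where Cm: "\<forall>\<phi>. \<phi> \<in> test_functions \<Omega> \<longrightarrow> tsupport \<phi> \<subseteq> cball 0 s \<longrightarrow>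
    \<bar>incompatibility \<phi>\<bar> \<le> C * (deriv_sups m (pd 1 (pd 1 \<phi>)) + deriv_sups m (pd 2 (pd 1 \<phi>))
       + deriv_sups m (pd 1 (pd 2 \<phi>)) + deriv_sups m (pd 2 (pd 2 \<phi>)))"
    using incompatibility_bound[OF compact_cball s(2)] by blast
  have "incompatibility (\<lambda>x. \<eta> x * (monomial p q x * g x)) = 0" if pq: "m + 3 \<le> p + q" and g: "smooth_on UNIV g" for p q g
  proof -
    define \<Phi> where "\<Phi> = (\<lambda>x. \<eta> x * monomial p q x)"
    have \<Phi>: "\<Phi> \<in> test_functions (ball 0 s)"
      unfolding \<Phi>_def by (intro test_functions_mult \<eta> smooth_on_monomial open_UNIV)
    have \<Phi>': "\<Phi> \<in> test_functions UNIV" using test_functions_mono[OF \<Phi>] by simp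
    define F where "F = (\<lambda>l x. \<Phi> ((1 / l) *\<^sub>R x) * g x)"
    have "\<forall>i. \<exists>D. \<forall>j. D j \<ge> 0 \<and> (\<forall>l. 0 < l \<longrightarrow> l \<le> 1 \<longrightarrow>
        \<bar>deriv_sups m (pd i (pd j (F l)))\<bar> \<le> D j * (1 / l) ^ (m + 2))"
      unfolding F_def by (intro allI choice) (rule deriv_sups_concentrated[OF \<Phi>' g])
    from choice[OF this] obtain D where D: "\<forall>i j. D i j \<ge> 0 \<and> (\<forall>l. 0 < l \<longrightarrow> l \<le> 1 \<longrightarrow>
        \<bar>deriv_sups m (pd i (pd j (F l)))\<bar> \<le> D i j * (1 / l) ^ (m + 2))"
      by (rule exE)
    define B where "B = \<bar>C\<bar> * (D 1 1 + D 2 1 + D 1 2 + D 2 2)"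
    have bound: "\<bar>incompatibility (\<lambda>x. \<eta> x * (monomial p q x * g x))\<bar> \<le> B * l" if l: "0 < l" "l \<le> 1" for l
    proof -
      have F0: "F l x = 0" if "x \<notin> cball 0 s" for x
      proof -
        have "norm x \<le> norm x / l" using l by (simp add: pos_le_divide_eq mult_left_le)
        then have "norm x \<le> norm ((1 / l) *\<^sub>R x)" using l by simp
        then have "(1 / l) *\<^sub>R x \<notin> ball 0 s" using that by auto
        then have "(1 / l) *\<^sub>R x \<notin> tsupport \<Phi>" using test_functionsD(3)[OF \<Phi>] by blast
        from zero_outside_tsupport[OF this] show ?thesis by (simp add: F_def)
      qed
      have F_test: "F l \<in> test_functions \<Omega>"
      proof (rule test_functionsI[OF _ compact_cball s(2) F0])
        show "smooth_on UNIV (F l)"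
          unfolding F_def by (intro smooth_on_mult open_UNIV smooth_on_rescaled g test_functionsD(1)[OF \<Phi>])
      qed
      have F_supp: "tsupport (F l) \<subseteq> cball 0 s" by (rule tsupport_subsetI[OF closed_cball F0])
      have F_eq: "l ^ (p + q) * F l x = \<eta> ((1 / l) *\<^sub>R x) * (monomial p q x * g x)" for x
        unfolding F_def \<Phi>_def monomial_scaleR using l by (simp add: power_one_over)
      have sub: "ball 0 s \<subseteq> \<Omega>" using s(2) ball_subset_cball by blast
      have "incompatibility (\<lambda>x. \<eta> x * (monomial p q x * g x)) = incompatibility (\<lambda>x. l ^ (p + q) * F l x)"
      proof (rule incompatibility_localize[OF supp])
        show "(\<lambda>x. \<eta> x * (monomial p q x * g x)) \<in> test_functions \<Omega>"
          by (intro test_functions_mult test_functions_mono[OF \<eta>(1) sub] smooth_on_mult smooth_on_monomial open_UNIV g)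
        show "(\<lambda>x. l ^ (p + q) * F l x) \<in> test_functions \<Omega>"
          by (rule test_functions_cmult[OF F_test])
        show "0 < l * \<delta>" using l \<eta>(2) by simp
        fix x :: "real^2" assume x: "x \<in> ball 0 (l * \<delta>)"
        have "l * \<delta> \<le> \<delta>" using l \<eta>(2) by simp
        then have "x \<in> ball 0 \<delta>" using x by auto
        moreover have "(1 / l) *\<^sub>R x \<in> ball 0 \<delta>" using x l by (simp add: field_simps)
        ultimately show "\<eta> x * (monomial p q x * g x) = l ^ (p + q) * F l x"
          unfolding F_eq by (simp add: \<eta>(3))
      qed
      then have incompatibility_eq: "\<bar>incompatibility (\<lambda>x. \<eta> x * (monomial p q x * g x))\<bar> = l ^ (p + q) * \<bar>incompatibility (F l)\<bar>"
        using l by (simp add: incompatibility_cmult[OF F_test] abs_mult)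
      let ?S = "deriv_sups m (pd 1 (pd 1 (F l))) + deriv_sups m (pd 2 (pd 1 (F l)))
       + deriv_sups m (pd 1 (pd 2 (F l))) + deriv_sups m (pd 2 (pd 2 (F l)))"
      have S: "\<bar>?S\<bar> \<le> (D 1 1 + D 2 1 + D 1 2 + D 2 2) * (1 / l) ^ (m + 2)"
      proof -
        have "\<bar>deriv_sups m (pd i (pd j (F l)))\<bar> \<le> D i j * (1 / l) ^ (m + 2)" for i j
          using D l by blast
        from this[of 1 1] this[of 2 1] this[of 1 2] this[of 2 2] show ?thesis
          unfolding distrib_right by linarith
      qed
      have "\<bar>incompatibility (F l)\<bar> \<le> C * ?S" using Cm F_test F_supp by blast
      also have "\<dots> \<le> \<bar>C\<bar> * \<bar>?S\<bar>" by (metis abs_ge_self abs_mult)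
      also have "\<dots> \<le> \<bar>C\<bar> * ((D 1 1 + D 2 1 + D 1 2 + D 2 2) * (1 / l) ^ (m + 2))"
        by (rule mult_left_mono[OF S]) simp
      finally have TF: "\<bar>incompatibility (F l)\<bar> \<le> B * (1 / l) ^ (m + 2)" by (simp add: B_def mult.assoc)
      have B0: "0 \<le> B" unfolding B_def using D by (intro mult_nonneg_nonneg add_nonneg_nonneg) auto
      have "l ^ (p + q) * \<bar>incompatibility (F l)\<bar> \<le> l ^ (m + 3) * (B * (1 / l) ^ (m + 2))"
        using l pq TF by (intro mult_mono power_decreasing) auto
      also have "\<dots> = B * l"
        using l by (simp add: power_one_over eval_nat_numeral)
      finally show ?thesis unfolding incompatibility_eq .
    qed
    have "\<bar>incompatibility (\<lambda>x. \<eta> x * (monomial p q x * g x))\<bar> \<le> B * inverse (real (Suc n))" for n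
      by (rule bound) (simp_all add: field_simps)
    moreover have "(\<lambda>n. B * inverse (real (Suc n))) \<longlonglongrightarrow> 0"
      using tendsto_mult_left[OF LIMSEQ_inverse_real_of_nat, of B] by simp
    ultimately have "\<bar>incompatibility (\<lambda>x. \<eta> x * (monomial p q x * g x))\<bar> \<le> 0"
      by (intro LIMSEQ_le_const) auto
    then show ?thesis by simp
  qed
  then show ?thesis by (intro exI[of _ "m + 3"]) blast
qed

lemma E_zero: "E (\<lambda>x. 0) = 0"
proof -
  have "(\<lambda>x::real^2. 0::real) \<in> test_functions \<Omega>"
    by (rule test_functionsI[of _ "{}"]) (simp_all add: smooth_on_const)
  from E_cmult[OF this, of 0] show ?thesis by simp
qed

lemma E_entry_rescale_tendsto:
  assumes k: "\<forall>\<Phi>\<in>test_functions (ball 0 r). ((\<lambda>l. l powr k * pairing E (rescale l \<Phi>)) \<longlongrightarrow> 0) (at_right 0)"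
    and \<phi>: "\<phi> \<in> test_functions (ball 0 r)"
  shows "((\<lambda>l. l powr k * E (rescale l \<phi>) $ i $ j) \<longlongrightarrow> 0) (at_right 0)"
proof -
  define B :: "real^2^2" where "B = axis i (axis j 1)"
  have B: "B \<in> Basis" unfolding B_def by (intro axis_in_Basis_iff[THEN iffD2]) (simp add: axis_in_Basis_iff)
  define \<Phi> where "\<Phi> = (\<lambda>x. \<phi> x *\<^sub>R B)"
  have "\<Phi> \<in> test_functions (ball 0 r)"
  proof (rule test_functionsI)
    show "smooth_on UNIV \<Phi>" unfolding \<Phi>_def
      by (rule smooth_on_linear[OF open_UNIV bounded_linear_scaleR_left test_functionsD(1)[OF \<phi>]])
    show "\<Phi> x = 0" if "x \<notin> tsupport \<phi>" for x
      using zero_outside_tsupport[OF that] by (simp add: \<Phi>_def)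
  qed (simp_all add: test_functionsD[OF \<phi>])
  moreover have "pairing E (rescale l \<Phi>) = E (rescale l \<phi>) $ i $ j" for l
  proof -
    have "E (\<lambda>x. rescale l \<Phi> x \<bullet> b) \<bullet> b = (if b = B then E (rescale l \<phi>) $ i $ j else 0)" if "b \<in> Basis" for b
    proof (cases "b = B")
      case True
      have "(\<lambda>x. rescale l \<Phi> x \<bullet> B) = rescale l \<phi>"
        by (simp add: rescale_def \<Phi>_def fun_eq_iff inner_Basis[OF B B])
      then show ?thesis using True by (simp add: B_def inner_axis)
    next
      case False
      have "(\<lambda>x. rescale l \<Phi> x \<bullet> b) = (\<lambda>x. 0)"
        using False by (simp add: rescale_def \<Phi>_def fun_eq_iff inner_Basis[OF B that])
      then show ?thesis using False by (simp add: E_zero)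
    qed
    then have "pairing E (rescale l \<Phi>) = (\<Sum>b\<in>Basis. if b = B then E (rescale l \<phi>) $ i $ j else 0)"
      unfolding pairing_def by (rule sum.cong[OF refl])
    then show ?thesis using B by simp
  qed
  ultimately show ?thesis using k by force
qed

lemma incompatibility_rescale:
  assumes \<phi>: "\<phi> \<in> test_functions (ball 0 r)" and sub: "ball 0 r \<subseteq> \<Omega>" and l: "0 < l" "l \<le> 1"
  shows "l powr (k + 2) * incompatibility (rescale l \<phi>) =
    l powr k * E (rescale l (pd 1 (pd 1 \<phi>))) $ 2 $ 2 - l powr k * E (rescale l (pd 2 (pd 1 \<phi>))) $ 2 $ 1
    - l powr k * E (rescale l (pd 1 (pd 2 \<phi>))) $ 1 $ 2 + l powr k * E (rescale l (pd 2 (pd 2 \<phi>))) $ 1 $ 1"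
proof -
  have test: "rescale l \<psi> \<in> test_functions \<Omega>" if "\<psi> \<in> test_functions (ball 0 r)" for \<psi> :: "real^2 \<Rightarrow> real"
    by (rule test_functions_mono[OF rescale_test[OF that l] sub])
  have "E (pd i (pd j (rescale l \<phi>))) = (1 / l) *\<^sub>R (1 / l) *\<^sub>R E (rescale l (pd i (pd j \<phi>)))" for i j
  proof -
    have "pd i (pd j (rescale l \<phi>)) = (\<lambda>x. (1 / l) * ((1 / l) * rescale l (pd i (pd j \<phi>)) x))"
      by (simp only: pd_rescale[OF \<phi>] pd_cmult_test[OF test[OF test_functions_pd[OF \<phi>]]]
          pd_rescale[OF test_functions_pd[OF \<phi>]])
    then show ?thesis
      using test[OF test_functions_pd[OF test_functions_pd[OF \<phi>]]]
      by (simp only: E_cmult test_functions_cmult)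
  qed
  moreover have "l powr (k + 2) = l powr k * l\<^sup>2"
    using l by (simp add: powr_add powr_numeral)
  ultimately show ?thesis
    unfolding incompatibility_eq using l by (simp add: field_simps power2_eq_square)
qed

text \<open>Differentiating a rescaled test function gives 1 / l times the rescaled derivative, so the two
  derivatives in the incompatibility are paid for by two more powers of l.\<close>

lemma incompatibility_rescale_tendsto:
  assumes k: "\<forall>\<Phi>\<in>test_functions (ball 0 r). ((\<lambda>l. l powr k * pairing E (rescale l \<Phi>)) \<longlongrightarrow> 0) (at_right 0)"
    and \<phi>: "\<phi> \<in> test_functions (ball 0 r)" and sub: "ball 0 r \<subseteq> \<Omega>"
  shows "((\<lambda>l. l powr (k + 2) * incompatibility (rescale l \<phi>)) \<longlongrightarrow> 0) (at_right 0)"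
proof -
  have t: "((\<lambda>l. l powr k * E (rescale l (pd i (pd j \<phi>))) $ i' $ j') \<longlongrightarrow> 0) (at_right 0)" for i j i' j'
    by (intro E_entry_rescale_tendsto[OF k] test_functions_pd \<phi>)
  have "((\<lambda>l. l powr k * E (rescale l (pd 1 (pd 1 \<phi>))) $ 2 $ 2 - l powr k * E (rescale l (pd 2 (pd 1 \<phi>))) $ 2 $ 1
    - l powr k * E (rescale l (pd 1 (pd 2 \<phi>))) $ 1 $ 2 + l powr k * E (rescale l (pd 2 (pd 2 \<phi>))) $ 1 $ 1)
      \<longlongrightarrow> 0 - 0 - 0 + 0) (at_right 0)"
    by (intro tendsto_add tendsto_diff t)
  then have "((\<lambda>l. l powr k * E (rescale l (pd 1 (pd 1 \<phi>))) $ 2 $ 2 - l powr k * E (rescale l (pd 2 (pd 1 \<phi>))) $ 2 $ 1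
    - l powr k * E (rescale l (pd 1 (pd 2 \<phi>))) $ 1 $ 2 + l powr k * E (rescale l (pd 2 (pd 2 \<phi>))) $ 1 $ 1)
      \<longlongrightarrow> 0) (at_right 0)" by simp
  then show ?thesis
  proof (rule Lim_transform_eventually)
    show "\<forall>\<^sub>F l in at_right 0. l powr k * E (rescale l (pd 1 (pd 1 \<phi>))) $ 2 $ 2 - l powr k * E (rescale l (pd 2 (pd 1 \<phi>))) $ 2 $ 1
    - l powr k * E (rescale l (pd 1 (pd 2 \<phi>))) $ 1 $ 2 + l powr k * E (rescale l (pd 2 (pd 2 \<phi>))) $ 1 $ 1
      = l powr (k + 2) * incompatibility (rescale l \<phi>)"
      by (rule eventually_at_rightI[of 0 1]) (simp_all add: incompatibility_rescale[OF \<phi> sub])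
  qed
qed

text \<open>A monomial is homogeneous, so the contracted cutoff times the monomial is, up to a power of l, a
  rescaling of one fixed test function. The factor is l ^ (p + q + 2), the two extra powers coming from
  the normalization of the rescaling; it beats l powr (k + 2) since p + q is at least 2 and k is below 2.\<close>

lemma incompatibility_monomial_zero:
  assumes supp: "\<forall>\<phi>\<in>test_functions U. incompatibility \<phi> = 0"
    and k: "\<forall>\<Phi>\<in>test_functions (ball 0 r). ((\<lambda>l. l powr k * pairing E (rescale l \<Phi>)) \<longlongrightarrow> 0) (at_right 0)"
    and k2: "k < 2" and sub: "ball 0 r \<subseteq> \<Omega>"
    and \<eta>: "\<eta> \<in> test_functions (ball 0 r)" "0 < \<delta>" "\<And>x. x \<in> ball 0 \<delta> \<Longrightarrow> \<eta> x = 1"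
    and pq: "2 \<le> p + q"
  shows "incompatibility (\<lambda>x. \<eta> x * monomial p q x) = 0"
proof -
  define \<phi> where "\<phi> = (\<lambda>x. \<eta> x * monomial p q x)"
  have \<phi>: "\<phi> \<in> test_functions (ball 0 r)"
    unfolding \<phi>_def by (intro test_functions_mult \<eta> smooth_on_monomial open_UNIV)
  have bound: "\<bar>incompatibility \<phi>\<bar> \<le> \<bar>l powr (k + 2) * incompatibility (rescale l \<phi>)\<bar>" if l: "0 < l" "l \<le> 1" for l
  proof -
    have R: "rescale l \<phi> \<in> test_functions \<Omega>" by (rule test_functions_mono[OF rescale_test[OF \<phi> l] sub])
    have "incompatibility \<phi> = incompatibility (\<lambda>x. l ^ (p + q + 2) * rescale l \<phi> x)"
    proof (rule incompatibility_localize[OF supp])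
      show "\<phi> \<in> test_functions \<Omega>" by (rule test_functions_mono[OF \<phi> sub])
      show "(\<lambda>x. l ^ (p + q + 2) * rescale l \<phi> x) \<in> test_functions \<Omega>"
        by (rule test_functions_cmult[OF R])
      show "0 < l * \<delta>" using l \<eta>(2) by simp
      fix x :: "real^2" assume x: "x \<in> ball 0 (l * \<delta>)"
      have "l * \<delta> \<le> \<delta>" using l \<eta>(2) by simp
      then have "x \<in> ball 0 \<delta>" using x by auto
      moreover have "(1 / l) *\<^sub>R x \<in> ball 0 \<delta>" using x l by (simp add: field_simps)
      moreover have "l ^ (p + q + 2) * rescale l \<phi> x = \<eta> ((1 / l) *\<^sub>R x) * monomial p q x"
        unfolding \<phi>_def rescale_def monomial_scaleR using l
        by (simp add: power_one_over power_add[of l "p + q" 2] power2_eq_square)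
      ultimately show "\<phi> x = l ^ (p + q + 2) * rescale l \<phi> x"
        by (simp add: \<phi>_def \<eta>(3))
    qed
    then have "\<bar>incompatibility \<phi>\<bar> = l ^ (p + q + 2) * \<bar>incompatibility (rescale l \<phi>)\<bar>"
      using l by (simp add: incompatibility_cmult[OF R] abs_mult)
    also have "l ^ (p + q + 2) = l powr real (p + q + 2)"
      by (rule powr_realpow[symmetric]) (rule l)
    also have "\<dots> \<le> l powr (k + 2)"
      using l k2 pq by (intro powr_mono') auto
    finally show ?thesis using l by (simp add: abs_mult mult_right_mono)
  qed
  have "((\<lambda>l. \<bar>l powr (k + 2) * incompatibility (rescale l \<phi>)\<bar>) \<longlongrightarrow> 0) (at_right 0)"
    by (rule tendsto_rabs_zero[OF incompatibility_rescale_tendsto[OF k \<phi> sub]])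
  moreover have "\<forall>\<^sub>F l in at_right 0. \<bar>incompatibility \<phi>\<bar> \<le> \<bar>l powr (k + 2) * incompatibility (rescale l \<phi>)\<bar>"
    by (rule eventually_at_rightI[of 0 1]) (use bound in auto)
  ultimately have "\<bar>incompatibility \<phi>\<bar> \<le> 0"
    by (rule tendsto_lowerbound) simp
  then show ?thesis by (simp add: \<phi>_def)
qed

text \<open>The scaling degree handles single monomials, and the finite order handles arbitrary smooth factors in
  high degree. Hadamard's lemma connects them: it writes the smooth factor as a constant plus terms of
  higher degree.\<close>

lemma incompatibility_second_order_zero:
  assumes supp: "\<forall>\<phi>\<in>test_functions U. incompatibility \<phi> = 0"
    and k: "\<forall>\<Phi>\<in>test_functions (ball 0 r). ((\<lambda>l. l powr k * pairing E (rescale l \<Phi>)) \<longlongrightarrow> 0) (at_right 0)"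
    and k2: "k < 2" and sub: "ball 0 r \<subseteq> \<Omega>"
    and s: "0 < s" "cball 0 s \<subseteq> \<Omega>" "s \<le> r"
    and \<eta>: "\<eta> \<in> test_functions (ball 0 s)" "0 < \<delta>" "\<And>x. x \<in> ball 0 \<delta> \<Longrightarrow> \<eta> x = 1"
    and pq: "2 \<le> p + q" and g: "smooth_on UNIV g"
  shows "incompatibility (\<lambda>x. \<eta> x * (monomial p q x * g x)) = 0"
proof -
  obtain M where M: "\<forall>p q g. M \<le> p + q \<longrightarrow> smooth_on UNIV g \<longrightarrow> incompatibility (\<lambda>x. \<eta> x * (monomial p q x * g x)) = 0"
    using incompatibility_high_order_zero[OF supp s(1,2) \<eta>] by blast
  have \<eta>r: "\<eta> \<in> test_functions (ball 0 r)"
    by (rule test_functions_mono[OF \<eta>(1)]) (use s(3) in auto)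
  have \<eta>\<Omega>: "\<eta> \<in> test_functions \<Omega>" by (rule test_functions_mono[OF \<eta>r sub])
  have t: "(\<lambda>x. \<eta> x * (monomial p q x * g x)) \<in> test_functions \<Omega>" if "smooth_on UNIV g" for p q g
    by (intro test_functions_mult \<eta>\<Omega> smooth_on_mult smooth_on_monomial open_UNIV that)
  have t0: "(\<lambda>x. \<eta> x * monomial p q x) \<in> test_functions \<Omega>" for p q
    by (intro test_functions_mult \<eta>\<Omega> smooth_on_monomial open_UNIV)
  show ?thesis
    using pq g
  \<comment> \<open>Downward induction on the degree, starting where the finite order of the distribution suffices.\<close>
  proof (induction "M - (p + q)" arbitrary: p q g)
    case 0
    then show ?case using M by simp
  next
    case (Suc n)
    obtain g1 g2 where g12: "smooth_on UNIV g1" "smooth_on UNIV g2"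
      and g_eq: "\<And>x. g x = g 0 + x $ 1 * g1 x + x $ 2 * g2 x"
      using hadamard[OF Suc.prems(2)] by metis
    have "(\<lambda>x. \<eta> x * (monomial p q x * g x)) = (\<lambda>x. g 0 * (\<eta> x * monomial p q x)
        + (\<eta> x * (monomial (Suc p) q x * g1 x) + \<eta> x * (monomial p (Suc q) x * g2 x)))"
    proof
      fix x
      show "\<eta> x * (monomial p q x * g x) = g 0 * (\<eta> x * monomial p q x)
        + (\<eta> x * (monomial (Suc p) q x * g1 x) + \<eta> x * (monomial p (Suc q) x * g2 x))"
        by (subst g_eq) (simp add: monomial_def algebra_simps)
    qed
    then have "incompatibility (\<lambda>x. \<eta> x * (monomial p q x * g x)) = g 0 * incompatibility (\<lambda>x. \<eta> x * monomial p q x)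
        + (incompatibility (\<lambda>x. \<eta> x * (monomial (Suc p) q x * g1 x)) + incompatibility (\<lambda>x. \<eta> x * (monomial p (Suc q) x * g2 x)))"
      using t[OF g12(1)] t[OF g12(2)] t0
      by (simp only: incompatibility_add incompatibility_cmult test_functions_add test_functions_cmult)
    moreover have "incompatibility (\<lambda>x. \<eta> x * (monomial (Suc p) q x * g1 x)) = 0"
      by (rule Suc.hyps(1)) (use Suc.hyps(2) Suc.prems g12 in auto)
    moreover have "incompatibility (\<lambda>x. \<eta> x * (monomial p (Suc q) x * g2 x)) = 0"
      by (rule Suc.hyps(1)) (use Suc.hyps(2) Suc.prems g12 in auto)
    moreover have "incompatibility (\<lambda>x. \<eta> x * monomial p q x) = 0"
      by (rule incompatibility_monomial_zero[OF supp k k2 sub \<eta>r \<eta>(2,3) Suc.prems(1)])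
    ultimately show ?case by simp
  qed
qed

text \<open>Applied to the function and to its two quotients, Hadamard's lemma writes the second order Taylor
  remainder as a combination of monomials of degree two with smooth factors.\<close>

lemma incompatibility_depends_on_first_order_jet:
  assumes supp: "\<forall>\<phi>\<in>test_functions U. incompatibility \<phi> = 0"
    and k: "\<forall>\<Phi>\<in>test_functions (ball 0 r). ((\<lambda>l. l powr k * pairing E (rescale l \<Phi>)) \<longlongrightarrow> 0) (at_right 0)"
    and k2: "k < 2" and sub: "ball 0 r \<subseteq> \<Omega>"
    and s: "0 < s" "cball 0 s \<subseteq> \<Omega>" "s \<le> r"
    and \<eta>: "\<eta> \<in> test_functions (ball 0 s)" "0 < \<delta>" "\<And>x. x \<in> ball 0 \<delta> \<Longrightarrow> \<eta> x = 1"
    and \<phi>: "\<phi> \<in> test_functions \<Omega>"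
  shows "incompatibility \<phi> = incompatibility (\<lambda>x. \<eta> x * affine_fun (\<phi> 0) (pd 1 \<phi> 0) (pd 2 \<phi> 0) x)"
proof -
  let ?a = "affine_fun (\<phi> 0) (pd 1 \<phi> 0) (pd 2 \<phi> 0)"
  note \<phi>_smooth = test_functionsD(1)[OF \<phi>]
  have \<eta>\<Omega>: "\<eta> \<in> test_functions \<Omega>"
    by (rule test_functions_mono[OF \<eta>(1)]) (use s(2) ball_subset_cball in blast)
  have z: "incompatibility (\<lambda>x. \<eta> x * (monomial p q x * g x)) = 0" if "2 \<le> p + q" "smooth_on UNIV g" for p q g
    by (rule incompatibility_second_order_zero[OF supp k k2 sub s \<eta> that])
  obtain g1 g2 where g: "smooth_on UNIV g1" "smooth_on UNIV g2"
    and g0: "g1 0 = pd 1 \<phi> 0" "g2 0 = pd 2 \<phi> 0"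
    and \<phi>_eq: "\<And>x. \<phi> x = \<phi> 0 + x $ 1 * g1 x + x $ 2 * g2 x"
    using hadamard[OF \<phi>_smooth] by metis
  obtain h1 h2 where h: "smooth_on UNIV h1" "smooth_on UNIV h2"
    and g1_eq: "\<And>x. g1 x = g1 0 + x $ 1 * h1 x + x $ 2 * h2 x"
    using hadamard[OF g(1)] by metis
  obtain i1 i2 where i: "smooth_on UNIV i1" "smooth_on UNIV i2"
    and g2_eq: "\<And>x. g2 x = g2 0 + x $ 1 * i1 x + x $ 2 * i2 x"
    using hadamard[OF g(2)] by metis
  have expand: "\<eta> x * \<phi> x = \<eta> x * ?a x + (\<eta> x * (monomial 2 0 x * h1 x)
      + (\<eta> x * (monomial 1 1 x * (h2 x + i1 x)) + \<eta> x * (monomial 0 2 x * i2 x)))" for x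
  proof -
    have "\<phi> x = \<phi> 0 + x $ 1 * (pd 1 \<phi> 0 + x $ 1 * h1 x + x $ 2 * h2 x)
        + x $ 2 * (pd 2 \<phi> 0 + x $ 1 * i1 x + x $ 2 * i2 x)"
      using \<phi>_eq[of x] g1_eq[of x] g2_eq[of x] g0 by simp
    then have "\<phi> x = ?a x + (monomial 2 0 x * h1 x + (monomial 1 1 x * (h2 x + i1 x) + monomial 0 2 x * i2 x))"
      by (simp add: affine_fun_def monomial_def power2_eq_square algebra_simps)
    then show ?thesis by (simp only: distrib_left)
  qed
  have t: "(\<lambda>x. \<eta> x * f x) \<in> test_functions \<Omega>" if "smooth_on UNIV f" for f
    by (rule test_functions_mult[OF \<eta>\<Omega> that])
  have hi: "smooth_on UNIV (\<lambda>x. h2 x + i1 x)" by (intro smooth_on_add open_UNIV h i)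
  have tm: "(\<lambda>x. \<eta> x * (monomial p q x * g x)) \<in> test_functions \<Omega>" if "smooth_on UNIV g" for p q g
    by (intro t smooth_on_mult open_UNIV smooth_on_monomial that)
  have "incompatibility \<phi> = incompatibility (\<lambda>x. \<eta> x * \<phi> x)"
    by (rule incompatibility_localize[OF supp \<phi> t[OF \<phi>_smooth] \<eta>(2)]) (simp add: \<eta>(3))
  also have "\<dots> = incompatibility (\<lambda>x. \<eta> x * ?a x) + (incompatibility (\<lambda>x. \<eta> x * (monomial 2 0 x * h1 x))
      + (incompatibility (\<lambda>x. \<eta> x * (monomial 1 1 x * (h2 x + i1 x))) + incompatibility (\<lambda>x. \<eta> x * (monomial 0 2 x * i2 x))))"
    unfolding expand
    using t[OF smooth_on_affine_fun[OF open_UNIV]] tm[OF h(1)] tm[OF hi] tm[OF i(2)]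
    by (simp only: incompatibility_add test_functions_add)
  also have "\<dots> = incompatibility (\<lambda>x. \<eta> x * ?a x)"
    using z[OF _ h(1), of 2 0] z[OF _ hi, of 1 1] z[OF _ i(2), of 0 2] by simp
  finally show ?thesis .
qed

lemma incompatibility_cutoff_affine_linear:
  assumes "\<eta> \<in> test_functions \<Omega>"
  shows "incompatibility (\<lambda>x. \<eta> x * affine_fun \<alpha> \<beta> \<gamma> x) = \<alpha> * incompatibility (\<lambda>x. \<eta> x * affine_fun 1 0 0 x)
     + \<beta> * incompatibility (\<lambda>x. \<eta> x * affine_fun 0 1 0 x) + \<gamma> * incompatibility (\<lambda>x. \<eta> x * affine_fun 0 0 1 x)"
proof -
  have t: "(\<lambda>x. \<eta> x * affine_fun a b c x) \<in> test_functions \<Omega>" for a b c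
    by (intro test_functions_mult assms smooth_on_affine_fun open_UNIV)
  have "(\<lambda>x. \<eta> x * affine_fun \<alpha> \<beta> \<gamma> x) = (\<lambda>x. (\<alpha> * (\<eta> x * affine_fun 1 0 0 x)
      + \<beta> * (\<eta> x * affine_fun 0 1 0 x)) + \<gamma> * (\<eta> x * affine_fun 0 0 1 x))"
    by (simp add: fun_eq_iff affine_fun_def algebra_simps)
  then show ?thesis
    using t[of 1 0 0] t[of 0 1 0] t[of 0 0 1]
    by (simp only: incompatibility_add incompatibility_cmult test_functions_add test_functions_cmult)
qed

end


section \<open>Combinations of derivatives of the Dirac measure\<close>

lemma dpd_funpow: "(dpd i ^^ n) S \<phi> = (- 1) ^ n * S ((pd i ^^ n) \<phi>)"
proof (induction n arbitrary: \<phi>)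
  case (Suc n)
  have "(dpd i ^^ Suc n) S \<phi> = - (dpd i ^^ n) S (pd i \<phi>)" by (simp add: dpd_def)
  also have "\<dots> = (- 1) ^ Suc n * S ((pd i ^^ n) (pd i \<phi>))" by (simp add: Suc)
  also have "(pd i ^^ n) (pd i \<phi>) = (pd i ^^ Suc n) \<phi>" by (simp add: funpow_swap1)
  finally show ?case .
qed simp

lemma dmpd_dirac:
  "dmpd \<alpha> dirac \<phi> = (- 1) ^ mi_order \<alpha> * fold pd (replicate (fst \<alpha>) 1 @ replicate (snd \<alpha>) 2) \<phi> 0"
  by (simp add: dmpd_def dpd_funpow dirac_def fold_replicate_funpow mi_order_def power_add)

lemma fold_pd_zero: "fold pd is (\<lambda>x. 0) = (\<lambda>x. 0)"
  by (induction "is") simp_all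

lemma fold_pd_affine_zero:
  assumes "2 \<le> length is"
  shows "fold pd is (affine_fun \<alpha> \<beta> \<gamma>) = (\<lambda>x. 0)"
proof -
  obtain i j js where "is = i # j # js"
    using assms by (metis Suc_le_length_iff numeral_2_eq_2)
  then show ?thesis by (simp add: pd_affine_fun fold_pd_zero)
qed

text \<open>Multi-indices outside the index set carry a zero coefficient, so every sum over an index set
  which only sees derivatives of order below two is the same first order expression.\<close>

lemma dirac_sum_first_order:
  fixes Nc :: "multiindex \<Rightarrow> real"
  assumes "finite S" "\<And>\<alpha>. \<alpha> \<notin> S \<Longrightarrow> Nc \<alpha> = 0"
    and high: "\<And>\<alpha>. \<alpha> \<in> S \<Longrightarrow> 2 \<le> mi_order \<alpha> \<Longrightarrow> dmpd \<alpha> dirac \<phi> = 0"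
  shows "(\<Sum>\<alpha>\<in>S. Nc \<alpha> * dmpd \<alpha> dirac \<phi>) = Nc (0, 0) * \<phi> 0 - Nc (1, 0) * pd 1 \<phi> 0 - Nc (0, 1) * pd 2 \<phi> 0"
proof -
  let ?f = "\<lambda>\<alpha>. Nc \<alpha> * dmpd \<alpha> dirac \<phi>"
  define B :: "multiindex set" where "B = {(0, 0), (1, 0), (0, 1)}"
  have B: "\<alpha> \<in> B" if "\<not> 2 \<le> mi_order \<alpha>" for \<alpha>
  proof -
    obtain a b where ab: "\<alpha> = (a, b)" by fastforce
    then have "a + b \<le> 1" using that by (simp add: mi_order_def)
    then show ?thesis unfolding ab B_def by auto
  qed
  have "sum ?f S = sum ?f (S \<inter> B)"
    by (rule sum.mono_neutral_right) (use assms(1) high B in auto)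
  also have "\<dots> = sum ?f B"
    by (rule sum.mono_neutral_left) (use assms(2) in \<open>auto simp: B_def\<close>)
  also have "\<dots> = Nc (0, 0) * \<phi> 0 - Nc (1, 0) * pd 1 \<phi> 0 - Nc (0, 1) * pd 2 \<phi> 0"
    by (simp add: B_def dmpd_dirac mi_order_def)
  finally show ?thesis .
qed

lemma dmpd_dirac_zero_near_origin:
  assumes "0 < \<delta>" "\<And>x. x \<in> ball 0 \<delta> \<Longrightarrow> \<phi> x = affine_fun a b c x" "2 \<le> mi_order \<alpha>"
  shows "dmpd \<alpha> dirac \<phi> = 0"
proof -
  let ?is = "replicate (fst \<alpha>) 1 @ replicate (snd \<alpha>) (2::2)"
  have "fold pd ?is \<phi> 0 = fold pd ?is (affine_fun a b c) 0"
    by (rule fold_pd_cong_open[of "ball 0 \<delta>"]) (use assms(1,2) in simp_all)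
  also have "\<dots> = 0"
    using fold_pd_affine_zero[of ?is a b c] assms(3) by (simp add: mi_order_def)
  finally show ?thesis by (simp add: dmpd_dirac)
qed

text \<open>If the index set were infinite, the sum would denote 0; but the degree of divergence of
  the zero distribution is minus infinity, so that its index set is empty.\<close>

lemma finite_index_set:
  assumes N: "dist_eq \<Omega> N (\<lambda>\<phi>. \<Sum>\<alpha> | ereal (real (mi_order \<alpha>)) \<le> div_degree r N. Nc \<alpha> * dmpd \<alpha> dirac \<phi>)"
    and sub: "ball 0 r \<subseteq> \<Omega>"
  shows "finite {\<alpha>. ereal (real (mi_order \<alpha>)) \<le> div_degree r N}" (is "finite ?S")
proof (rule ccontr)
  assume inf: "infinite ?S"
  have zero: "N \<phi> = 0" if "\<phi> \<in> test_functions (ball 0 r)" for \<phi>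
    using N test_functions_mono[OF that sub] inf by (simp add: dist_eq_def)
  have "((\<lambda>l. l powr k * pairing N (rescale l \<Phi>)) \<longlongrightarrow> 0) (at_right 0)"
    if "\<Phi> \<in> test_functions (ball 0 r)" for k and \<Phi> :: "real^2 \<Rightarrow> real"
  proof (rule tendsto_eventually)
    show "\<forall>\<^sub>F l in at_right 0. l powr k * pairing N (rescale l \<Phi>) = 0"
      by (rule eventually_at_rightI[of 0 1]) (simp_all add: pairing_real zero rescale_test[OF that])
  qed
  then have "scaling_degree r N = Inf (range ereal)"
    by (simp add: scaling_degree_def)
  also have "\<dots> = - \<infinity>"
    by (rule ereal_bot) (rule INF_lower[OF UNIV_I])
  finally have "div_degree r N = - \<infinity>" by (simp add: div_degree_def)
  then have "?S = {}" by simp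
  then have "finite ?S" by (simp only: finite.emptyI)
  with inf show False by blast
qed

lemma div_degree_neg:
  assumes "div_degree r T < 0"
  obtains k where "k < 2" "\<forall>\<Phi>\<in>test_functions (ball 0 r).
     ((\<lambda>l. l powr k * pairing T (rescale l \<Phi>)) \<longlongrightarrow> 0) (at_right 0)"
proof -
  have "scaling_degree r T < 2"
    using assms unfolding div_degree_def by (cases "scaling_degree r T") auto
  then obtain z where "z \<in> ereal ` {k. \<forall>\<Phi>\<in>test_functions (ball 0 r).
     ((\<lambda>l. l powr k * pairing T (rescale l \<Phi>)) \<longlongrightarrow> 0) (at_right 0)}" "z < 2"
    unfolding scaling_degree_def Inf_less_iff by blast
  then show ?thesis using that by auto
qed

lemma div_degree_le_plus_2:
  fixes S :: "'v::euclidean_space dist" and T :: "'w::euclidean_space dist"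
  assumes "\<And>k. \<forall>\<Phi>\<in>test_functions (ball 0 r). ((\<lambda>l. l powr k * pairing T (rescale l \<Phi>)) \<longlongrightarrow> 0) (at_right 0)
    \<Longrightarrow> \<forall>\<Phi>\<in>test_functions (ball 0 r). ((\<lambda>l. l powr (k + 2) * pairing S (rescale l \<Phi>)) \<longlongrightarrow> 0) (at_right 0)"
  shows "div_degree r S \<le> div_degree r T + 2"
proof -
  have "scaling_degree r S - 2 \<le> scaling_degree r T"
    unfolding scaling_degree_def[of r T]
  proof (rule Inf_greatest)
    fix z assume "z \<in> ereal ` {k. \<forall>\<Phi>\<in>test_functions (ball 0 r).
     ((\<lambda>l. l powr k * pairing T (rescale l \<Phi>)) \<longlongrightarrow> 0) (at_right 0)}"
    then obtain k where k: "z = ereal k" "\<forall>\<Phi>\<in>test_functions (ball 0 r).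
       ((\<lambda>l. l powr k * pairing T (rescale l \<Phi>)) \<longlongrightarrow> 0) (at_right 0)" by blast
    have "scaling_degree r S \<le> ereal (k + 2)"
      unfolding scaling_degree_def by (rule Inf_lower) (use assms[OF k(2)] in blast)
    then show "scaling_degree r S - 2 \<le> z"
      unfolding k(1) by (cases "scaling_degree r S") auto
  qed
  then show ?thesis unfolding div_degree_def
    by (cases "scaling_degree r T"; cases "scaling_degree r S") auto
qed


section \<open>The incompatibility equation\<close>

theorem lemma4p7:
  fixes \<Omega> :: "(real^2) set"
    and E :: "(real^2^2) dist" and E0 :: "real^2 \<Rightarrow> real^2^2"
    and N :: "real dist" and Nc :: "multiindex \<Rightarrow> real"
    and r \<epsilon> :: real
  assumes "open \<Omega>" and "bounded \<Omega>" and "simply_connected \<Omega>" and "0 \<in> \<Omega>"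
    and "0 < r" and "ball 0 r \<subseteq> \<Omega>"
    and "E \<in> sym_fields \<Omega>"
    and "given_by_smooth (\<Omega> - {0}) E E0"
    and "N \<in> point_fields \<Omega>"
    and "dist_eq \<Omega> N
           (\<lambda>\<phi>. \<Sum>\<alpha> | ereal (real (mi_order \<alpha>)) \<le> div_degree r N. Nc \<alpha> * dmpd \<alpha> dirac \<phi>)"
    and "\<And>\<alpha>. \<not> ereal (real (mi_order \<alpha>)) \<le> div_degree r N \<Longrightarrow> Nc \<alpha> = 0"
    and "0 < \<epsilon>" and "cball 0 \<epsilon> \<subseteq> \<Omega>"
  shows
    "let incompat = dist_eq \<Omega> (dCurl_vec (dCurl_mat E)) N;
         cond_i = (\<forall>x\<in>\<Omega> - {0}. curl_vec (curl_mat E0) x = 0);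
         cond_ii = (\<forall>x\<in>\<Omega> - {0}.
           line_integral (circle \<epsilon>)
             (\<lambda>y dy. E0 y *v dy + (curl_mat E0 y \<bullet> dy) *\<^sub>R cross_e3 (y - x))
           = - Nc (0, 1) *\<^sub>R axis 1 1 + Nc (1, 0) *\<^sub>R axis 2 1 + Nc (0, 0) *\<^sub>R e3_cross x);
         cond_iii = (div_degree r N \<le> div_degree r E + 2)
     in (incompat \<longrightarrow> cond_i \<and> cond_ii \<and> cond_iii) \<and>
        (div_degree r E < 0 \<longrightarrow> (incompat \<longleftrightarrow> cond_i \<and> cond_ii \<and> cond_iii))"
proof -
  note r_pos = assms(5) and ball_sub = assms(6)
    and N_eq = assms(10) and Nc_zero = assms(11)
    and \<epsilon> = assms(12) assms(13)
  define S where "S = {\<alpha>. ereal (real (mi_order \<alpha>)) \<le> div_degree r N}"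
  have fin: "finite S" unfolding S_def by (rule finite_index_set[OF N_eq ball_sub])
  have Nc0: "Nc \<alpha> = 0" if "\<alpha> \<notin> S" for \<alpha> using Nc_zero that by (simp add: S_def)
  have N_sum: "N \<phi> = (\<Sum>\<alpha>\<in>S. Nc \<alpha> * dmpd \<alpha> dirac \<phi>)" if "\<phi> \<in> test_functions \<Omega>" for \<phi>
    using N_eq that by (simp add: dist_eq_def S_def)
  interpret strain_field \<Omega> E E0
    using assms(1,7,8) by unfold_locales (simp_all add: sym_fields_def)
  define lhs where "lhs = (\<lambda>x. line_integral (circle \<epsilon>)
     (\<lambda>y dy. E0 y *v dy + (curl_mat E0 y \<bullet> dy) *\<^sub>R cross_e3 (y - x)))"
  define rhs where "rhs = (\<lambda>x. - Nc (0, 1) *\<^sub>R axis 1 1 + Nc (1, 0) *\<^sub>R axis 2 1 + Nc (0, 0) *\<^sub>R e3_cross x)"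
  define incompat where "incompat \<longleftrightarrow> dist_eq \<Omega> (dCurl_vec (dCurl_mat E)) N"
  define cond_i where "cond_i \<longleftrightarrow> (\<forall>x\<in>U. curl_vec (curl_mat E0) x = 0)"
  define cond_ii where "cond_ii \<longleftrightarrow> (\<forall>x\<in>U. lhs x = rhs x)"
  define cond_iii where "cond_iii \<longleftrightarrow> div_degree r N \<le> div_degree r E + 2"
  have incompat_iff: "incompat \<longleftrightarrow> (\<forall>\<phi>\<in>test_functions \<Omega>. incompatibility \<phi> = N \<phi>)"
    by (simp add: incompat_def dist_eq_def incompatibility_def)
  define s where "s = min r \<epsilon>"
  have s: "0 < s" "s \<le> \<epsilon>" "s \<le> r" using r_pos \<epsilon>(1) by (simp_all add: s_def)
  have s_sub: "cball 0 s \<subseteq> \<Omega>" using s(2) \<epsilon>(2) by (auto simp: subset_iff)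
  have N_affine: "N \<phi> = Nc (0, 0) * a - Nc (1, 0) * b - Nc (0, 1) * c"
    if \<phi>: "\<phi> \<in> test_functions \<Omega>" and "0 < \<delta>" and eq: "\<And>x. x \<in> ball 0 \<delta> \<Longrightarrow> \<phi> x = affine_fun a b c x" for \<phi> \<delta> a b c
  proof -
    have "N \<phi> = Nc (0, 0) * \<phi> 0 - Nc (1, 0) * pd 1 \<phi> 0 - Nc (0, 1) * pd 2 \<phi> 0"
      unfolding N_sum[OF \<phi>]
      by (rule dirac_sum_first_order[OF fin Nc0]) (use dmpd_dirac_zero_near_origin[OF \<open>0 < \<delta>\<close> eq] in blast)+
    moreover have "pd i \<phi> 0 = pd i (affine_fun a b c) 0" for i
      by (rule pd_cong_open[of "ball 0 \<delta>"]) (use \<open>0 < \<delta>\<close> eq in simp_all)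
    moreover have "\<phi> 0 = a" using eq[of 0] \<open>0 < \<delta>\<close> by (simp add: affine_fun_def)
    ultimately show ?thesis by (simp add: pd_affine_fun)
  qed
  have N_punctured: "N \<phi> = 0" if \<phi>: "\<phi> \<in> test_functions U" for \<phi>
  proof -
    have "open (- tsupport \<phi>)" "0 \<in> - tsupport \<phi>"
      using test_functionsD(3)[OF \<phi>] by (auto simp: open_Compl)
    then obtain \<delta> where \<delta>: "0 < \<delta>" "ball 0 \<delta> \<subseteq> - tsupport \<phi>"
      using open_contains_ball by blast
    have "N \<phi> = Nc (0, 0) * 0 - Nc (1, 0) * 0 - Nc (0, 1) * 0"
    proof (rule N_affine[OF test_functions_mono[OF \<phi>] \<delta>(1)])
      show "\<phi> x = affine_fun 0 0 0 x" if "x \<in> ball 0 \<delta>" for x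
        using zero_outside_tsupport[of x \<phi>] \<delta>(2) that by (auto simp: affine_fun_def)
    qed simp
    then show ?thesis by simp
  qed
  have rhs_nth: "rhs x $ 1 = - Nc (0, 1) - Nc (0, 0) * x $ 2" "rhs x $ 2 = Nc (1, 0) + Nc (0, 0) * x $ 1" for x
    by (simp_all add: rhs_def e3_cross_def axis_def)
  have part_i: cond_i if incompat
    unfolding cond_i_def curl_curl_zero_iff
  proof
    fix \<phi> :: "real^2 \<Rightarrow> real" assume \<phi>: "\<phi> \<in> test_functions U"
    have "\<phi> \<in> test_functions \<Omega>" by (rule test_functions_mono[OF \<phi>]) blast
    then show "incompatibility \<phi> = 0" using \<open>incompat\<close> N_punctured[OF \<phi>] by (simp add: incompat_iff)
  qed
  have part_iii: cond_iii if incompat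
    unfolding cond_iii_def
  proof (rule div_degree_le_plus_2, intro ballI)
    fix k and \<phi> :: "real^2 \<Rightarrow> real"
    assume k: "\<forall>\<Phi>\<in>test_functions (ball 0 r). ((\<lambda>l. l powr k * pairing E (rescale l \<Phi>)) \<longlongrightarrow> 0) (at_right 0)"
      and \<phi>: "\<phi> \<in> test_functions (ball 0 r)"
    have "((\<lambda>l. l powr (k + 2) * incompatibility (rescale l \<phi>)) \<longlongrightarrow> 0) (at_right 0)"
      by (rule incompatibility_rescale_tendsto[OF k \<phi> ball_sub])
    then show "((\<lambda>l. l powr (k + 2) * pairing N (rescale l \<phi>)) \<longlongrightarrow> 0) (at_right 0)"
    proof (rule Lim_transform_eventually)
      have "incompatibility (rescale l \<phi>) = N (rescale l \<phi>)" if "0 < l" "l < 1" for l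
        using \<open>incompat\<close> test_functions_mono[OF rescale_test[OF \<phi>, of l] ball_sub] that
        unfolding incompat_iff by simp
      then show "\<forall>\<^sub>F l in at_right 0. l powr (k + 2) * incompatibility (rescale l \<phi>) = l powr (k + 2) * pairing N (rescale l \<phi>)"
        by (intro eventually_at_rightI[of 0 1]) (simp_all add: pairing_real)
    qed
  qed
  \<comment> \<open>Under (i), condition (ii) says that both sides of the equation agree on cut off affine functions.\<close>
  have main: "(incompat \<longrightarrow> cond_ii) \<and> (cond_ii \<longrightarrow> cond_iii \<longrightarrow> div_degree r E < 0 \<longrightarrow> incompat)" if cond_i
  proof -
    have i: "\<forall>x\<in>U. curl_vec (curl_mat E0) x = 0" using \<open>cond_i\<close> by (simp add: cond_i_def)
    have supp: "\<forall>\<phi>\<in>test_functions U. incompatibility \<phi> = 0" using i curl_curl_zero_iff by blast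
    show ?thesis
    proof (rule cutoff_circulation[OF i \<epsilon> s(1,2)])
      fix \<eta> \<delta>
      assume \<eta>: "0 < \<delta>" "\<eta> \<in> test_functions (ball 0 s)" "\<And>x. x \<in> ball 0 \<delta> \<Longrightarrow> \<eta> x = 1"
        and circ: "\<And>\<alpha> \<beta> \<gamma>. incompatibility (\<lambda>x. \<eta> x * affine_fun \<alpha> \<beta> \<gamma> x) = circulation (form \<alpha> \<beta> \<gamma> 1) (form \<alpha> \<beta> \<gamma> 2) \<epsilon>"
      have \<eta>\<Omega>: "\<eta> \<in> test_functions \<Omega>"
        by (rule test_functions_mono[OF \<eta>(2)]) (use s_sub ball_subset_cball in blast)
      have cut_test: "(\<lambda>x. \<eta> x * affine_fun a b c x) \<in> test_functions \<Omega>" for a b c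
        by (intro test_functions_mult \<eta>\<Omega> smooth_on_affine_fun open_UNIV)
      define t0 where "t0 = incompatibility (\<lambda>x. \<eta> x * affine_fun 1 0 0 x)"
      define t1 where "t1 = incompatibility (\<lambda>x. \<eta> x * affine_fun 0 1 0 x)"
      define t2 where "t2 = incompatibility (\<lambda>x. \<eta> x * affine_fun 0 0 1 x)"
      have incompatibility_affine: "incompatibility (\<lambda>x. \<eta> x * affine_fun a b c x) = a * t0 + b * t1 + c * t2" for a b c
        unfolding t0_def t1_def t2_def by (rule incompatibility_cutoff_affine_linear[OF \<eta>\<Omega>])
      have N_cut: "N (\<lambda>x. \<eta> x * affine_fun a b c x) = Nc (0, 0) * a - Nc (1, 0) * b - Nc (0, 1) * c" for a b c
        by (rule N_affine[OF cut_test \<eta>(1)]) (simp add: \<eta>(3))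
      have lhs_nth: "lhs x $ 1 = t2 - x $ 2 * t0" "lhs x $ 2 = x $ 1 * t0 - t1" for x
        unfolding lhs_def line_integral_eq_circulation[OF \<epsilon>] circ[symmetric] incompatibility_affine by simp_all
      have ii_iff: "cond_ii \<longleftrightarrow> t0 = Nc (0, 0) \<and> t1 = - Nc (1, 0) \<and> t2 = - Nc (0, 1)"
      proof
        assume cond_ii
        then have ii: "lhs x $ k = rhs x $ k" if "x \<in> U" for x k
          using that by (simp add: cond_ii_def)
        \<comment> \<open>The identity at the two points on the coordinate axes already determines all three coefficients.\<close>
        have U: "axis k \<epsilon> \<in> U" for k :: 2
        proof -
          have "axis k \<epsilon> = \<epsilon> *\<^sub>R axis k (1::real)" by (simp add: vec_eq_iff axis_def)
          then have "norm (axis k \<epsilon> :: real^2) = \<epsilon>" using \<epsilon>(1) by simp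
          then have "axis k \<epsilon> \<in> cball (0::real^2) \<epsilon>" "axis k \<epsilon> \<noteq> (0::real^2)" using \<epsilon>(1) by auto
          then show ?thesis using \<epsilon>(2) by blast
        qed
        show "t0 = Nc (0, 0) \<and> t1 = - Nc (1, 0) \<and> t2 = - Nc (0, 1)"
          using ii[OF U[of 1], of 1] ii[OF U[of 2], of 1] ii[OF U[of 2], of 2] \<epsilon>(1)
          unfolding lhs_nth rhs_nth by (auto simp: axis_def)
      next
        assume "t0 = Nc (0, 0) \<and> t1 = - Nc (1, 0) \<and> t2 = - Nc (0, 1)"
        then show cond_ii
          unfolding cond_ii_def vec_eq_iff forall_2 lhs_nth rhs_nth by simp
      qed
      have "cond_ii" if incompat
      proof -
        have "a * t0 + b * t1 + c * t2 = Nc (0, 0) * a - Nc (1, 0) * b - Nc (0, 1) * c" for a b c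
          using \<open>incompat\<close> cut_test unfolding incompat_iff incompatibility_affine[symmetric] N_cut[symmetric] by blast
        from this[of 1 0 0] this[of 0 1 0] this[of 0 0 1] show ?thesis by (simp add: ii_iff)
      qed
      moreover have "incompat" if cond_ii cond_iii and neg: "div_degree r E < 0"
        unfolding incompat_iff
      proof
        fix \<phi> :: "real^2 \<Rightarrow> real" assume \<phi>: "\<phi> \<in> test_functions \<Omega>"
        obtain k where k: "k < 2" "\<forall>\<Phi>\<in>test_functions (ball 0 r).
           ((\<lambda>l. l powr k * pairing E (rescale l \<Phi>)) \<longlongrightarrow> 0) (at_right 0)"
          using div_degree_neg[OF neg] by blast
        have "incompatibility \<phi> = incompatibility (\<lambda>x. \<eta> x * affine_fun (\<phi> 0) (pd 1 \<phi> 0) (pd 2 \<phi> 0) x)"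
          by (rule incompatibility_depends_on_first_order_jet[OF supp k(2,1) ball_sub s(1) s_sub s(3) \<eta>(2,1,3) \<phi>])
        then have incompatibility_jet: "incompatibility \<phi> = \<phi> 0 * t0 + pd 1 \<phi> 0 * t1 + pd 2 \<phi> 0 * t2"
          unfolding incompatibility_affine .
        have "div_degree r N < 2"
        proof -
          have "div_degree r N \<le> div_degree r E + 2" using \<open>cond_iii\<close> by (simp add: cond_iii_def)
          also have "\<dots> < 2" using neg by (cases "div_degree r E") auto
          finally show ?thesis .
        qed
        then have low: "\<not> 2 \<le> mi_order \<alpha>" if "\<alpha> \<in> S" for \<alpha>
        proof -
          have "ereal (real (mi_order \<alpha>)) < 2"
            by (rule le_less_trans[OF _ \<open>div_degree r N < 2\<close>]) (use that in \<open>simp add: S_def\<close>)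
          then show ?thesis by simp
        qed
        have "N \<phi> = Nc (0, 0) * \<phi> 0 - Nc (1, 0) * pd 1 \<phi> 0 - Nc (0, 1) * pd 2 \<phi> 0"
          unfolding N_sum[OF \<phi>] by (rule dirac_sum_first_order[OF fin Nc0]) (use low in blast)+
        then show "incompatibility \<phi> = N \<phi>"
          using incompatibility_jet \<open>cond_ii\<close> unfolding ii_iff by simp
      qed
      ultimately show ?thesis by blast
    qed
  qed
  have "(incompat \<longrightarrow> cond_i \<and> cond_ii \<and> cond_iii) \<and>
     (div_degree r E < 0 \<longrightarrow> (incompat \<longleftrightarrow> cond_i \<and> cond_ii \<and> cond_iii))"
    using part_i part_iii main by blast
  then show ?thesis
    unfolding Let_def incompat_def cond_i_def cond_ii_def cond_iii_def lhs_def rhs_def .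
qed

end
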